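(* Let $G$ be a bipartite graph on $[d]$ and let $\mathcal{B}_G$ be the convex hull of $\{\mathbf{0},\pm\mathbf{e}_1,\ldots,\pm\mathbf{e}_d\}\cup\{\pm\mathbf{e}_i\pm\mathbf{e}_j:\{i,j\}\in E(G)\}\subset\mathbb{R}^d$. Then the following are equivalent: (i) the toric ideal $I_{\mathcal{B}_G}$ has a squarefree quadratic initial ideal (i.e., $\mathcal{B}_G$ has a flag regular unimodular triangulation); (ii) the toric ring $K[\mathcal{B}_G]$ is a Koszul algebra; (iii) $I_{\mathcal{B}_G}$ is generated by quadratic binomials; (iv) every cycle of $G$ of length $\ge6$ has a chord ($G$ is chordal bipartite).
   Context: $K$ is a field. For a lattice polytope $\mathcal{P}\subset\mathbb{R}^d$ with $\mathcal{P}\cap\mathbb{Z}^d=\{\mathbf{a}_1,\ldots,\mathbf{a}_n\}$, the toric ring $K[\mathcal{P}]$ is the subalgebra of $K[t_1^{\pm1},\ldots,t_d^{\pm1},s]$ generated by $\mathbf{t}^{\mathbf{a}_i}s$, graded by $\deg \mathbf{t}^{\mathbf{a}_i}s=1$, and the toric ideal $I_{\mathcal{P}}$ is the kernel of $K[x_1,\ldots,x_n]\to K[\mathcal{P}]$, $x_i\mapsto\mathbf{t}^{\mathbf{a}_i}s$. *)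

theory Defs
  imports "HOL-Analysis.Analysis" "HOL-Library.Poly_Mapping"
begin

text \<open>A simple graph on the vertex set \<^term>\<open>UNIV :: 'd set\<close> is given by its set \<open>E\<close> of
  two-element edges.\<close>

definition bipartite :: "'d set set \<Rightarrow> bool" where
  "bipartite E \<longleftrightarrow> (\<exists>V W. V \<union> W = UNIV \<and> V \<inter> W = {} \<and>
     (\<forall>e\<in>E. \<exists>v\<in>V. \<exists>w\<in>W. e = {v, w}))"

definition cycle_edges :: "'d list \<Rightarrow> 'd set set" where
  "cycle_edges vs = {{vs ! i, vs ! (Suc i mod length vs)} | i. i < length vs}"

definition is_cycle :: "'d set set \<Rightarrow> 'd list \<Rightarrow> bool" where
  "is_cycle E vs \<longleftrightarrow> 3 \<le> length vs \<and> distinct vs \<and> cycle_edges vs \<subseteq> E"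

definition has_chord :: "'d set set \<Rightarrow> 'd list \<Rightarrow> bool" where
  "has_chord E vs \<longleftrightarrow> (\<exists>e\<in>E. e \<subseteq> set vs \<and> e \<notin> cycle_edges vs)"

definition graph_polytope :: "'d set set \<Rightarrow> (real ^ 'd::finite) set" where
  "graph_polytope E = convex hull
     ({0} \<union> {\<sigma> *\<^sub>R axis i 1 | \<sigma> i. \<sigma> \<in> {-1, 1}} \<union>
      {\<sigma> *\<^sub>R axis i 1 + \<tau> *\<^sub>R axis j 1 | \<sigma> \<tau> i j. \<sigma> \<in> {-1, 1} \<and> \<tau> \<in> {-1, 1} \<and> {i, j} \<in> E})"

definition lattice_points :: "(real ^ 'd::finite) set \<Rightarrow> (int ^ 'd) set" where
  "lattice_points P = {a. (\<chi> i. real_of_int (a $ i)) \<in> P}"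

text \<open>Polynomials are finitely supported functions from exponent vectors to coefficients.
  The ring \<open>K[x\<^sub>a | a \<in> A]\<close> is the subring \<open>poly_ring A\<close> of those polynomials that only
  involve variables from \<open>A\<close>.\<close>

type_synonym 'v monom = "'v \<Rightarrow>\<^sub>0 nat"
type_synonym ('v, 'k) mpoly = "'v monom \<Rightarrow>\<^sub>0 'k"

definition monomials :: "'v set \<Rightarrow> 'v monom set" where
  "monomials A = {m. Poly_Mapping.keys m \<subseteq> A}"

definition poly_ring :: "'v set \<Rightarrow> ('v, 'k::field) mpoly set" where
  "poly_ring A = {p. Poly_Mapping.keys p \<subseteq> monomials A}"

definition mdeg :: "'v monom \<Rightarrow> nat" where
  "mdeg m = (\<Sum>a\<in>Poly_Mapping.keys m. Poly_Mapping.lookup m a)"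

definition sqfree_monom :: "'v monom \<Rightarrow> bool" where
  "sqfree_monom m \<longleftrightarrow> (\<forall>a. Poly_Mapping.lookup m a \<le> 1)"

abbreviation monom_poly :: "'v monom \<Rightarrow> ('v, 'k::field) mpoly" where
  "monom_poly m \<equiv> Poly_Mapping.single m 1"

definition ideal_gen :: "'v set \<Rightarrow> ('v, 'k::field) mpoly set \<Rightarrow> ('v, 'k) mpoly set" where
  "ideal_gen A S = {\<Sum>f\<in>T. q f * f | T q. finite T \<and> T \<subseteq> S \<and> (\<forall>f\<in>T. q f \<in> poly_ring A)}"

definition monomial_order :: "'v set \<Rightarrow> 'v monom rel \<Rightarrow> bool" where
  "monomial_order A r \<longleftrightarrow> linear_order_on (monomials A) r \<and>
     (\<forall>m\<in>monomials A. (0, m) \<in> r) \<and>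
     (\<forall>m n k. (m, n) \<in> r \<and> k \<in> monomials A \<longrightarrow> (m + k, n + k) \<in> r)"

definition lead_monom :: "'v monom rel \<Rightarrow> ('v, 'k::field) mpoly \<Rightarrow> 'v monom" where
  "lead_monom r f = (THE m. m \<in> Poly_Mapping.keys f \<and> (\<forall>n\<in>Poly_Mapping.keys f. (n, m) \<in> r))"

definition initial_ideal ::
    "'v set \<Rightarrow> 'v monom rel \<Rightarrow> ('v, 'k::field) mpoly set \<Rightarrow> ('v, 'k) mpoly set" where
  "initial_ideal A r I = ideal_gen A {monom_poly (lead_monom r f) | f. f \<in> I \<and> f \<noteq> 0}"

definition has_sqfree_quadratic_initial_ideal ::
    "'v set \<Rightarrow> ('v, 'k::field) mpoly set \<Rightarrow> bool" where
  "has_sqfree_quadratic_initial_ideal A I \<longleftrightarrow>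
     (\<exists>r M. monomial_order A r \<and>
        M \<subseteq> {m \<in> monomials A. mdeg m = 2 \<and> sqfree_monom m} \<and>
        initial_ideal A r I = ideal_gen A (monom_poly ` M))"

definition quadratic_binomials :: "'v set \<Rightarrow> ('v, 'k::field) mpoly set" where
  "quadratic_binomials A = {monom_poly u - monom_poly v | u v.
     u \<in> monomials A \<and> v \<in> monomials A \<and> u \<noteq> v \<and> mdeg u = 2 \<and> mdeg v = 2}"

definition generated_by_quadratic_binomials ::
    "'v set \<Rightarrow> ('v, 'k::field) mpoly set \<Rightarrow> bool" where
  "generated_by_quadratic_binomials A I \<longleftrightarrow>
     (\<exists>S \<subseteq> quadratic_binomials A. I = ideal_gen A S)"

text \<open>The ring \<open>K[t\<^sub>1\<^sup>\<plusminus>\<^sup>1, \<dots>, t\<^sub>d\<^sup>\<plusminus>\<^sup>1, s]\<close> is the monoid algebra of the additive monoid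
  \<open>\<int>\<^sup>d \<times> \<nat>\<close>; the key \<open>(a, k)\<close> stands for the monomial \<open>t\<^sup>a s\<^sup>k\<close>.\<close>

type_synonym ('d, 'k) laurent = "((int ^ 'd) \<times> nat) \<Rightarrow>\<^sub>0 'k"

definition toric_gen :: "int ^ 'd::finite \<Rightarrow> ('d, 'k::field) laurent" where
  "toric_gen a = Poly_Mapping.single (a, 1) 1"

definition is_subalgebra :: "('d::finite, 'k::field) laurent set \<Rightarrow> bool" where
  "is_subalgebra S \<longleftrightarrow> (\<forall>c. Poly_Mapping.single 0 c \<in> S) \<and>
     (\<forall>f\<in>S. \<forall>g\<in>S. f + g \<in> S \<and> f * g \<in> S)"

definition toric_ring :: "(real ^ 'd::finite) set \<Rightarrow> ('d, 'k::field) laurent set" where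
  "toric_ring P = is_subalgebra hull (toric_gen ` lattice_points P)"

text \<open>The \<open>K\<close>-algebra homomorphism with \<open>x\<^sub>a \<mapsto> t\<^sup>a s\<close>.\<close>

definition toric_hom :: "(int ^ 'd::finite, 'k::field) mpoly \<Rightarrow> ('d, 'k) laurent" where
  "toric_hom p = (\<Sum>m\<in>Poly_Mapping.keys p. Poly_Mapping.single 0 (Poly_Mapping.lookup p m) *
     (\<Prod>a\<in>Poly_Mapping.keys m. toric_gen a ^ Poly_Mapping.lookup m a))"

definition toric_ideal :: "(real ^ 'd::finite) set \<Rightarrow> (int ^ 'd, 'k::field) mpoly set" where
  "toric_ideal P = {p \<in> poly_ring (lattice_points P). toric_hom p = 0}"

text \<open>For a subalgebra \<open>R\<close> that is graded by the exponent of \<open>s\<close>, the residue field is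
  \<open>K = R / R\<^sub>+\<close> with \<open>R\<^sub>+\<close> the irrelevant ideal.\<close>

definition graded_part :: "('d::finite, 'k::field) laurent set \<Rightarrow> nat \<Rightarrow> ('d, 'k) laurent set" where
  "graded_part R k = {f \<in> R. \<forall>m\<in>Poly_Mapping.keys f. snd m = k}"

definition irrelevant_ideal :: "('d::finite, 'k::field) laurent set \<Rightarrow> ('d, 'k) laurent set" where
  "irrelevant_ideal R = {f \<in> R. \<forall>m\<in>Poly_Mapping.keys f. 0 < snd m}"

text \<open>A linear graded free resolution
  \<open>\<cdots> \<rightarrow> R(-2)\<^bsup>b 2\<^esup> \<rightarrow> R(-1)\<^bsup>b 1\<^esup> \<rightarrow> R \<rightarrow> K \<rightarrow> 0\<close>. The ranks are finite since the
  algebras in question are Noetherian. The map from homological degree \<open>Suc i\<close> to \<open>i\<close> sends a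
  row vector \<open>v\<close> to \<open>v \<cdot> D i\<close>; it is homogeneous of degree \<open>0\<close> for these shifts iff all entries
  of \<open>D i\<close> have degree \<open>1\<close>, and then the resolution is automatically minimal. The third conjunct
  is exactness at \<open>R\<close>, the last one exactness in all positive homological degrees.\<close>

definition linear_resolution :: "('d::finite, 'k::field) laurent set \<Rightarrow> (nat \<Rightarrow> nat) \<Rightarrow>
    (nat \<Rightarrow> nat \<Rightarrow> nat \<Rightarrow> ('d, 'k) laurent) \<Rightarrow> bool" where
  "linear_resolution R b D \<longleftrightarrow>
     b 0 = 1 \<and>
     (\<forall>i. \<forall>j<b (Suc i). \<forall>l<b i. D i j l \<in> graded_part R 1) \<and>
     {\<Sum>j<b 1. v j * D 0 j 0 | v. \<forall>j<b 1. v j \<in> R} = irrelevant_ideal R \<and>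
     (\<forall>i v. (\<forall>j<b (Suc i). v j \<in> R) \<longrightarrow>
        ((\<forall>l<b i. (\<Sum>j<b (Suc i). v j * D i j l) = 0) \<longleftrightarrow>
        (\<exists>w. (\<forall>k<b (Suc (Suc i)). w k \<in> R) \<and>
             (\<forall>j<b (Suc i). v j = (\<Sum>k<b (Suc (Suc i)). w k * D (Suc i) k j)))))"

definition koszul :: "('d::finite, 'k::field) laurent set \<Rightarrow> bool" where
  "koszul R \<longleftrightarrow> (\<exists>b D. linear_resolution R b D)"

end

theory Submission
  imports Defs
begin

text \<open>For a bipartite graph the lattice points of the polytope are the sign vectors supported on
  cliques. If the graph is chordal bipartite, its biadjacency matrix has a Gamma-free ordering. Order
  monomials by degree, then by total \<open>l\<^sub>1\<close>-norm, then reverse lexicographically along that ordering.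
  A monomial that is not minimal in its toric fibre then either contains two variables of opposite
  sign in some coordinate, which can be cancelled, or two variables \<open>x\<^sub>l x\<^sub>k\<close> for which Gamma-freeness
  provides a smaller product \<open>x\<^sub>a x\<^sub>f\<close>; so the initial ideal is squarefree and quadratic.

  Given a quadratic initial ideal, a Schreyer-type construction resolves the residue field: the
  leading terms of each syzygy module are of the form \<open>x\<^sub>z e\<^sub>w\<close>, because colon ideals of variables
  modulo quadratic monomials are again generated by variables. Hence the resolution is linear. Linear
  first syzygies in turn force the toric ideal to be generated in degree two. Finally, the two perfect
  matchings of a chordless cycle of length at least six form a toric fibre that no quadratic move
  connects.\<close>

section \<open>Exponent vectors, monoid algebras and toric ideals\<close>

text \<open>The toric map sends monomials to Laurent monomials, so its kernel only identifies
  monomials within a fibre of \<open>tdeg\<close>, and a monomial lies outside the initial ideal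
  exactly when it is smallest in its fibre; the field disappears from that condition. The obstacle
  for the resolution is that it lives over the toric ring, where a product of two standard monomials
  need not be standard, so multiplication may lower a leading term. A basis element is therefore
  measured by its normal form, and products are only bounded from above; equality is claimed only
  where a product is known to be standard. On the polytope side the obstacle is signs. Comparing the
  norm right after the degree makes minimal monomials free of cancellation, so that the sign of each
  coordinate is fixed by the fibre and the lattice points behave like edges of a bipartite graph;
  the origin and the single vertices correspond to edges through an extra vertex on either
  side.\<close>

abbreviation keys :: "('a \<Rightarrow>\<^sub>0 'b::zero) \<Rightarrow> 'a set" where "keys \<equiv> Poly_Mapping.keys"
abbreviation lookup :: "('a \<Rightarrow>\<^sub>0 'b::zero) \<Rightarrow> 'a \<Rightarrow> 'b" where "lookup \<equiv> Poly_Mapping.lookup"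
abbreviation single :: "'a \<Rightarrow> 'b::zero \<Rightarrow> 'a \<Rightarrow>\<^sub>0 'b" where "single \<equiv> Poly_Mapping.single"

text \<open>Linear functionals on exponent vectors. Coordinates of the multidegree, the total
  degree, norms and counts of variables with a given property are all instances, so relations
  between them follow from pointwise relations between the functions \<open>g\<close>.\<close>

definition wt :: "('v \<Rightarrow> int) \<Rightarrow> 'v monom \<Rightarrow> int" where
  "wt g m = (\<Sum>a\<in>keys m. int (lookup m a) * g a)"

lemma wt_superset:
  assumes "finite B" "keys m \<subseteq> B"
  shows "wt g m = (\<Sum>a\<in>B. int (lookup m a) * g a)"
  unfolding wt_def using assms
  by (intro sum.mono_neutral_left) (auto simp: in_keys_iff)

lemma wt_add: "wt g (m + n) = wt g m + wt g n"
proof -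
  let ?B = "keys m \<union> keys n"
  have "keys (m + n) \<subseteq> ?B" by (rule keys_add)
  then show ?thesis
    by (simp add: wt_superset[of ?B] lookup_add sum.distrib algebra_simps)
qed

lemma wt_zero [simp]: "wt g 0 = 0"
  by (simp add: wt_def)

lemma wt_single [simp]: "wt g (single a k) = int k * g a"
  by (simp add: wt_def)

lemma wt_sum: "wt g (\<Sum>i\<in>X. f i) = (\<Sum>i\<in>X. wt g (f i))"
  by (induction X rule: infinite_finite_induct) (auto simp: wt_add)

lemma wt_fun_sum: "wt (\<lambda>a. \<Sum>i\<in>X. g i a) m = (\<Sum>i\<in>X. wt (g i) m)"
  unfolding wt_def by (simp add: sum_distrib_left) (rule sum.swap)

lemma wt_fun_diff: "wt (\<lambda>a. g a - h a) m = wt g m - wt h m"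
  unfolding wt_def by (simp add: algebra_simps sum_subtractf)

lemma wt_cong: "(\<And>a. a \<in> keys m \<Longrightarrow> g a = h a) \<Longrightarrow> wt g m = wt h m"
  unfolding wt_def by (intro sum.cong) auto

lemma int_mdeg: "int (mdeg m) = wt (\<lambda>_. 1) m"
  by (simp add: wt_def mdeg_def)

lemma mdeg_add [simp]: "mdeg (m + n) = mdeg m + mdeg n"
proof -
  have "int (mdeg (m + n)) = int (mdeg m + mdeg n)"
    by (simp only: int_mdeg wt_add of_nat_add)
  then show ?thesis by (simp only: of_nat_eq_iff)
qed

lemma mdeg_zero [simp]: "mdeg 0 = 0"
  by (simp add: mdeg_def)

lemma mdeg_single [simp]: "mdeg (single a k) = k"
  by (cases "k = 0") (simp_all add: mdeg_def)

lemma mdeg_eq_0_iff [simp]: "mdeg m = 0 \<longleftrightarrow> m = 0"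
  by (auto simp: mdeg_def in_keys_iff poly_mapping_eq_iff fun_eq_iff)

lemma lookup_le_mdeg: "lookup m a \<le> mdeg m"
proof (cases "a \<in> keys m")
  case True
  then show ?thesis unfolding mdeg_def by (intro member_le_sum) auto
qed (simp add: in_keys_iff)

lemma monom_remove_var:
  fixes m :: "'v monom"
  assumes "a \<in> keys m"
  shows "m = (m - single a 1) + single a 1"
  using assms
  by (intro poly_mapping_eqI) (auto simp: lookup_add lookup_minus lookup_single in_keys_iff when_def)

lemma keys_add_monom: "keys (m + n :: 'v monom) = keys m \<union> keys n"
  by (auto simp: in_keys_iff lookup_add)

lemma monomials_add_iff [simp]: "m + n \<in> monomials A \<longleftrightarrow> m \<in> monomials A \<and> n \<in> monomials A"
  by (simp add: monomials_def keys_add_monom)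

lemma monomials_zero [simp]: "0 \<in> monomials A"
  by (simp add: monomials_def)

lemma monomials_var [simp]: "single a (Suc 0) \<in> monomials A \<longleftrightarrow> a \<in> A"
  by (simp add: monomials_def)

lemma monom_Suc_degE:
  assumes "mdeg m = Suc k"
  obtains a m' where "m = m' + single a 1" "mdeg m' = k" "a \<in> keys m"
proof -
  from assms have "m \<noteq> 0" by auto
  then obtain a where a: "a \<in> keys m" by (metis all_not_in_conv keys_eq_empty)
  have eq: "m = (m - single a 1) + single a 1"
    using a by (rule monom_remove_var)
  have "mdeg m = mdeg (m - single a 1) + 1"
    by (subst eq) simp
  then show ?thesis using that[OF eq _ a] assms by simp
qed

lemma monom_induct [case_names zero add]:
  fixes m :: "'v monom"
  assumes "P 0" "\<And>m a. P m \<Longrightarrow> P (m + single a 1)"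
  shows "P m"
proof (induction "mdeg m" arbitrary: m)
  case 0
  then show ?case using assms(1) by simp
next
  case (Suc k)
  then obtain a m' where "m = m' + single a 1" "mdeg m' = k"
    by (metis monom_Suc_degE)
  then show ?case using Suc assms(2) by auto
qed

text \<open>Finiteness in bounded degree gives every fibre of \<open>tdeg\<close> a smallest
  monomial and makes division terminate.\<close>

lemma finite_monomials_mdeg_le:
  assumes "finite A"
  shows "finite {m \<in> monomials A. mdeg m \<le> k}"
proof (rule finite_imageD)
  let ?f = "\<lambda>m. restrict (lookup m) A"
  have "?f ` {m \<in> monomials A. mdeg m \<le> k} \<subseteq> A \<rightarrow>\<^sub>E {..k}"
    using lookup_le_mdeg order_trans by (fastforce simp: PiE_def extensional_def)
  then show "finite (?f ` {m \<in> monomials A. mdeg m \<le> k})"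
    using finite_PiE[OF assms, of "\<lambda>_. {..k}"] finite_subset by blast
  show "inj_on ?f {m \<in> monomials A. mdeg m \<le> k}"
  proof (rule inj_onI)
    fix m n assume *: "m \<in> {m \<in> monomials A. mdeg m \<le> k}" "n \<in> {m \<in> monomials A. mdeg m \<le> k}"
      and eq: "?f m = ?f n"
    show "m = n"
    proof (rule poly_mapping_eqI)
      fix a
      show "lookup m a = lookup n a"
        using * fun_cong[OF eq, of a]
        by (cases "a \<in> A") (auto simp: monomials_def in_keys_iff subset_iff, metis neq0_conv)
    qed
  qed
qed

text \<open>The exponent of the image of \<open>m\<close> under the toric map. The degree appears as
  last component because every generator contains \<open>s\<close> exactly once.\<close>

definition tdeg :: "(int ^ 'd::finite) monom \<Rightarrow> (int ^ 'd) \<times> nat" where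
  "tdeg m = (\<chi> i. wt (\<lambda>a. a $ i) m, mdeg m)"

lemma tdeg_add: "tdeg (m + n) = tdeg m + tdeg n"
  by (simp add: tdeg_def wt_add vec_eq_iff)

lemma tdeg_zero [simp]: "tdeg 0 = 0"
  by (simp add: tdeg_def zero_prod_def vec_eq_iff)

lemma tdeg_var [simp]: "tdeg (single a (Suc 0)) = (a, Suc 0)"
  by (simp add: tdeg_def vec_eq_iff)

lemma snd_tdeg [simp]: "snd (tdeg m) = mdeg m"
  by (simp add: tdeg_def)

lemma tdeg_eq_iff: "tdeg m = tdeg n \<longleftrightarrow> (\<forall>i. wt (\<lambda>a. a $ i) m = wt (\<lambda>a. a $ i) n) \<and> mdeg m = mdeg n"
  by (simp add: tdeg_def vec_eq_iff)

lemma tdeg_eq_mdeg: "tdeg m = tdeg n \<Longrightarrow> mdeg m = mdeg n"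
  by (metis snd_tdeg)

text \<open>Distinct lattice points have distinct images, so degree two is the first in which
  relations can occur.\<close>

lemma tdeg_inj_mdeg_le_1:
  assumes "tdeg m = tdeg n" "mdeg m \<le> 1"
  shows "m = n"
proof (cases "mdeg m = 0")
  case True
  then show ?thesis using tdeg_eq_mdeg[OF assms(1)] by simp
next
  case False
  then have 1: "mdeg m = Suc 0" "mdeg n = Suc 0" using assms(2) tdeg_eq_mdeg[OF assms(1)] by linarith+
  from 1(1) obtain a m' where m: "m = m' + single a 1" "mdeg m' = 0"
    by (rule monom_Suc_degE)
  from 1(2) obtain b n' where n: "n = n' + single b 1" "mdeg n' = 0"
    by (rule monom_Suc_degE)
  show ?thesis using m n assms(1) by simp
qed

text \<open>The linear map induced by a map of index sets. For the additive \<open>tdeg\<close> it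
  is the toric ring homomorphism; for the section \<open>rep\<close> below it is merely a linear
  lift.\<close>

definition push :: "('a \<Rightarrow> 'b) \<Rightarrow> ('a \<Rightarrow>\<^sub>0 'k) \<Rightarrow> ('b \<Rightarrow>\<^sub>0 'k::comm_ring_1)" where
  "push h p = (\<Sum>m\<in>keys p. single (h m) (lookup p m))"

lemma push_superset:
  assumes "finite B" "keys p \<subseteq> B"
  shows "push h p = (\<Sum>m\<in>B. single (h m) (lookup p m))"
  unfolding push_def using assms
  by (intro sum.mono_neutral_left) (auto simp: in_keys_iff)

lemma push_add: "push h (p + q) = push h p + push h q"
proof -
  let ?B = "keys p \<union> keys q"
  have "keys (p + q) \<subseteq> ?B" by (rule keys_add)
  then show ?thesis
    by (simp add: push_superset[of ?B] lookup_add sum.distrib single_add)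
qed

lemma push_zero [simp]: "push h 0 = 0"
  by (simp add: push_def)

lemma push_single [simp]: "push h (single m c) = single (h m) c"
  by (cases "c = 0") (simp_all add: push_def)

lemma push_sum: "push h (\<Sum>i\<in>X. f i) = (\<Sum>i\<in>X. push h (f i))"
  by (induction X rule: infinite_finite_induct) (auto simp: push_add)

lemma push_diff: "push h (p - q) = push h p - push h q"
  by (metis add_diff_cancel diff_add_cancel push_add)

lemma poly_mapping_expand:
  "p = (\<Sum>m\<in>keys p. single m (lookup p m))"
proof (rule poly_mapping_eqI)
  fix m
  show "lookup p m = lookup
      (\<Sum>m\<in>keys p. single m (lookup p m)) m"
    by (simp add: lookup_sum lookup_single when_def in_keys_iff)
qed

lemma push_push: "push g (push h p) = push (g \<circ> h) p"
proof -
  have "push g (push h p) = (\<Sum>m\<in>keys p.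
      push g (single (h m) (lookup p m)))"
    unfolding push_def[of h] by (rule push_sum)
  then show ?thesis by (simp add: push_def[of "g \<circ> h"])
qed

lemma push_id [simp]: "push id p = p"
  using poly_mapping_expand[of p] by (simp add: push_def)

lemma push_cong: "(\<And>m. m \<in> keys p \<Longrightarrow> h m = g m) \<Longrightarrow> push h p = push g p"
  by (simp add: push_def)

lemma push_mult:
  assumes "\<And>m n. h (m + n) = h m + h n"
  shows "push h (p * q) = push h p * push h q"
proof -
  have "p * q = (\<Sum>m\<in>keys p. \<Sum>n\<in>keys q.
      single (m + n) (lookup p m * lookup q n))"
    using arg_cong2[OF poly_mapping_expand[of p] poly_mapping_expand[of q], of "(*)"]
    by (simp add: sum_product mult_single)
  then have "push h (p * q) = (\<Sum>m\<in>keys p. \<Sum>n\<in>keys q.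
      single (h m + h n) (lookup p m * lookup q n))"
    by (simp add: push_sum assms)
  then show ?thesis
    by (simp add: push_def[of h p] push_def[of h q] sum_product mult_single)
qed

lemma keys_push: "keys (push h p) \<subseteq> h ` keys p"
proof -
  have "keys (push h p) \<subseteq> (\<Union>m\<in>keys p. keys
      (single (h m) (lookup p m)))"
    unfolding push_def by (rule keys_sum)
  then show ?thesis by (auto split: if_splits)
qed

lemma lookup_push:
  "lookup (push h p) x = (\<Sum>m | m \<in> keys p \<and> h m = x. lookup p m)"
proof -
  have "lookup (push h p) x =
      (\<Sum>m\<in>keys p. if h m = x then lookup p m else 0)"
    by (auto simp: push_def lookup_sum lookup_single when_def intro!: sum.cong)
  also have "\<dots> = (\<Sum>m | m \<in> keys p \<and> h m = x. lookup p m)"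
    by (simp add: sum.If_cases Int_def)
  finally show ?thesis .
qed

text \<open>Cancellation in the exponent monoid makes the shift by \<open>k\<close> injective, so no
  two terms of \<open>f\<close> are merged.\<close>

lemma lookup_single_times:
  fixes f :: "'a::cancel_comm_monoid_add \<Rightarrow>\<^sub>0 'k::comm_ring_1"
  shows "lookup (single k c * f) (k + l) = c * lookup f l"
proof -
  have "single k c * f = (\<Sum>m\<in>keys f.
      single (k + m) (c * lookup f m))"
    using arg_cong[OF poly_mapping_expand[of f], of "(*) (single k c)"]
    by (simp add: sum_distrib_left mult_single)
  then show ?thesis
    by (simp add: lookup_sum lookup_single when_def in_keys_iff)
qed

lemma keys_single_times:
  "keys (single k c * f) \<subseteq> (+) k ` keys f"
  using keys_mult[of "single k c" f] by (auto split: if_splits)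

lemma keys_minus_subset:
  fixes p q :: "'a \<Rightarrow>\<^sub>0 'k::ab_group_add"
  shows "keys (p - q) \<subseteq> keys p \<union> keys q"
  by (auto simp: in_keys_iff lookup_minus)

lemma toric_gen_power: "toric_gen a ^ k = (single (tdeg (single a k)) 1 :: ('d::finite, 'k::field) laurent)"
proof (induction k)
  case (Suc k)
  have "single a (Suc k) = single a (Suc 0) + single a k"
    by (simp flip: single_add)
  then show ?case
    using Suc by (simp add: toric_gen_def mult_single tdeg_add del: One_nat_def) simp
qed simp

lemma toric_hom_eq_push: "toric_hom p = (push tdeg p :: ('d::finite, 'k::field) laurent)"
proof -
  have "(\<Prod>a\<in>B. toric_gen a ^ lookup m a) =
      (single (tdeg (\<Sum>a\<in>B. single a (lookup m a))) 1 :: ('d, 'k) laurent)"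
    if "finite B" for m B
    using that by induction (auto simp: toric_gen_power mult_single tdeg_add)
  then show ?thesis
    by (simp add: toric_hom_def push_def mult_single flip: poly_mapping_expand)
qed

section \<open>Polynomials in the variables from \<open>A\<close>, their ideals, and toric rings
  described by exponents\<close>

lemma poly_ring_add: "p \<in> poly_ring A \<Longrightarrow> q \<in> poly_ring A \<Longrightarrow> p + q \<in> poly_ring A"
  using keys_add[of p q] by (auto simp: poly_ring_def)

lemma poly_ring_zero [simp]: "0 \<in> poly_ring A"
  by (simp add: poly_ring_def)

lemma poly_ring_sum: "(\<And>i. i \<in> X \<Longrightarrow> f i \<in> poly_ring A) \<Longrightarrow> (\<Sum>i\<in>X. f i) \<in> poly_ring A"
  by (induction X rule: infinite_finite_induct) (auto intro: poly_ring_add)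

lemma poly_ring_diff: "p \<in> poly_ring A \<Longrightarrow> q \<in> poly_ring A \<Longrightarrow> p - q \<in> poly_ring A"
  using keys_minus_subset[of p q] by (auto simp: poly_ring_def)

lemma poly_ring_mult: "p \<in> poly_ring A \<Longrightarrow> q \<in> poly_ring A \<Longrightarrow> p * q \<in> poly_ring A"
  using keys_mult[of p q] by (fastforce simp: poly_ring_def)

lemma poly_ring_single: "m \<in> monomials A \<Longrightarrow> single m c \<in> poly_ring A"
  by (simp add: poly_ring_def)

lemma ideal_gen_zero [simp]: "0 \<in> ideal_gen A S"
  unfolding ideal_gen_def by (intro CollectI exI[of _ "{}"]) auto

lemma ideal_gen_mult_gen:
  assumes "f \<in> S" "q \<in> poly_ring A"
  shows "q * f \<in> ideal_gen A S"
  unfolding ideal_gen_def using assms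
  by (intro CollectI exI[of _ "{f}"] exI[of _ "\<lambda>_. q"]) auto

lemma ideal_gen_gen: "f \<in> S \<Longrightarrow> f \<in> ideal_gen A S"
  using ideal_gen_mult_gen[of f S "1" A] poly_ring_single[of 0 A 1] by simp

lemma ideal_gen_add:
  assumes "f \<in> ideal_gen A S" "g \<in> ideal_gen A S"
  shows "f + g \<in> ideal_gen A S"
proof -
  from assms(1) obtain T q where f: "f = (\<Sum>h\<in>T. q h * h)" "finite T" "T \<subseteq> S" "\<forall>h\<in>T. q h \<in> poly_ring A"
    unfolding ideal_gen_def by blast
  from assms(2) obtain T' q' where g: "g = (\<Sum>h\<in>T'. q' h * h)" "finite T'" "T' \<subseteq> S" "\<forall>h\<in>T'. q' h \<in> poly_ring A"
    unfolding ideal_gen_def by blast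
  define p where "p h = (if h \<in> T then q h else 0) + (if h \<in> T' then q' h else 0)" for h
  have "f = (\<Sum>h\<in>T \<union> T'. (if h \<in> T then q h else 0) * h)"
    unfolding f(1) using f g by (intro sum.mono_neutral_cong_left) auto
  moreover have "g = (\<Sum>h\<in>T \<union> T'. (if h \<in> T' then q' h else 0) * h)"
    unfolding g(1) using f g by (intro sum.mono_neutral_cong_left) auto
  ultimately have "f + g = (\<Sum>h\<in>T \<union> T'. p h * h)"
    by (simp add: p_def distrib_right sum.distrib)
  moreover have "\<forall>h\<in>T \<union> T'. p h \<in> poly_ring A"
    using f g by (auto simp: p_def intro: poly_ring_add)
  ultimately show ?thesis
    unfolding ideal_gen_def using f g by (intro CollectI exI[of _ "T \<union> T'"] exI[of _ p]) auto
qed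

lemma ideal_gen_sum: "(\<And>i. i \<in> X \<Longrightarrow> f i \<in> ideal_gen A S) \<Longrightarrow> (\<Sum>i\<in>X. f i) \<in> ideal_gen A S"
  by (induction X rule: infinite_finite_induct) (auto intro: ideal_gen_add)

lemma ideal_gen_mult:
  assumes "f \<in> ideal_gen A S" "p \<in> poly_ring A"
  shows "p * f \<in> ideal_gen A S"
proof -
  from assms(1) obtain T q where f: "f = (\<Sum>h\<in>T. q h * h)" "finite T" "T \<subseteq> S" "\<forall>h\<in>T. q h \<in> poly_ring A"
    unfolding ideal_gen_def by blast
  have "p * f = (\<Sum>h\<in>T. (p * q h) * h)"
    by (simp add: f(1) sum_distrib_left mult.assoc)
  also have "\<dots> \<in> ideal_gen A S"
    using f assms(2) by (intro ideal_gen_sum ideal_gen_mult_gen) (auto intro: poly_ring_mult)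
  finally show ?thesis .
qed

lemma ideal_gen_subset:
  assumes "S \<subseteq> ideal_gen A S'"
  shows "ideal_gen A S \<subseteq> ideal_gen A S'"
proof
  fix f assume "f \<in> ideal_gen A S"
  then obtain T q where f: "f = (\<Sum>h\<in>T. q h * h)" "finite T" "T \<subseteq> S" "\<forall>h\<in>T. q h \<in> poly_ring A"
    unfolding ideal_gen_def by blast
  show "f \<in> ideal_gen A S'"
    unfolding f(1) using f assms by (intro ideal_gen_sum ideal_gen_mult) auto
qed

definition tor_ideal :: "(int ^ 'd::finite) set \<Rightarrow> (int ^ 'd, 'k::field) mpoly set" where
  "tor_ideal A = {p \<in> poly_ring A. push tdeg p = 0}"

text \<open>An algebra generated by Laurent monomials is spanned by the semigroup of their
  exponents, so membership is a condition on keys alone.\<close>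

definition tor_ring :: "(int ^ 'd::finite) set \<Rightarrow> ('d, 'k::field) laurent set" where
  "tor_ring A = {f. keys f \<subseteq> tdeg ` monomials A}"

lemma toric_ideal_eq: "toric_ideal P = tor_ideal (lattice_points P)"
  by (simp add: toric_ideal_def tor_ideal_def toric_hom_eq_push)

lemma tor_ring_add: "f \<in> tor_ring A \<Longrightarrow> g \<in> tor_ring A \<Longrightarrow> f + g \<in> tor_ring A"
  using keys_add[of f g] by (auto simp: tor_ring_def)

lemma tor_ring_zero [simp]: "0 \<in> tor_ring A"
  by (simp add: tor_ring_def)

lemma tor_ring_diff: "f \<in> tor_ring A \<Longrightarrow> g \<in> tor_ring A \<Longrightarrow> f - g \<in> tor_ring A"
  using keys_minus_subset[of f g] by (auto simp: tor_ring_def)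

lemma tor_ring_sum: "(\<And>i. i \<in> X \<Longrightarrow> f i \<in> tor_ring A) \<Longrightarrow> (\<Sum>i\<in>X. f i) \<in> tor_ring A"
  by (induction X rule: infinite_finite_induct) (auto intro: tor_ring_add)

lemma tor_ring_mult:
  assumes "f \<in> tor_ring A" "g \<in> tor_ring A"
  shows "f * g \<in> tor_ring A"
  unfolding tor_ring_def
proof (intro CollectI subsetI)
  fix x assume "x \<in> keys (f * g)"
  then obtain y z where "x = y + z" "y \<in> keys f" "z \<in> keys g"
    using keys_mult[of f g] by blast
  moreover from this obtain m n where "m \<in> monomials A" "n \<in> monomials A" "y = tdeg m" "z = tdeg n"
    using assms unfolding tor_ring_def by blast
  ultimately show "x \<in> tdeg ` monomials A"
    by (intro image_eqI[of _ _ "m + n"]) (auto simp: tdeg_add)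
qed

lemma tor_ring_single: "m \<in> monomials A \<Longrightarrow> single (tdeg m) c \<in> tor_ring A"
  by (simp add: tor_ring_def)

lemma tor_ring_const: "single 0 c \<in> tor_ring A"
  using tor_ring_single[of 0 A c] by simp

lemma toric_ring_eq: "toric_ring P = (tor_ring (lattice_points P) :: ('d::finite, 'k::field) laurent set)"
proof (rule subset_antisym)
  let ?A = "lattice_points P"
  have "toric_gen ` ?A \<subseteq> tor_ring ?A"
  proof safe
    fix a assume "a \<in> ?A"
    then show "toric_gen a \<in> tor_ring ?A"
      using tor_ring_single[of "single a 1" ?A 1] by (simp add: toric_gen_def)
  qed
  moreover have "is_subalgebra (tor_ring ?A)"
    unfolding is_subalgebra_def by (auto intro: tor_ring_add tor_ring_mult tor_ring_const)
  ultimately show "toric_ring P \<subseteq> tor_ring ?A"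
    unfolding toric_ring_def by (intro hull_minimal)
next
  let ?A = "lattice_points P"
  have main: "tor_ring ?A \<subseteq> T" if T: "is_subalgebra T" "toric_gen ` ?A \<subseteq> T" for T :: "('d, 'k) laurent set"
  proof
    have mono: "single (tdeg m) 1 \<in> T" if "m \<in> monomials ?A" for m
      using that
    proof (induction m rule: monom_induct)
      case zero
      then show ?case using T(1) unfolding is_subalgebra_def by (metis tdeg_zero)
    next
      case (add m a)
      then have "toric_gen a \<in> T" "single (tdeg m) 1 \<in> T" using T(2) by auto
      then have "single (tdeg m) 1 * toric_gen a \<in> T"
        using T(1) by (simp add: is_subalgebra_def)
      then show ?case by (simp add: toric_gen_def mult_single tdeg_add)
    qed
    have monom_in: "single (tdeg m) c \<in> T" if "m \<in> monomials ?A" for m c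
    proof -
      have "single 0 c * single (tdeg m) 1 \<in> T"
        using mono[OF that] T(1) by (simp add: is_subalgebra_def)
      then show ?thesis by (simp add: mult_single)
    qed
    have sum: "(\<Sum>i\<in>X. f i) \<in> T" if "\<And>i. i \<in> X \<Longrightarrow> f i \<in> T" for X :: "((int ^ 'd) \<times> nat) set" and f
      using that T(1)
    proof (induction X rule: infinite_finite_induct)
      case (infinite X)
      have "single 0 0 \<in> T" using T(1) unfolding is_subalgebra_def by blast
      then show ?case using infinite by simp
    next
      case empty
      have "single 0 0 \<in> T" using T(1) unfolding is_subalgebra_def by blast
      then show ?case by simp
    qed (auto simp: is_subalgebra_def)
    fix f :: "('d, 'k) laurent" assume f: "f \<in> tor_ring ?A"
    have "(\<Sum>x\<in>keys f. single x (lookup f x)) \<in> T"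
      by (rule sum) (use f in \<open>auto simp: tor_ring_def intro!: monom_in\<close>)
    then show "f \<in> T" by (simp flip: poly_mapping_expand)
  qed
  show "tor_ring ?A \<subseteq> (toric_ring P :: ('d, 'k) laurent set)"
    unfolding toric_ring_def hull_def
    by (rule Inter_greatest) (elim CollectE conjE, rule main)
qed

lemma push_tdeg_in_tor_ring: "p \<in> poly_ring A \<Longrightarrow> push tdeg p \<in> tor_ring A"
  using keys_push[of tdeg p] unfolding tor_ring_def poly_ring_def by blast

lemma tor_ideal_binomial:
  assumes "u \<in> monomials A" "v \<in> monomials A" "tdeg u = tdeg v"
  shows "monom_poly u - monom_poly v \<in> tor_ideal A"
  using assms by (simp add: tor_ideal_def push_diff poly_ring_diff poly_ring_single)

text \<open>Over each fibre the coefficients of an element of the kernel sum to zero, so no fibre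
  meets the support in a single monomial.\<close>

lemma tor_ideal_other_key:
  assumes "p \<in> tor_ideal A" "u \<in> keys p"
  obtains v where "v \<in> keys p" "v \<noteq> u" "tdeg v = tdeg u"
proof -
  have "\<exists>v\<in>keys p. v \<noteq> u \<and> tdeg v = tdeg u"
  proof (rule ccontr)
    assume "\<not> ?thesis"
    then have "{m. m \<in> keys p \<and> tdeg m = tdeg u} = {u}" using assms(2) by auto
    then have "lookup (push tdeg p) (tdeg u) = lookup p u"
      by (simp add: lookup_push)
    then show False using assms by (simp add: tor_ideal_def in_keys_iff)
  qed
  then show ?thesis using that by blast
qed

lemma ideal_gen_subset_tor_ideal:
  assumes "S \<subseteq> tor_ideal A"
  shows "ideal_gen A S \<subseteq> tor_ideal A"
proof
  fix f assume "f \<in> ideal_gen A S"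
  then obtain T q where f: "f = (\<Sum>h\<in>T. q h * h)" "finite T" "T \<subseteq> S" "\<forall>h\<in>T. q h \<in> poly_ring A"
    unfolding ideal_gen_def by blast
  have "push tdeg f = 0"
    unfolding f(1) push_sum
  proof (rule sum.neutral, safe)
    fix h assume "h \<in> T"
    then have "push tdeg h = 0" using f assms by (auto simp: tor_ideal_def)
    then show "push tdeg (q h * h) = 0" by (simp add: push_mult[OF tdeg_add])
  qed
  moreover have "f \<in> poly_ring A"
    unfolding f(1) using f assms by (intro poly_ring_sum poly_ring_mult) (auto simp: tor_ideal_def)
  ultimately show "f \<in> tor_ideal A" by (simp add: tor_ideal_def)
qed

section \<open>Standard monomials and initial ideals\<close>

abbreviation var :: "'v \<Rightarrow> 'v monom" where
  "var a \<equiv> single a (Suc 0)"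

text \<open>Being smallest in the fibre is the combinatorial form of not lying in the initial ideal,
  as \<open>lead_monoms_tor_ideal\<close> confirms; it mentions no field.\<close>

definition standard :: "(int ^ 'd::finite) set \<Rightarrow> (int ^ 'd) monom rel \<Rightarrow> (int ^ 'd) monom \<Rightarrow> bool" where
  "standard A r m \<longleftrightarrow> m \<in> monomials A \<and> (\<forall>n\<in>monomials A. tdeg n = tdeg m \<longrightarrow> (m, n) \<in> r)"

locale monom_order =
  fixes A :: "(int ^ 'd::finite) set" and r :: "(int ^ 'd) monom rel"
  assumes mo: "monomial_order A r" and fin: "finite A"
begin

abbreviation lt where "lt m n \<equiv> (m, n) \<in> r \<and> m \<noteq> n"
abbreviation std where "std \<equiv> standard A r"

lemma r_refl: "m \<in> monomials A \<Longrightarrow> (m, m) \<in> r"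
  using mo by (auto simp: monomial_order_def order_on_defs refl_on_def)

lemma r_trans: "(m, n) \<in> r \<Longrightarrow> (n, k) \<in> r \<Longrightarrow> (m, k) \<in> r"
  using mo unfolding monomial_order_def order_on_defs trans_def by blast

lemma r_antisym: "(m, n) \<in> r \<Longrightarrow> (n, m) \<in> r \<Longrightarrow> m = n"
  using mo by (auto simp: monomial_order_def order_on_defs antisym_def)

lemma r_total: "m \<in> monomials A \<Longrightarrow> n \<in> monomials A \<Longrightarrow> (m, n) \<in> r \<or> (n, m) \<in> r"
  using mo r_refl unfolding monomial_order_def linear_order_on_def total_on_def by metis

lemma r_dom: "(m, n) \<in> r \<Longrightarrow> m \<in> monomials A \<and> n \<in> monomials A"
  using mo by (auto simp: monomial_order_def order_on_defs)

lemma r_add: "(m, n) \<in> r \<Longrightarrow> k \<in> monomials A \<Longrightarrow> (m + k, n + k) \<in> r"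
  using mo unfolding monomial_order_def by blast

lemma lt_add: "lt m n \<Longrightarrow> k \<in> monomials A \<Longrightarrow> lt (m + k) (n + k)"
  using r_add by auto

lemma r_add_cancel:
  assumes "(m + k, n + k) \<in> r"
  shows "(m, n) \<in> r"
proof (rule ccontr)
  assume *: "(m, n) \<notin> r"
  have "m \<in> monomials A" "n \<in> monomials A" "k \<in> monomials A" using r_dom[OF assms] by auto
  then have "lt n m" using * r_total r_refl by auto
  then have "lt (n + k) (m + k)" using lt_add \<open>k \<in> monomials A\<close> by blast
  then show False using assms r_antisym by blast
qed

lemma r_min:
  assumes "finite X" "X \<noteq> {}" "X \<subseteq> monomials A"
  shows "\<exists>m\<in>X. \<forall>n\<in>X. (m, n) \<in> r"
  using assms
proof (induction X rule: finite_ne_induct)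
  case (singleton x)
  then show ?case using r_refl by auto
next
  case (insert x F)
  then obtain m where m: "m \<in> F" "\<forall>n\<in>F. (m, n) \<in> r" by auto
  show ?case
  proof (cases "(m, x) \<in> r")
    case True
    then show ?thesis using m by auto
  next
    case False
    then have xm: "(x, m) \<in> r" using r_total m insert.prems by auto
    then show ?thesis using m r_trans[OF xm] r_refl insert.prems by (intro bexI[of _ x]) auto
  qed
qed

lemma r_max:
  assumes "finite X" "X \<noteq> {}" "X \<subseteq> monomials A"
  shows "\<exists>m\<in>X. \<forall>n\<in>X. (n, m) \<in> r"
  using assms
proof (induction X rule: finite_ne_induct)
  case (singleton x)
  then show ?case using r_refl by auto
next
  case (insert x F)
  then obtain m where m: "m \<in> F" "\<forall>n\<in>F. (n, m) \<in> r" by auto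
  show ?case
  proof (cases "(x, m) \<in> r")
    case True
    then show ?thesis using m by auto
  next
    case False
    then have mx: "(m, x) \<in> r" using r_total m insert.prems by auto
    then show ?thesis using m r_trans[OF _ mx] r_refl insert.prems by (intro bexI[of _ x]) auto
  qed
qed

lemma std_exists:
  assumes "m \<in> monomials A"
  shows "\<exists>n. std n \<and> tdeg n = tdeg m"
proof -
  let ?X = "{n \<in> monomials A. tdeg n = tdeg m}"
  have "?X \<subseteq> {n \<in> monomials A. mdeg n \<le> mdeg m}" using tdeg_eq_mdeg by fastforce
  then have "finite ?X" using finite_monomials_mdeg_le[OF fin] finite_subset by blast
  then obtain n where "n \<in> ?X" "\<forall>k\<in>?X. (n, k) \<in> r" using r_min[of ?X] assms by auto
  then show ?thesis by (intro exI[of _ n]) (auto simp: standard_def)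
qed

lemma std_unique: "std m \<Longrightarrow> std n \<Longrightarrow> tdeg m = tdeg n \<Longrightarrow> m = n"
  using r_antisym by (auto simp: standard_def)

text \<open>If a factor could be lowered within its fibre, the same replacement would lower the
  product.\<close>

lemma std_factor:
  assumes "std (m + k)"
  shows "std m"
  unfolding standard_def
proof (intro conjI ballI impI)
  show "m \<in> monomials A" using assms by (simp add: standard_def)
  fix n assume "n \<in> monomials A" "tdeg n = tdeg m"
  then have "(m + k, n + k) \<in> r" using assms by (simp add: standard_def tdeg_add)
  then show "(m, n) \<in> r" by (rule r_add_cancel)
qed

lemma not_std_smaller:
  assumes "m \<in> monomials A" "\<not> std m"
  obtains n where "lt n m" "tdeg n = tdeg m" "std n"
proof -
  obtain n where n: "std n" "tdeg n = tdeg m" using std_exists assms by blast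
  then have "(n, m) \<in> r" using assms by (simp add: standard_def)
  moreover have "n \<noteq> m" using n assms by auto
  ultimately show ?thesis using n that by blast
qed

lemma not_std_if_smaller:
  assumes "lt n m" "tdeg n = tdeg m"
  shows "\<not> std m"
proof
  assume "std m"
  then have "(m, n) \<in> r" using assms r_dom by (auto simp: standard_def)
  then show False using assms r_antisym by blast
qed

lemma std_deg_le_1:
  assumes "m \<in> monomials A" "mdeg m \<le> 1"
  shows "std m"
  using assms tdeg_inj_mdeg_le_1 r_refl unfolding standard_def by (metis)

lemma lead_monom_props:
  assumes "p \<in> poly_ring A" "p \<noteq> 0"
  shows "lead_monom r p \<in> keys p" "\<And>n. n \<in> keys p \<Longrightarrow> (n, lead_monom r p) \<in> r"
proof -
  from r_max[of "keys p"] assms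
  obtain m where m: "m \<in> keys p" "\<forall>n\<in>keys p. (n, m) \<in> r"
    by (auto simp: poly_ring_def)
  then have "lead_monom r p = m"
    unfolding lead_monom_def by (intro the_equality) (use r_antisym in auto)
  with m show "lead_monom r p \<in> keys p" "\<And>n. n \<in> keys p \<Longrightarrow> (n, lead_monom r p) \<in> r"
    by auto
qed

text \<open>A leading monomial shares its fibre with another, smaller key of the same polynomial.
  Conversely, the binomial of \<open>m\<close> and a smaller monomial of its fibre leads with
  \<open>m\<close>.\<close>

lemma lead_monoms_tor_ideal:
  "{lead_monom r f | f. f \<in> (tor_ideal A :: (int ^ 'd, 'k::field) mpoly set) \<and> f \<noteq> 0} = {m \<in> monomials A. \<not> std m}"
proof (intro equalityI subsetI)
  fix m assume "m \<in> {lead_monom r f | f. f \<in> (tor_ideal A :: (int ^ 'd, 'k) mpoly set) \<and> f \<noteq> 0}"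
  then obtain f :: "(int ^ 'd, 'k) mpoly" where f: "m = lead_monom r f" "f \<in> tor_ideal A" "f \<noteq> 0" by blast
  then have pr: "f \<in> poly_ring A" by (simp add: tor_ideal_def)
  note lm = lead_monom_props[OF pr f(3)]
  obtain v where v: "v \<in> keys f" "v \<noteq> m" "tdeg v = tdeg m"
    using tor_ideal_other_key[OF f(2)] lm(1) f(1) by blast
  then have "lt v m" using lm(2) f(1) by auto
  then show "m \<in> {m \<in> monomials A. \<not> std m}" using not_std_if_smaller v r_dom by blast
next
  fix m assume "m \<in> {m \<in> monomials A. \<not> std m}"
  then have m: "m \<in> monomials A" "\<not> std m" by auto
  then obtain n where n: "lt n m" "tdeg n = tdeg m" by (rule not_std_smaller)
  let ?f = "monom_poly m - monom_poly n :: (int ^ 'd, 'k) mpoly"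
  have keys: "keys ?f = {m, n}"
    using n by (auto simp: in_keys_iff lookup_minus lookup_single when_def split: if_splits)
  then have nz: "?f \<noteq> 0" by auto
  have tor: "?f \<in> tor_ideal A" using m n r_dom by (intro tor_ideal_binomial) auto
  then have pr: "?f \<in> poly_ring A" by (simp add: tor_ideal_def)
  have "lead_monom r ?f \<in> {m, n}" using lead_monom_props(1)[OF pr nz] keys by simp
  moreover have "(m, lead_monom r ?f) \<in> r" using lead_monom_props(2)[OF pr nz, of m] keys by simp
  ultimately have "lead_monom r ?f = m" using n r_antisym[of m n] by auto
  then show "m \<in> {lead_monom r f | f. f \<in> (tor_ideal A :: (int ^ 'd, 'k) mpoly set) \<and> f \<noteq> 0}" using tor nz by force
qed

lemma initial_ideal_tor_ideal:
  "initial_ideal A r (tor_ideal A :: (int ^ 'd, 'k::field) mpoly set) =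
     ideal_gen A (monom_poly ` {m \<in> monomials A. \<not> std m})"
proof -
  have "{monom_poly (lead_monom r f) :: (int ^ 'd, 'k) mpoly | f. f \<in> (tor_ideal A :: (int ^ 'd, 'k) mpoly set) \<and> f \<noteq> 0}
      = monom_poly ` {lead_monom r f | f. f \<in> (tor_ideal A :: (int ^ 'd, 'k) mpoly set) \<and> f \<noteq> 0}"
    by blast
  then show ?thesis by (simp add: initial_ideal_def lead_monoms_tor_ideal)
qed

end

text \<open>A key of a sum is a key of some summand, and each summand is a multiple of one
  generator.\<close>

lemma monom_poly_in_ideal_gen_iff:
  fixes M :: "'v monom set"
  assumes "M \<subseteq> monomials A"
  shows "(monom_poly u :: ('v, 'k::field) mpoly) \<in> ideal_gen A (monom_poly ` M)
    \<longleftrightarrow> u \<in> monomials A \<and> (\<exists>m\<in>M. \<exists>k. u = k + m)"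
proof
  assume "(monom_poly u :: ('v, 'k) mpoly) \<in> ideal_gen A (monom_poly ` M)"
  then obtain T and q :: "('v, 'k) mpoly \<Rightarrow> ('v, 'k) mpoly"
    where T: "monom_poly u = (\<Sum>f\<in>T. q f * f)" "finite T" "T \<subseteq> monom_poly ` M" "\<forall>f\<in>T. q f \<in> poly_ring A"
    unfolding ideal_gen_def by blast
  have "u \<in> keys (\<Sum>f\<in>T. q f * f)" by (simp flip: T(1))
  then obtain f where f: "f \<in> T" "u \<in> keys (q f * f)" using keys_sum[of "\<lambda>f. q f * f" T] by blast
  then obtain m where m: "m \<in> M" "f = monom_poly m" using T by auto
  obtain k where k: "k \<in> keys (q f)" "u = k + m"
    using keys_mult[of "q f" f] f m by auto
  moreover have "k \<in> monomials A" using k f T by (auto simp: poly_ring_def)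
  ultimately show "u \<in> monomials A \<and> (\<exists>m\<in>M. \<exists>k. u = k + m)" using m assms by auto
next
  assume "u \<in> monomials A \<and> (\<exists>m\<in>M. \<exists>k. u = k + m)"
  then obtain m k where mk: "m \<in> M" "u = k + m" "k \<in> monomials A" by auto
  have "(monom_poly k * monom_poly m :: ('v, 'k) mpoly) \<in> ideal_gen A (monom_poly ` M)"
    using mk by (intro ideal_gen_mult_gen) (auto intro: poly_ring_single)
  then show "(monom_poly u :: ('v, 'k) mpoly) \<in> ideal_gen A (monom_poly ` M)"
    using mk by (simp add: mult_single)
qed

lemma mdeg_2E:
  assumes "mdeg m = 2"
  obtains a b where "m = var a + var b"
proof -
  obtain b m' where b: "m = m' + var b" "mdeg m' = 1"
    using assms monom_Suc_degE[of m 1] by (metis One_nat_def Suc_1)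
  obtain a m'' where a: "m' = m'' + var a" "mdeg m'' = 0"
    using b(2) monom_Suc_degE[of m' 0] by (metis One_nat_def)
  then show ?thesis using b that by simp
qed

text \<open>The field-free content of condition (i); the requirement \<open>a \<noteq> b\<close> is
  squarefreeness of the generators.\<close>

definition quadratic_order :: "(int ^ 'd::finite) set \<Rightarrow> (int ^ 'd) monom rel \<Rightarrow> bool" where
  "quadratic_order A r \<longleftrightarrow> monomial_order A r \<and>
     (\<forall>m\<in>monomials A. \<not> standard A r m \<longrightarrow>
       (\<exists>a b k. a \<noteq> b \<and> m = k + (var a + var b) \<and> \<not> standard A r (var a + var b)))"

text \<open>Both ideals are generated by monomials, so they are compared through the monomials they
  contain. In the converse direction \<open>M\<close> consists of all nonstandard products of two
  different variables.\<close>

lemma has_sqfree_quadratic_initial_ideal_iff: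
  assumes "finite A"
  shows "has_sqfree_quadratic_initial_ideal A (tor_ideal A :: (int ^ 'd::finite, 'k::field) mpoly set)
    \<longleftrightarrow> (\<exists>r. quadratic_order A r)"
proof
  assume "has_sqfree_quadratic_initial_ideal A (tor_ideal A :: (int ^ 'd, 'k) mpoly set)"
  then obtain r M where r: "monomial_order A r"
    and M: "M \<subseteq> {m \<in> monomials A. mdeg m = 2 \<and> sqfree_monom m}"
    and eq: "initial_ideal A r (tor_ideal A :: (int ^ 'd, 'k) mpoly set) = ideal_gen A (monom_poly ` M)"
    unfolding has_sqfree_quadratic_initial_ideal_def by blast
  interpret monom_order A r using r assms by unfold_locales
  have MA: "M \<subseteq> monomials A" using M by auto
  have NA: "{m \<in> monomials A. \<not> std m} \<subseteq> monomials A" by auto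
  have eq': "(monom_poly u :: (int ^ 'd, 'k) mpoly) \<in> ideal_gen A (monom_poly ` {m \<in> monomials A. \<not> std m})
      \<longleftrightarrow> (monom_poly u :: (int ^ 'd, 'k) mpoly) \<in> ideal_gen A (monom_poly ` M)" for u
    unfolding eq[symmetric] initial_ideal_tor_ideal ..
  have nstd: "\<not> std q" if "q \<in> M" for q
  proof -
    have "(monom_poly q :: (int ^ 'd, 'k) mpoly) \<in> ideal_gen A (monom_poly ` M)"
      using that by (intro ideal_gen_gen) auto
    then obtain m k where "\<not> std m" "q = k + m"
      using eq'[of q] monom_poly_in_ideal_gen_iff[OF NA] by blast
    then show ?thesis using std_factor[of m k] by (auto simp: add.commute)
  qed
  have "\<exists>a b k. a \<noteq> b \<and> m = k + (var a + var b) \<and> \<not> std (var a + var b)"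
    if m: "m \<in> monomials A" "\<not> std m" for m
  proof -
    have "(monom_poly m :: (int ^ 'd, 'k) mpoly) \<in> ideal_gen A (monom_poly ` {m \<in> monomials A. \<not> std m})"
      using m by (intro ideal_gen_gen) auto
    then obtain q k where q: "q \<in> M" "m = k + q"
      using eq'[of m] monom_poly_in_ideal_gen_iff[OF MA] by blast
    then have "mdeg q = 2" "sqfree_monom q" using M by auto
    then obtain a b where ab: "q = var a + var b" by (elim mdeg_2E)
    have "lookup q a \<le> 1" using \<open>sqfree_monom q\<close> by (simp add: sqfree_monom_def)
    then have "a \<noteq> b" unfolding ab by (auto simp: lookup_add)
    then show ?thesis using ab q nstd by blast
  qed
  then show "\<exists>r. quadratic_order A r" using r by (auto simp: quadratic_order_def)
next
  assume "\<exists>r. quadratic_order A r"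
  then obtain r where r: "quadratic_order A r" ..
  then have mo: "monomial_order A r" by (simp add: quadratic_order_def)
  interpret monom_order A r using mo assms by unfold_locales
  define M where "M = {var a + var b | a b. a \<noteq> b \<and> a \<in> A \<and> b \<in> A \<and> \<not> std (var a + var b)}"
  have MA: "M \<subseteq> {m \<in> monomials A. \<not> std m}" unfolding M_def by auto
  then have MA': "M \<subseteq> monomials A" by auto
  have sq: "M \<subseteq> {m \<in> monomials A. mdeg m = 2 \<and> sqfree_monom m}"
    unfolding M_def sqfree_monom_def by (auto simp: lookup_add lookup_single when_def)
  have "(monom_poly m :: (int ^ 'd, 'k) mpoly) \<in> ideal_gen A (monom_poly ` M)"
    if m: "m \<in> monomials A" "\<not> std m" for m
  proof -
    obtain a b k where ab: "a \<noteq> b" "m = k + (var a + var b)" "\<not> std (var a + var b)"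
      using r m unfolding quadratic_order_def by blast
    then have "var a + var b \<in> M" using m unfolding M_def by auto
    then show ?thesis using m ab unfolding monom_poly_in_ideal_gen_iff[OF MA'] by blast
  qed
  then have "ideal_gen A (monom_poly ` {m \<in> monomials A. \<not> std m}) \<subseteq> (ideal_gen A (monom_poly ` M) :: (int ^ 'd, 'k) mpoly set)"
    by (intro ideal_gen_subset) auto
  moreover have "(ideal_gen A (monom_poly ` M) :: (int ^ 'd, 'k) mpoly set) \<subseteq> ideal_gen A (monom_poly ` {m \<in> monomials A. \<not> std m})"
    using MA by (intro ideal_gen_subset) (auto intro!: ideal_gen_gen)
  ultimately have "initial_ideal A r (tor_ideal A :: (int ^ 'd, 'k) mpoly set) = ideal_gen A (monom_poly ` M)"
    by (simp add: initial_ideal_tor_ideal)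
  then show "has_sqfree_quadratic_initial_ideal A (tor_ideal A :: (int ^ 'd, 'k) mpoly set)"
    unfolding has_sqfree_quadratic_initial_ideal_def using mo sq by blast
qed

section \<open>The Schreyer resolution\<close>

text \<open>If \<open>x + y\<close> has only one decomposition along the two supports, nothing can
  cancel there. In \<open>syz_lead\<close> the uniqueness comes from the term order.\<close>

lemma lookup_mult_unique:
  fixes f g :: "'a::comm_monoid_add \<Rightarrow>\<^sub>0 'k::comm_ring_1"
  assumes "\<And>a b. a \<in> keys f \<Longrightarrow> b \<in> keys g \<Longrightarrow> a + b = x + y \<Longrightarrow> a = x \<and> b = y"
  shows "lookup (f * g) (x + y) = lookup f x * lookup g y"
proof -
  have "f * g = (\<Sum>a\<in>keys f. \<Sum>b\<in>keys g.
      single (a + b) (lookup f a * lookup g b))"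
    using arg_cong2[OF poly_mapping_expand[of f] poly_mapping_expand[of g], of "(*)"]
    by (simp add: sum_product mult_single)
  then have "lookup (f * g) (x + y) = (\<Sum>a\<in>keys f. \<Sum>b\<in>keys g.
      (if a + b = x + y then lookup f a * lookup g b else 0))"
    by (simp add: lookup_sum lookup_single when_def)
  also have "\<dots> = (\<Sum>a\<in>keys f. \<Sum>b\<in>keys g.
      (if a = x then if b = y then lookup f x * lookup g y else 0 else 0))"
    using assms by (intro sum.cong refl) auto
  also have "\<dots> = (\<Sum>a\<in>keys f. if a = x then (\<Sum>b\<in>keys g.
      (if b = y then lookup f x * lookup g y else 0)) else 0)"
    by (intro sum.cong refl) auto
  also have "\<dots> = lookup f x * lookup g y"
    by (auto simp: in_keys_iff)
  finally show ?thesis .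
qed

text \<open>\<open>idx\<close> is an arbitrary injective numbering of the variables; it fixes the
  order along which colon ideals are formed and breaks ties between generators.\<close>

locale schreyer = monom_order A r for A :: "(int ^ 'd::finite) set" and r +
  fixes idx :: "int ^ 'd \<Rightarrow> nat"
  assumes idx: "inj_on idx A"
    and quad: "\<And>m. m \<in> monomials A \<Longrightarrow> \<not> standard A r m \<Longrightarrow>
      \<exists>a b k. m = k + (var a + var b) \<and> \<not> standard A r (var a + var b)"
begin

section \<open>Normal forms and the Schreyer order on terms\<close>

definition nf :: "(int ^ 'd) \<times> nat \<Rightarrow> (int ^ 'd) monom" where
  "nf g = (THE m. std m \<and> tdeg m = g)"

abbreviation G where "G \<equiv> tdeg ` monomials A"

lemma nf_eqI: "std m \<Longrightarrow> tdeg m = g \<Longrightarrow> nf g = m"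
  unfolding nf_def using std_unique by (intro the_equality) auto

lemma nf_props:
  assumes "g \<in> G"
  shows "std (nf g)" "tdeg (nf g) = g" "nf g \<in> monomials A"
proof -
  obtain m where m: "std m" "tdeg m = g" using assms std_exists by blast
  then have "nf g = m" by (rule nf_eqI)
  with m show "std (nf g)" "tdeg (nf g) = g" "nf g \<in> monomials A" by (auto simp: standard_def)
qed

lemma nf_le: "m \<in> monomials A \<Longrightarrow> tdeg m = g \<Longrightarrow> (nf g, m) \<in> r"
  using nf_props(1,2)[of g] unfolding standard_def by auto

lemma nf_tdeg: "std m \<Longrightarrow> nf (tdeg m) = m"
  by (rule nf_eqI) auto

lemma nf_var: "h \<in> A \<Longrightarrow> nf (h, Suc 0) = var h"
  using std_deg_le_1[of "var h"] by (intro nf_eqI) auto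

text \<open>A nonstandard quadratic divisor of \<open>m + var a\<close> cannot divide the standard
  \<open>m\<close>, so it involves \<open>a\<close>. In other words, the colon of the initial ideal
  by a variable is generated by variables modulo the initial ideal, which keeps the resolution
  linear.\<close>

lemma not_std_var:
  assumes "std m" "a \<in> A" "\<not> std (m + var a)"
  obtains b where "b \<in> keys m" "\<not> std (var b + var a)"
proof -
  have mA: "m \<in> monomials A" using assms by (simp add: standard_def)
  obtain b c k where eq: "m + var a = k + (var b + var c)" and ns: "\<not> std (var b + var c)"
    using quad[of "m + var a"] assms mA by auto
  consider "a = c" | "a = b" | "a \<noteq> c" "a \<noteq> b" by auto
  then show ?thesis
  proof cases
    case 1
    then have "m + var a = (k + var b) + var a" using eq by (simp add: add.assoc)
    then have "m = k + var b" by simp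
    then show ?thesis using ns 1 that[of b] by (simp add: keys_add_monom)
  next
    case 2
    then have "m + var a = (k + var c) + var a" using eq by (simp add: ac_simps)
    then have "m = k + var c" by simp
    then show ?thesis using ns 2 that[of c] by (simp add: keys_add_monom add.commute)
  next
    case 3
    have "a \<in> keys (k + (var b + var c))" by (simp flip: eq add: keys_add_monom)
    then have "a \<in> keys k" using 3 by (auto simp: keys_add_monom)
    then obtain k' where k: "k = k' + var a" using monom_remove_var[of a k] by (metis One_nat_def)
    have "m + var a = ((var b + var c) + k') + var a" using eq k by (simp add: ac_simps)
    then have "m = (var b + var c) + k'" by simp
    then show ?thesis using assms(1) ns std_factor by blast
  qed
qed

text \<open>A word \<open>h # w\<close> (last letter first) indexes a generator with leading term \<open>x\<^sub>h e\<^sub>w\<close>, and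
  \<open>L (h # w)\<close> generates the colon ideal of the variables preceding \<open>h\<close> in \<open>L w\<close> by \<open>x\<^sub>h\<close>, modulo
  the initial ideal.\<close>

fun L :: "(int ^ 'd) list \<Rightarrow> (int ^ 'd) set" where
  "L [] = A"
| "L (h # w) = {z \<in> L w. idx z < idx h} \<union> {z \<in> A. \<not> std (var z + var h)}"

primrec W :: "nat \<Rightarrow> (int ^ 'd) list set" where
  "W 0 = {[]}"
| "W (Suc n) = {h # w | h w. w \<in> W n \<and> h \<in> L w}"

text \<open>The shift in Schreyer's order: the product of the leading variables met when the basis
  vector \<open>e_w\<close> is mapped down to the ring step by step.\<close>

primrec mu :: "(int ^ 'd) list \<Rightarrow> (int ^ 'd) monom" where
  "mu [] = 0"
| "mu (h # w) = var h + mu w"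

text \<open>The positions of the leading terms one step lower, that is the tails, are compared
  first; the newest letter decides only between equal tails.\<close>

fun wless :: "(int ^ 'd) list \<Rightarrow> (int ^ 'd) list \<Rightarrow> bool" where
  "wless (h # w) (h' # w') \<longleftrightarrow> wless w w' \<or> (w = w' \<and> idx h < idx h')"
| "wless _ _ \<longleftrightarrow> False"

lemma L_subset: "L w \<subseteq> A"
  by (induction w) auto

lemma W_Suc_iff [simp]: "h # w \<in> W (Suc n) \<longleftrightarrow> w \<in> W n \<and> h \<in> L w"
  by auto

declare W.simps(2) [simp del]

lemma W_SucE:
  assumes "u \<in> W (Suc n)"
  obtains h w where "u = h # w" "w \<in> W n" "h \<in> L w" "h \<in> A"
  using assms L_subset by (auto simp: W.simps)

lemma finite_W [simp]: "finite (W n)"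
proof (induction n)
  case (Suc n)
  have "W (Suc n) \<subseteq> (\<lambda>(h, w). h # w) ` (A \<times> W n)" using L_subset by (force simp: W.simps)
  then show ?case using Suc fin by (meson finite_SigmaI finite_imageI finite_subset)
qed simp

lemma mu_in: "w \<in> W n \<Longrightarrow> mu w \<in> monomials A"
proof (induction n arbitrary: w)
  case (Suc n)
  then show ?case using L_subset by (auto elim!: W_SucE)
qed simp

lemma wless_irrefl [simp]: "\<not> wless w w"
  by (induction w) auto

lemma wless_trans: "wless u v \<Longrightarrow> wless v w \<Longrightarrow> wless u w"
proof (induction u w arbitrary: v rule: wless.induct)
  case (1 h w h' w')
  then show ?case by (cases v) auto
qed auto

lemma wless_total: "u \<in> W n \<Longrightarrow> v \<in> W n \<Longrightarrow> u \<noteq> v \<Longrightarrow> wless u v \<or> wless v u"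
proof (induction n arbitrary: u v)
  case (Suc n)
  obtain h w where u: "u = h # w" "w \<in> W n" "h \<in> L w" "h \<in> A" using Suc.prems(1) by (rule W_SucE)
  obtain h' w' where v: "v = h' # w'" "w' \<in> W n" "h' \<in> L w'" "h' \<in> A" using Suc.prems(2) by (rule W_SucE)
  show ?case
  proof (cases "w = w'")
    case True
    then have "idx h \<noteq> idx h'" using u v Suc.prems(3) inj_onD[OF idx] by auto
    then show ?thesis using u v True by auto
  next
    case False
    then show ?thesis using Suc.IH u v by auto
  qed
qed simp

definition vlt :: "(int ^ 'd) monom \<times> (int ^ 'd) list \<Rightarrow> (int ^ 'd) monom \<times> (int ^ 'd) list \<Rightarrow> bool" where
  "vlt x y \<longleftrightarrow> lt (fst x) (fst y) \<or> (fst x = fst y \<and> wless (snd x) (snd y))"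

text \<open>The total monomial of the term with exponent \<open>g\<close> at \<open>e_w\<close>. The
  product \<open>nf g + mu w\<close> is deliberately not normalised again, so its size can be
  compared by cancelling \<open>mu w\<close>.\<close>

definition val :: "((int ^ 'd) \<times> nat) \<times> (int ^ 'd) list \<Rightarrow> (int ^ 'd) monom \<times> (int ^ 'd) list" where
  "val t = (nf (fst t) + mu (snd t), snd t)"

lemma le_lt_trans: "(x, y) \<in> r \<Longrightarrow> lt y z \<Longrightarrow> lt x z"
  using r_trans[of x y z] r_antisym[of x y] by auto

lemma vlt_irrefl [simp]: "\<not> vlt x x"
  by (simp add: vlt_def)

lemma vlt_trans: "vlt x y \<Longrightarrow> vlt y z \<Longrightarrow> vlt x z"
  using le_lt_trans[of "fst x" "fst y" "fst z"] wless_trans[of "snd x" "snd y" "snd z"]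
  by (auto simp: vlt_def)

lemma val_total:
  assumes "g \<in> G" "g' \<in> G" "w \<in> W n" "w' \<in> W n" "(g, w) \<noteq> (g', w')"
  shows "vlt (val (g, w)) (val (g', w')) \<or> vlt (val (g', w')) (val (g, w))"
proof (cases "nf g + mu w = nf g' + mu w'")
  case True
  have "w \<noteq> w'"
  proof
    assume "w = w'"
    then have "nf g = nf g'" using True by simp
    then have "g = g'" using nf_props(2) assms by metis
    then show False using assms \<open>w = w'\<close> by simp
  qed
  then show ?thesis using wless_total[OF assms(3,4)] True by (auto simp: vlt_def val_def)
next
  case False
  have "nf g + mu w \<in> monomials A" "nf g' + mu w' \<in> monomials A"
    using nf_props(3) assms mu_in by auto
  then show ?thesis using r_total False by (auto simp: vlt_def val_def)
qed

text \<open>Multiplication by a standard monomial is compatible with the order, since the normal form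
  is the smallest element of its fibre.\<close>

lemma vlt_shift:
  assumes "vlt (val (g, w')) (N, w)" "std m" "g \<in> G" "w' \<in> W n"
  shows "vlt (val (tdeg m + g, w')) (m + N, w)"
proof -
  have m: "m \<in> monomials A" using assms by (simp add: standard_def)
  have le0: "(nf (tdeg m + g), m + nf g) \<in> r"
    using m nf_props[OF assms(3)] by (intro nf_le) (auto simp: tdeg_add)
  then have le: "(nf (tdeg m + g) + mu w', m + (nf g + mu w')) \<in> r"
    using r_add[OF le0 mu_in[OF assms(4)]] by (simp add: add.assoc)
  consider "lt (nf g + mu w') N" | "nf g + mu w' = N" "wless w' w"
    using assms(1) by (auto simp: vlt_def val_def)
  then show ?thesis
  proof cases
    case 1
    then have "lt (m + (nf g + mu w')) (m + N)" using lt_add[OF 1 m] by (simp add: ac_simps)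
    then show ?thesis using le_lt_trans[OF le] unfolding vlt_def val_def by simp
  next
    case 2
    then show ?thesis using le by (auto simp: vlt_def val_def)
  qed
qed

text \<open>Vectors are total functions on words. Only their values on \<open>W n\<close> count,
  which is why supports, membership and equations below are restricted to
  \<open>W n\<close>.\<close>

type_synonym ('e, 'f) vect = "(int ^ 'e) list \<Rightarrow> ('e, 'f) laurent"

definition vsupp :: "nat \<Rightarrow> ('d, 'k::field) vect \<Rightarrow> (((int ^ 'd) \<times> nat) \<times> (int ^ 'd) list) set" where
  "vsupp n v = {(g, w). w \<in> W n \<and> g \<in> keys (v w)}"

definition isvec :: "nat \<Rightarrow> ('d, 'k::field) vect \<Rightarrow> bool" where
  "isvec n v \<longleftrightarrow> (\<forall>w\<in>W n. v w \<in> tor_ring A)"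

definition is_lead :: "nat \<Rightarrow> ('d, 'k::field) vect \<Rightarrow> ((int ^ 'd) \<times> nat) \<times> (int ^ 'd) list \<Rightarrow> bool" where
  "is_lead n v t \<longleftrightarrow> t \<in> vsupp n v \<and> (\<forall>t'\<in>vsupp n v. t' \<noteq> t \<longrightarrow> vlt (val t') (val t))"

definition comb :: "nat \<Rightarrow> ((int ^ 'd) list \<Rightarrow> ('d, 'k::field) vect) \<Rightarrow> ('d, 'k) vect \<Rightarrow> ('d, 'k) vect" where
  "comb n s c = (\<lambda>w. \<Sum>u\<in>W (Suc n). c u * s u w)"

text \<open>The columns are required to have linear entries and leading term \<open>x_h e_w\<close>
  with coefficient one. The bound is written with \<open>var h\<close> itself because a variable is
  its own normal form.\<close>

definition gens :: "nat \<Rightarrow> ((int ^ 'd) list \<Rightarrow> ('d, 'k::field) vect) \<Rightarrow> bool" where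
  "gens n s \<longleftrightarrow> (\<forall>w\<in>W n. \<forall>h\<in>L w.
     isvec n (s (h # w)) \<and>
     (\<forall>(g, w')\<in>vsupp n (s (h # w)). snd g = 1) \<and>
     lookup (s (h # w) w) (h, Suc 0) = 1 \<and>
     (\<forall>t\<in>vsupp n (s (h # w)). t \<noteq> ((h, Suc 0), w) \<longrightarrow> vlt (val t) (var h + mu w, w)))"

lemma vsupp_G: "isvec n v \<Longrightarrow> (g, w) \<in> vsupp n v \<Longrightarrow> g \<in> G \<and> w \<in> W n"
  by (auto simp: vsupp_def isvec_def tor_ring_def)

lemma finite_vsupp: "finite (vsupp n v)"
proof -
  have "vsupp n v \<subseteq> (\<Union>w\<in>W n. keys (v w) \<times> {w})" by (auto simp: vsupp_def)
  then show ?thesis by (rule finite_subset) auto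
qed

lemma lead_exists:
  assumes "isvec n v" "vsupp n v \<noteq> {}"
  shows "\<exists>t. is_lead n v t"
proof -
  have "\<exists>t\<in>X. \<forall>t'\<in>X. t' \<noteq> t \<longrightarrow> vlt (val t') (val t)"
    if "finite X" "X \<noteq> {}" "X \<subseteq> vsupp n v" for X
    using that
  proof (induction X rule: finite_ne_induct)
    case (singleton x)
    then show ?case by auto
  next
    case (insert x F)
    then obtain t where t: "t \<in> F" "\<forall>t'\<in>F. t' \<noteq> t \<longrightarrow> vlt (val t') (val t)" by auto
    have "x \<noteq> t" using t insert by auto
    moreover have "x \<in> vsupp n v" "t \<in> vsupp n v" using insert t by auto
    ultimately consider "vlt (val x) (val t)" | "vlt (val t) (val x)"
      using val_total[of "fst x" "fst t" "snd x" n "snd t"] vsupp_G[OF assms(1)]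
      by (metis prod.collapse)
    then show ?case
    proof cases
      case 1
      then show ?thesis using t by auto
    next
      case 2
      then have "vlt (val t') (val x)" if "t' \<in> F" for t'
        using t that vlt_trans[OF _ 2] by (cases "t' = t") auto
      then show ?thesis by auto
    qed
  qed
  from this[OF finite_vsupp assms(2) subset_refl] show ?thesis unfolding is_lead_def by blast
qed

lemma gens_props:
  assumes "gens n s" "u \<in> W (Suc n)"
  shows "isvec n (s u)" "\<And>g w. (g, w) \<in> vsupp n (s u) \<Longrightarrow> snd g = 1"
    "lookup (s u (tl u)) (hd u, Suc 0) = 1"
    "\<And>t. t \<in> vsupp n (s u) \<Longrightarrow> t \<noteq> ((hd u, Suc 0), tl u) \<Longrightarrow> vlt (val t) (mu u, tl u)"
  using assms by (fastforce simp: gens_def elim!: W_SucE)+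

lemma isvec_comb:
  assumes "gens n s" "isvec (Suc n) c"
  shows "isvec n (comb n s c)"
  using assms gens_props(1)[OF assms(1)] unfolding isvec_def comb_def
  by (auto intro!: tor_ring_sum tor_ring_mult)

lemma comb_diff: "comb n s (\<lambda>u. c u - c' u) w = comb n s c w - comb n s c' w"
  by (simp add: comb_def algebra_simps sum_subtractf)

lemma comb_delta:
  assumes "u \<in> W (Suc n)"
  shows "comb n s (\<lambda>u'. if u' = u then p else 0) w = p * s u w"
proof -
  have "comb n s (\<lambda>u'. if u' = u then p else 0) w = (\<Sum>u'\<in>W (Suc n). if u' = u then p * s u w else 0)"
    unfolding comb_def by (intro sum.cong) auto
  then show ?thesis using assms by simp
qed

text \<open>The bound \<open>B\<close> controls the leading terms of the products \<open>c u * s u\<close>.\<close>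

definition quotient :: "nat \<Rightarrow> ((int ^ 'd) list \<Rightarrow> ('d, 'k::field) vect) \<Rightarrow> nat set \<Rightarrow> ('d, 'k) vect \<Rightarrow> ('d, 'k) vect \<Rightarrow> bool" where
  "quotient n s Dg v c \<longleftrightarrow> isvec (Suc n) c \<and> (\<forall>w\<in>W n. v w = comb n s c w) \<and>
      (\<forall>(g, u)\<in>vsupp (Suc n) c. Suc (snd g) \<in> Dg) \<and>
      (\<forall>B. (\<forall>t\<in>vsupp n v. vlt (val t) B) \<longrightarrow> (\<forall>(g, u)\<in>vsupp (Suc n) c. vlt (nf g + mu u, tl u) B))"

text \<open>A leading term divisible by some \<open>x_h\<close> with \<open>h\<close> in
  \<open>L w\<close> is removed by subtracting a multiple of \<open>s (h # w)\<close>. The invariant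
  \<open>Z\<close> is a parameter so that the same division serves images of columns, syzygies and
  the irrelevant ideal.\<close>

lemma division:
  fixes s :: "(int ^ 'd) list \<Rightarrow> ('d, 'k::field) vect"
  assumes gens: "gens n s"
    and Z_vec: "\<And>v. Z v \<Longrightarrow> isvec n v"
    and Z_closed: "\<And>v u m c. Z v \<Longrightarrow> u \<in> W (Suc n) \<Longrightarrow> m \<in> monomials A \<Longrightarrow>
      Z (\<lambda>w. v w - single (tdeg m) c * s u w)"
    and Z_lead: "\<And>v t. Z v \<Longrightarrow> is_lead n v t \<Longrightarrow> \<exists>h\<in>L (snd t). h \<in> keys (nf (fst t))"
    and "finite Dg"
  shows "Z v \<Longrightarrow> (\<And>g w. (g, w) \<in> vsupp n v \<Longrightarrow> snd g \<in> Dg) \<Longrightarrow> \<exists>c. quotient n s Dg v c"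
proof -
  \<comment> \<open>The columns are homogeneous of degree one, so the degrees that occur stay in
    \<open>Dg\<close> throughout, and all terms come from this finite set.\<close>
  define T where "T = {(g, w). g \<in> G \<and> snd g \<in> Dg \<and> w \<in> W n}"
  have finT: "finite T"
  proof -
    have "T \<subseteq> (tdeg ` {m \<in> monomials A. mdeg m \<le> Max (insert 0 Dg)}) \<times> W n"
      using \<open>finite Dg\<close> by (auto simp: T_def intro!: imageI)
    then show ?thesis using finite_monomials_mdeg_le[OF fin] finite_subset by fastforce
  qed
  \<comment> \<open>Termination measure: the terms at or below some term of the vector. Replacing
    the leading term by smaller ones loses that term and adds none.\<close>
  define below where "below v = {t \<in> T. \<exists>t'\<in>vsupp n v. t = t' \<or> vlt (val t) (val t')}" for v :: "('d, 'k) vect"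
  show "Z v \<Longrightarrow> (\<And>g w. (g, w) \<in> vsupp n v \<Longrightarrow> snd g \<in> Dg) \<Longrightarrow> \<exists>c. quotient n s Dg v c"
  proof (induction "card (below v)" arbitrary: v rule: less_induct)
    case less
    note Zv = less.prems(1) and deg = less.prems(2)
    show ?case
    proof (cases "vsupp n v = {}")
      case True
      then have "\<forall>w\<in>W n. keys (v w) = {}" by (auto simp: vsupp_def simp del: keys_eq_empty)
      then show ?thesis
        by (intro exI[of _ "\<lambda>_. 0"]) (auto simp: quotient_def isvec_def comb_def vsupp_def)
    next
      case False
      obtain g w where lead: "is_lead n v (g, w)" using lead_exists[OF Z_vec[OF Zv] False] by auto
      then have gw: "(g, w) \<in> vsupp n v" by (simp add: is_lead_def)
      then have gG: "g \<in> G" and w: "w \<in> W n" using vsupp_G[OF Z_vec[OF Zv]] by auto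
      obtain h where h: "h \<in> L w" "h \<in> keys (nf g)" using Z_lead[OF Zv lead] by auto
      define m where "m = nf g - var h"
      have nfg: "nf g = m + var h" using monom_remove_var[OF h(2)] by (simp add: m_def)
      \<comment> \<open>The cofactor is standard as a factor of a normal form, which is what
        \<open>vlt_shift\<close> asks for.\<close>
      have stdm: "std m" using nf_props(1)[OF gG] std_factor nfg by metis
      then have mA: "m \<in> monomials A" by (simp add: standard_def)
      have g_eq: "g = tdeg m + (h, Suc 0)" using nf_props(2)[OF gG] unfolding nfg by (simp add: tdeg_add)
      define k where "k = lookup (v w) g"
      have hw: "h # w \<in> W (Suc n)" using h w by auto
      define v' where "v' = (\<lambda>w'. v w' - single (tdeg m) k * s (h # w) w')"
      have Zv': "Z v'" unfolding v'_def using Z_closed[OF Zv hw mA] .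
      note sp = gens_props[OF gens hw, simplified]
      have vt: "val (g, w) = (m + (var h + mu w), w)" by (simp add: val_def nfg add.assoc)
      have below': "vlt (val (g', w')) (val (g, w)) \<and> snd g' \<in> Dg" if "(g', w') \<in> vsupp n v'" for g' w'
      proof -
        have w': "w' \<in> W n" and g': "lookup (v' w') g' \<noteq> 0"
          using that by (auto simp: vsupp_def in_keys_iff)
        \<comment> \<open>The leading coefficient of the column is one, so the leading term cancels
          exactly.\<close>
        have "(g', w') \<noteq> (g, w)"
        proof
          assume "(g', w') = (g, w)"
          moreover have "lookup (v' w) g = 0"
            unfolding v'_def lookup_minus unfolding g_eq lookup_single_times using sp(3)
            by (simp add: k_def g_eq)
          ultimately show False using g' by simp
        qed
        show ?thesis
        proof (cases "g' \<in> keys (v w')")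
          case True
          then have "(g', w') \<in> vsupp n v" using w' by (simp add: vsupp_def)
          then show ?thesis using lead \<open>(g', w') \<noteq> (g, w)\<close> deg by (auto simp: is_lead_def)
        next
          case False
          then have "g' \<in> keys (single (tdeg m) k * s (h # w) w')"
            using g' by (auto simp: v'_def lookup_minus in_keys_iff)
          then obtain g1 where g1: "g' = tdeg m + g1" "g1 \<in> keys (s (h # w) w')"
            using keys_single_times by blast
          then have g1s: "(g1, w') \<in> vsupp n (s (h # w))" using w' by (simp add: vsupp_def)
          have "(g1, w') \<noteq> ((h, Suc 0), w)" using g1 g_eq \<open>(g', w') \<noteq> (g, w)\<close> by auto
          then have "vlt (val (g1, w')) (var h + mu w, w)" using sp(4) g1s by blast
          then have "vlt (val (g', w')) (val (g, w))"
            unfolding vt g1(1) using stdm vsupp_G[OF sp(1) g1s] by (intro vlt_shift) auto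
          moreover have "snd g' = snd g" using sp(2)[OF g1s] by (simp add: g1(1) g_eq)
          ultimately show ?thesis using deg gw by auto
        qed
      qed
      have "below v' \<subset> below v"
      proof
        show "below v' \<subseteq> below v"
        proof
          fix t assume "t \<in> below v'"
          then obtain t' where t': "t \<in> T" "t' \<in> vsupp n v'" "t = t' \<or> vlt (val t) (val t')"
            by (auto simp: below_def)
          have "vlt (val t') (val (g, w))" using below' t'(2) by (cases t') auto
          then have "vlt (val t) (val (g, w))" using t' vlt_trans by blast
          then show "t \<in> below v" using t' gw by (auto simp: below_def)
        qed
        have "(g, w) \<in> below v" using gw gG w deg by (auto simp: below_def T_def)
        moreover have "(g, w) \<notin> below v'"
        proof
          assume "(g, w) \<in> below v'"
          then obtain t' where t': "t' \<in> vsupp n v'" "(g, w) = t' \<or> vlt (val (g, w)) (val t')"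
            by (auto simp: below_def)
          have "vlt (val t') (val (g, w))" using below' t'(1) by (cases t') auto
          then show False using t'(2) vlt_trans vlt_irrefl by blast
        qed
        ultimately show "below v' \<noteq> below v" by blast
      qed
      moreover have "finite (below v)" using finT by (simp add: below_def)
      ultimately have "card (below v') < card (below v)" by (rule psubset_card_mono[rotated])
      from less.hyps[OF this Zv'] below' obtain c' where c': "isvec (Suc n) c'"
        "\<And>w'. w' \<in> W n \<Longrightarrow> v' w' = comb n s c' w'"
        "\<And>g u. (g, u) \<in> vsupp (Suc n) c' \<Longrightarrow> Suc (snd g) \<in> Dg"
        "\<And>B g u. (\<forall>t\<in>vsupp n v'. vlt (val t) B) \<Longrightarrow> (g, u) \<in> vsupp (Suc n) c' \<Longrightarrow> vlt (nf g + mu u, tl u) B"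
        unfolding quotient_def by fast
      define e where "e = (\<lambda>u. if u = h # w then single (tdeg m) k else (0 :: ('d, 'k) laurent))"
      define c where "c = (\<lambda>u. c' u + e u)"
      have supp_c: "(g', u) \<in> vsupp (Suc n) c' \<or> (g', u) = (tdeg m, h # w)" if "(g', u) \<in> vsupp (Suc n) c" for g' u
      proof -
        have "g' \<in> keys (c' u) \<union> keys (e u)"
          using that keys_add[of "c' u" "e u"] by (auto simp: vsupp_def c_def)
        then show ?thesis using that by (auto simp: vsupp_def e_def split: if_splits)
      qed
      have "isvec (Suc n) c"
        using c'(1) tor_ring_single[OF mA] by (auto simp: isvec_def c_def e_def intro!: tor_ring_add)
      moreover have "\<forall>w'\<in>W n. v w' = comb n s c w'"
      proof
        fix w' assume "w' \<in> W n"
        have "comb n s c w' = comb n s c' w' + comb n s e w'"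
          by (simp add: comb_def c_def distrib_right sum.distrib)
        also have "comb n s e w' = single (tdeg m) k * s (h # w) w'"
          unfolding e_def by (rule comb_delta[OF hw])
        finally show "v w' = comb n s c w'" using c'(2)[OF \<open>w' \<in> W n\<close>] by (simp add: v'_def diff_eq_eq)
      qed
      moreover have "\<forall>(g', u)\<in>vsupp (Suc n) c. Suc (snd g') \<in> Dg"
        using supp_c c'(3) deg[OF gw] g_eq by fastforce
      moreover have "\<forall>B. (\<forall>t\<in>vsupp n v. vlt (val t) B) \<longrightarrow> (\<forall>(g', u)\<in>vsupp (Suc n) c. vlt (nf g' + mu u, tl u) B)"
      proof (intro allI impI, clarify)
        fix x y g1 g2 u assume B: "\<forall>t\<in>vsupp n v. vlt (val t) (x, y)" and gu: "((g1, g2), u) \<in> vsupp (Suc n) c"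
        have gB: "vlt (val (g, w)) (x, y)" using B gw by blast
        then have "\<forall>t\<in>vsupp n v'. vlt (val t) (x, y)" using below' vlt_trans by fast
        then have "vlt (nf (g1, g2) + mu u, tl u) (x, y)" if "((g1, g2), u) \<in> vsupp (Suc n) c'"
          using c'(4) that by blast
        moreover have "vlt (nf (tdeg m) + mu (h # w), tl (h # w)) (x, y)"
          using gB by (simp add: nf_tdeg[OF stdm] vt)
        ultimately show "vlt (nf (g1, g2) + mu u, tl u) (x, y)" using supp_c[OF gu] by auto
      qed
      ultimately show ?thesis unfolding quotient_def by blast
    qed
  qed
qed

end

section \<open>Leading terms of syzygies and construction of the next differential\<close>

context schreyer begin

definition groebner :: "nat \<Rightarrow> ((int ^ 'd) list \<Rightarrow> ('d, 'k::field) vect) \<Rightarrow> bool" where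
  "groebner n s \<longleftrightarrow> gens n s \<and> (\<forall>c t. isvec (Suc n) c \<longrightarrow> is_lead n (comb n s c) t \<longrightarrow>
     (\<exists>h\<in>L (snd t). h \<in> keys (nf (fst t))))"

definition syz :: "nat \<Rightarrow> ((int ^ 'd) list \<Rightarrow> ('d, 'k::field) vect) \<Rightarrow> ('d, 'k) vect \<Rightarrow> bool" where
  "syz n s z \<longleftrightarrow> isvec (Suc n) z \<and> (\<forall>w\<in>W n. comb n s z w = 0)"

text \<open>Let \<open>z\<close> lead with \<open>m\<close> at \<open>e_u\<close>, where
  \<open>u = h # w\<close> and no variable of \<open>m\<close> is in \<open>L u\<close>. Then
  \<open>m + var h\<close> is standard by \<open>not_std_var\<close>, so multiplying the leading
  term of \<open>s u\<close> by \<open>m\<close> really produces the term \<open>d\<close> at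
  \<open>e_w\<close>. No other product reaches this term, so it survives in the combination,
  contradicting that \<open>z\<close> is a syzygy.\<close>

lemma syz_lead:
  fixes s :: "(int ^ 'd) list \<Rightarrow> ('d, 'k::field) vect"
  assumes gens: "gens n s" and z: "syz n s z" and lead: "is_lead (Suc n) z t"
  shows "\<exists>b\<in>L (snd t). b \<in> keys (nf (fst t))"
proof (rule ccontr)
  assume no: "\<not> ?thesis"
  obtain g u where t: "t = (g, u)" by fastforce
  have zv: "isvec (Suc n) z" using z by (simp add: syz_def)
  have gu: "(g, u) \<in> vsupp (Suc n) z" using lead t by (simp add: is_lead_def)
  then have gG: "g \<in> G" and uW: "u \<in> W (Suc n)" using vsupp_G[OF zv] by auto
  obtain h w where u: "u = h # w" "w \<in> W n" "h \<in> L w" "h \<in> A" using uW by (rule W_SucE)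
  define m where "m = nf g"
  have m: "std m" "tdeg m = g" "m \<in> monomials A" using nf_props[OF gG] by (auto simp: m_def)
  have no': False if "b \<in> L u" "b \<in> keys m" for b
    using no that by (auto simp: t m_def)
  have stdmh: "std (m + var h)"
  proof (rule ccontr)
    assume "\<not> std (m + var h)"
    then obtain b where b: "b \<in> keys m" "\<not> std (var b + var h)"
      using not_std_var[OF m(1) u(4)] by blast
    then have "b \<in> A" using m(3) by (auto simp: monomials_def)
    then have "b \<in> L u" using b u by simp
    then show False using no' b by blast
  qed
  define d where "d = g + (h, Suc 0)"
  have nfd: "nf d = m + var h" using stdmh m by (intro nf_eqI) (auto simp: tdeg_add d_def)
  have valdw: "val (d, w) = (m + (var h + mu w), w)" by (simp add: val_def nfd add.assoc)
  \<comment> \<open>Any contribution to \<open>d\<close> at \<open>e_w\<close> must come from the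
    leading term of \<open>z\<close> times the leading term of its column: a non-leading term of a
    column lands strictly lower.\<close>
  have uniq: "u1 = u \<and> g1 = g \<and> d1 = (h, Suc 0)"
    if u1W: "u1 \<in> W (Suc n)" and g1: "g1 \<in> keys (z u1)"
      and d1: "d1 \<in> keys (s u1 w)" and sum: "g1 + d1 = d" for u1 g1 d1
  proof -
    obtain h1 w1 where u1: "u1 = h1 # w1" "w1 \<in> W n" "h1 \<in> L w1" "h1 \<in> A" using u1W by (rule W_SucE)
    have gu1: "(g1, u1) \<in> vsupp (Suc n) z" using g1 u1W by (simp add: vsupp_def)
    then have g1G: "g1 \<in> G" using vsupp_G[OF zv] by blast
    define m1 where "m1 = nf g1"
    have m1: "std m1" "tdeg m1 = g1" "m1 \<in> monomials A" using nf_props[OF g1G] by (auto simp: m1_def)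
    have ord: "(g1, u1) = (g, u) \<or> vlt (m1 + (var h1 + mu w1), h1 # w1) (m + (var h + mu w), h # w)"
    proof (cases "(g1, u1) = (g, u)")
      case False
      then have "vlt (val (g1, u1)) (val (g, u))" using lead gu1 t unfolding is_lead_def by blast
      then show ?thesis by (simp add: val_def m_def m1_def u u1)
    qed simp
    have ord2: "(m1 + (var h1 + mu w1), w1) = (m + (var h + mu w), w) \<or>
        vlt (m1 + (var h1 + mu w1), w1) (m + (var h + mu w), w)"
      using ord by (auto simp: vlt_def u u1 m_def m1_def)
    have d1s: "(d1, w) \<in> vsupp n (s u1)" using d1 u by (simp add: vsupp_def)
    note sp = gens_props[OF gens u1W, unfolded u1(1) list.sel mu.simps]
    have lead1: "(d1, w) = ((h1, Suc 0), w1)"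
    proof (rule ccontr)
      assume "(d1, w) \<noteq> ((h1, Suc 0), w1)"
      then have "vlt (val (d1, w)) (var h1 + mu w1, w1)" using sp(4) d1s u1 by blast
      then have "vlt (val (tdeg m1 + d1, w)) (m1 + (var h1 + mu w1), w1)"
        using m1 u vsupp_G[OF sp(1)] d1s u1 by (intro vlt_shift[where n = n]) auto
      then have "vlt (val (d, w)) (m1 + (var h1 + mu w1), w1)" using sum m1 by simp
      then show False using ord2 valdw vlt_trans vlt_irrefl by metis
    qed
    then have d1e: "d1 = (h1, Suc 0)" and w1: "w1 = w" by auto
    \<comment> \<open>\<open>m + var h\<close> is the normal form of \<open>d\<close>, hence
      smallest in the fibre that also contains \<open>m1 + var h1\<close>; the leading term of
      \<open>z\<close> bounds from the other side.\<close>
    have le: "(m + var h, m1 + var h1) \<in> r"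
      using m1 u1 sum d1e nfd by (intro nf_le[of _ d, unfolded nfd]) (auto simp: tdeg_add)
    have eq: "m1 + var h1 = m + var h"
    proof (rule ccontr)
      assume ne: "m1 + var h1 \<noteq> m + var h"
      then have "m1 + (var h1 + mu w1) \<noteq> m + (var h + mu w)" by (simp add: w1 flip: add.assoc)
      then have "lt (m1 + (var h1 + mu w1)) (m + (var h + mu w))" using ord2 w1 by (auto simp: vlt_def)
      moreover have "(m + (var h + mu w), m1 + (var h1 + mu w1)) \<in> r"
        using r_add[OF le mu_in[OF u(2)]] by (simp add: w1 add.assoc)
      ultimately show False using r_antisym by blast
    qed
    \<comment> \<open>With equal monomials the tie-break leaves only an earlier letter
      \<open>h1\<close>. It would divide \<open>m\<close> and belong to \<open>L u\<close> as a
      letter of \<open>L w\<close> preceding \<open>h\<close>.\<close>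
    have "h1 = h"
    proof (rule ccontr)
      assume hne: "h1 \<noteq> h"
      then have "vlt (m1 + (var h1 + mu w1), h1 # w1) (m + (var h + mu w), h # w)" using ord u u1 by auto
      moreover have "m1 + (var h1 + mu w1) = m + (var h + mu w)" using eq by (simp add: w1 flip: add.assoc)
      ultimately have "idx h1 < idx h" by (simp add: vlt_def w1)
      moreover have "h1 \<in> keys (m + var h)" unfolding eq[symmetric] by (simp add: keys_add_monom)
      then have "h1 \<in> keys m" using hne by (auto simp: keys_add_monom)
      ultimately show False using no'[of h1] u u1 w1 by auto
    qed
    then show ?thesis using eq u u1 w1 m m1 d1e by auto
  qed
  have "lookup (z u * s u w) (g + (h, Suc 0)) =
      lookup (z u) g * lookup (s u w) (h, Suc 0)"
    using uniq[OF uW] unfolding d_def by (intro lookup_mult_unique) blast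
  also have "\<dots> = lookup (z u) g" using gens_props(3)[OF gens uW] u by simp
  finally have main: "lookup (z u * s u w) d \<noteq> 0"
    using gu by (simp add: d_def vsupp_def in_keys_iff)
  have others: "lookup (z u1 * s u1 w) d = 0" if "u1 \<in> W (Suc n)" "u1 \<noteq> u" for u1
  proof (rule ccontr)
    assume "lookup (z u1 * s u1 w) d \<noteq> 0"
    then have "d \<in> keys (z u1 * s u1 w)" by (simp add: in_keys_iff)
    then obtain g1 d1 where "g1 \<in> keys (z u1)" "d1 \<in> keys (s u1 w)" "g1 + d1 = d"
      using keys_mult[of "z u1" "s u1 w"] by blast
    then show False using uniq that by blast
  qed
  have "lookup (comb n s z w) d = (\<Sum>u1\<in>W (Suc n). lookup (z u1 * s u1 w) d)"
    by (simp add: comb_def lookup_sum)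
  also have "\<dots> = lookup (z u * s u w) d"
    using others uW by (simp add: sum.remove[of _ u])
  finally show False using main z u by (simp add: syz_def)
qed

lemma groebner_division:
  assumes "groebner n s" "isvec (Suc n) c0" "\<And>g w. (g, w) \<in> vsupp n (comb n s c0) \<Longrightarrow> snd g \<in> Dg" "finite Dg"
  shows "\<exists>c. quotient n s Dg (comb n s c0) c"
proof (rule division[where Z = "\<lambda>v. \<exists>c. isvec (Suc n) c \<and> v = comb n s c"])
  show gens: "gens n s" using assms by (simp add: groebner_def)
  show "isvec n v" if "\<exists>c. isvec (Suc n) c \<and> v = comb n s c" for v
    using that isvec_comb[OF gens] by auto
  show "\<exists>c'. isvec (Suc n) c' \<and> (\<lambda>w. v w - single (tdeg m) k * s u w) = comb n s c'"
    if v: "\<exists>c. isvec (Suc n) c \<and> v = comb n s c" and u: "u \<in> W (Suc n)" and m: "m \<in> monomials A" for v u m k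
  proof -
    obtain c where c: "isvec (Suc n) c" "v = comb n s c" using v by blast
    let ?c = "\<lambda>u'. c u' - (if u' = u then single (tdeg m) k else 0)"
    have "isvec (Suc n) ?c" using c tor_ring_single[OF m] by (auto simp: isvec_def intro!: tor_ring_diff)
    moreover have "(\<lambda>w. v w - single (tdeg m) k * s u w) = comb n s ?c"
      by (simp add: c(2) comb_diff comb_delta[OF u] fun_eq_iff)
    ultimately show ?thesis by blast
  qed
  show "\<exists>h\<in>L (snd t). h \<in> keys (nf (fst t))"
    if "\<exists>c. isvec (Suc n) c \<and> v = comb n s c" "is_lead n v t" for v t
    using assms(1) that unfolding groebner_def by blast
qed (use assms in auto)

text \<open>An S-pair argument. The candidate \<open>g0\<close> is chosen so that its image
  \<open>y\<close> lies strictly below the bound \<open>B\<close>; dividing \<open>y\<close> by the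
  columns and subtracting the quotient gives a syzygy without disturbing the leading term.\<close>

lemma syz_exists:
  fixes s :: "(int ^ 'd) list \<Rightarrow> ('d, 'k::field) vect"
  assumes gb: "groebner n s" and uW: "u \<in> W (Suc n)" and bL: "b \<in> L u"
  shows "\<exists>g. syz n s g \<and> (\<forall>(x, y)\<in>vsupp (Suc n) g. snd x = 1) \<and>
    lookup (g u) (b, Suc 0) = 1 \<and>
    (\<forall>t\<in>vsupp (Suc n) g. t \<noteq> ((b, Suc 0), u) \<longrightarrow> vlt (val t) (var b + mu u, u))"
proof -
  have gens: "gens n s" using gb by (simp add: groebner_def)
  obtain h w where u: "u = h # w" "w \<in> W n" "h \<in> L w" "h \<in> A" using uW by (rule W_SucE)
  have bA: "b \<in> A" using bL L_subset by blast
  \<comment> \<open>If \<open>x_b x_h\<close> is standard, \<open>b\<close> is in \<open>L u\<close>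
    as an earlier letter of \<open>L w\<close>, and \<open>g0\<close> is the Koszul-type difference
    \<open>x_b e_u - x_h e_(b # w)\<close>. Otherwise \<open>g0\<close> is \<open>x_b e_u\<close>
    alone.\<close>
  define P where "P \<longleftrightarrow> std (var b + var h)"
  have P: "b \<in> L w \<and> idx b < idx h" if P using bL that by (auto simp: u P_def)
  define e where "e = (\<lambda>u'. if u' = u then single (b, Suc 0) 1 else (0 :: ('d, 'k) laurent))"
  define e' where "e' = (\<lambda>u'. if u' = b # w then (if P then single (h, Suc 0) 1 else 0) else (0 :: ('d, 'k) laurent))"
  define g0 where "g0 = (\<lambda>u'. e u' - e' u')"
  have var_ring: "single (a, Suc 0) 1 \<in> tor_ring A" if "a \<in> A" for a
    using that tor_ring_single[of "var a" A 1] by simp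
  have g0v: "isvec (Suc n) g0"
    unfolding isvec_def g0_def e_def e'_def
    using var_ring[OF bA] var_ring[OF u(4)] by (intro ballI tor_ring_diff) auto
  define y where "y = comb n s g0"
  have ye': "comb n s e' w' = (if P then single (h, Suc 0) 1 * s (b # w) w' else 0)" for w'
  proof (cases P)
    case True
    then show ?thesis unfolding e'_def using comb_delta[of "b # w" n s _ w'] P u by simp
  qed (simp add: e'_def comb_def)
  have y: "y w' = single (b, Suc 0) 1 * s u w' -
      (if P then single (h, Suc 0) 1 * s (b # w) w' else 0)" for w'
    unfolding y_def g0_def comb_diff ye' by (simp add: e_def comb_delta[OF uW])
  define B where "B = (var b + (var h + mu w), w)"
  define d0 where "d0 = (b, Suc 0) + (h, Suc 0)"
  have shift: "snd x = 2 \<and> ((x, w') = ((a, Suc 0) + (c, Suc 0), w) \<or> vlt (val (x, w')) (var a + (var c + mu w), w))"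
    if aA: "a \<in> A" and cL: "c \<in> L w" and w': "w' \<in> W n"
      and xk: "x \<in> keys (single (a, Suc 0) 1 * s (c # w) w')" for a c x w'
  proof -
    have cw: "c # w \<in> W (Suc n)" using cL u by simp
    note sp = gens_props[OF gens cw, unfolded list.sel mu.simps]
    obtain x1 where x1: "x = (a, Suc 0) + x1" "x1 \<in> keys (s (c # w) w')"
      using xk keys_single_times by blast
    then have x1s: "(x1, w') \<in> vsupp n (s (c # w))" using w' by (simp add: vsupp_def)
    have "vlt (val (x, w')) (var a + (var c + mu w), w)" if ne: "(x1, w') \<noteq> ((c, Suc 0), w)"
    proof -
      have "vlt (val (x1, w')) (var c + mu w, w)" using sp(4)[OF x1s ne] .
      then have "vlt (val (tdeg (var a) + x1, w')) (var a + (var c + mu w), w)"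
        using vsupp_G[OF sp(1) x1s] std_deg_le_1[of "var a"] aA by (intro vlt_shift[where n = n]) auto
      then show ?thesis using x1 by simp
    qed
    then show ?thesis using x1 sp(2)[OF x1s] by (cases "(x1, w') = ((c, Suc 0), w)") simp_all
  qed
  have yb: "snd x = 2 \<and> vlt (val (x, w')) B" if "(x, w') \<in> vsupp n y" for x w'
  proof -
    have w': "w' \<in> W n" and nz: "lookup (y w') x \<noteq> 0"
      using that by (auto simp: vsupp_def in_keys_iff)
    consider "x \<in> keys (single (b, Suc 0) 1 * s (h # w) w')"
      | "P" "x \<in> keys (single (h, Suc 0) 1 * s (b # w) w')"
      using nz unfolding y lookup_minus by (fastforce simp: in_keys_iff u split: if_splits)
    then have *: "snd x = 2 \<and> ((x, w') = (d0, w) \<or> vlt (val (x, w')) B)"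
    proof cases
      case 1
      then show ?thesis using shift[OF bA u(3) w'] by (simp add: d0_def B_def)
    next
      case 2
      then have "snd x = 2 \<and> ((x, w') = ((h, Suc 0) + (b, Suc 0), w) \<or> vlt (val (x, w')) (var h + (var b + mu w), w))"
        using shift[OF u(4) _ w'] P by blast
      then show ?thesis by (simp add: d0_def B_def add.commute add.left_commute)
    qed
    \<comment> \<open>At the critical term the two leading terms cancel if \<open>P\<close> holds;
      if not, passing to the normal form of \<open>x_b x_h\<close> already makes the term
      smaller.\<close>
    have "vlt (val (x, w')) B" if eq: "(x, w') = (d0, w)"
    proof (cases P)
      case True
      have bw: "b # w \<in> W (Suc n)" using P True u by simp
      have "lookup (y w) d0 =
        lookup (single (b, Suc 0) 1 * s u w) ((b, Suc 0) + (h, Suc 0)) -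
        lookup (single (h, Suc 0) 1 * s (b # w) w) ((h, Suc 0) + (b, Suc 0))"
        using True by (simp add: y lookup_minus d0_def add.commute)
      also have "\<dots> = 0"
        unfolding lookup_single_times using gens_props(3)[OF gens uW] gens_props(3)[OF gens bw] u by simp
      finally show ?thesis using nz eq by simp
    next
      case False
      have d0t: "tdeg (var b + var h) = d0" by (simp add: tdeg_add d0_def)
      have vA: "var b + var h \<in> monomials A" using bA u by simp
      then have "d0 \<in> G" using d0t by blast
      then have "nf d0 \<noteq> var b + var h" using nf_props(1) False P_def by metis
      then have "lt (nf d0) (var b + var h)" using nf_le[OF vA d0t] by simp
      then have "lt (nf d0 + mu w) (var b + var h + mu w)" using lt_add mu_in[OF u(2)] by blast
      then show ?thesis using eq by (simp add: vlt_def val_def B_def add.assoc)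
    qed
    then show ?thesis using * by blast
  qed
  \<comment> \<open>The image is homogeneous of degree two, so the quotient by linear columns is
    linear: this is where linearity is passed on.\<close>
  have deg2: "\<And>g w. (g, w) \<in> vsupp n (comb n s g0) \<Longrightarrow> snd g \<in> {2}"
    using yb by (auto simp: y_def)
  have "\<exists>c. quotient n s {2} y c"
    unfolding y_def by (rule groebner_division[OF gb g0v deg2]) simp_all
  then obtain c where c: "isvec (Suc n) c" "\<forall>w\<in>W n. y w = comb n s c w"
    and c3: "\<forall>(g, u)\<in>vsupp (Suc n) c. Suc (snd g) \<in> {2}"
    and c4: "\<forall>B. (\<forall>t\<in>vsupp n y. vlt (val t) B) \<longrightarrow> (\<forall>(g, u)\<in>vsupp (Suc n) c. vlt (nf g + mu u, tl u) B)"
    unfolding quotient_def by blast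
  have yB: "\<forall>t\<in>vsupp n y. vlt (val t) B" using yb by fast
  have cB: "vlt (nf x + mu z, tl z) B" if "(x, z) \<in> vsupp (Suc n) c" for x z
    using c4 yB that by fast
  define g where "g = (\<lambda>u'. g0 u' - c u')"
  have "syz n s g"
    using g0v c(1,2) unfolding syz_def g_def isvec_def comb_diff
    by (auto simp: y_def intro: tor_ring_diff)
  moreover have supp: "(x, z) = ((b, Suc 0), u) \<or> (P \<and> (x, z) = ((h, Suc 0), b # w)) \<or> (x, z) \<in> vsupp (Suc n) c"
    if "(x, z) \<in> vsupp (Suc n) g" for x z
  proof -
    have "x \<in> keys (e z) \<union> keys (e' z) \<union> keys (c z)" "z \<in> W (Suc n)"
      using that keys_minus_subset[of "g0 z" "c z"] keys_minus_subset[of "e z" "e' z"]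
      by (auto simp: vsupp_def g_def g0_def)
    then show ?thesis by (auto simp: vsupp_def e_def e'_def split: if_splits)
  qed
  moreover have "\<forall>(x, z)\<in>vsupp (Suc n) g. snd x = 1"
    using supp c3 by fastforce
  moreover have "lookup (g u) (b, Suc 0) = 1"
  proof -
    have "e' u = 0" using P u by (auto simp: e'_def)
    moreover have "lookup (c u) (b, Suc 0) = 0"
    proof (rule ccontr)
      assume "lookup (c u) (b, Suc 0) \<noteq> 0"
      then have "((b, Suc 0), u) \<in> vsupp (Suc n) c" using uW by (simp add: vsupp_def in_keys_iff)
      then have "vlt (nf (b, Suc 0) + mu u, tl u) B" by (rule cB)
      then show False by (simp add: nf_var[OF bA] u B_def)
    qed
    ultimately show ?thesis by (simp add: g_def g0_def e_def lookup_minus)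
  qed
  moreover
  have bound: "vlt (val (x, z)) (var b + mu u, u)" if xz: "(x, z) \<in> vsupp (Suc n) g" "(x, z) \<noteq> ((b, Suc 0), u)" for x z
  proof -
    consider "P" "(x, z) = ((h, Suc 0), b # w)" | "(x, z) \<in> vsupp (Suc n) c" using supp xz by blast
    then show ?thesis
    proof cases
      \<comment> \<open>\<open>x_h e_(b # w)\<close> has the same total monomial as
        \<open>x_b e_u\<close> and loses the tie because \<open>b\<close> precedes
        \<open>h\<close>.\<close>
      case 1
      then show ?thesis using P nf_var[OF u(4)] by (simp add: vlt_def val_def u add.left_commute)
    next
      case 2
      then have "z \<in> W (Suc n)" by (simp add: vsupp_def)
      then obtain h' w' where "z = h' # w'" by (rule W_SucE)
      then show ?thesis using cB[OF 2] by (auto simp: vlt_def val_def B_def u)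
    qed
  qed
  then have "\<forall>t\<in>vsupp (Suc n) g. t \<noteq> ((b, Suc 0), u) \<longrightarrow> vlt (val t) (var b + mu u, u)"
    using bound by (metis surj_pair)
  ultimately show ?thesis by blast
qed


lemma comb_comb:
  "comb n s (comb (Suc n) s' c) w = (\<Sum>x\<in>W (Suc (Suc n)). c x * comb n s (s' x) w)"
  unfolding comb_def by (simp add: sum_distrib_right sum_distrib_left mult.assoc) (rule sum.swap)

text \<open>\<open>syz_lead\<close> applies to every syzygy and not only to combinations of the
  chosen columns. Hence these columns form a Groebner basis of the whole syzygy module, and division
  by them gives exactness.\<close>

lemma groebner_step:
  fixes s :: "(int ^ 'd) list \<Rightarrow> ('d, 'k::field) vect"
  assumes gb: "groebner n s"
  shows "\<exists>s'. groebner (Suc n) s' \<and>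
    (\<forall>v. isvec (Suc n) v \<longrightarrow> ((\<forall>w\<in>W n. comb n s v w = 0) \<longleftrightarrow>
      (\<exists>c. isvec (Suc (Suc n)) c \<and> (\<forall>u\<in>W (Suc n). v u = comb (Suc n) s' c u))))"
proof -
  have gens: "gens n s" using gb by (simp add: groebner_def)
  have "\<forall>x\<in>W (Suc (Suc n)). \<exists>g. syz n s g \<and> (\<forall>(a, y)\<in>vsupp (Suc n) g. snd a = 1) \<and>
    lookup (g (tl x)) (hd x, Suc 0) = 1 \<and>
    (\<forall>t\<in>vsupp (Suc n) g. t \<noteq> ((hd x, Suc 0), tl x) \<longrightarrow> vlt (val t) (mu x, tl x))"
  proof
    fix x assume "x \<in> W (Suc (Suc n))"
    then obtain b u where x: "x = b # u" "u \<in> W (Suc n)" "b \<in> L u" by (rule W_SucE)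
    show "\<exists>g. syz n s g \<and> (\<forall>(a, y)\<in>vsupp (Suc n) g. snd a = 1) \<and>
      lookup (g (tl x)) (hd x, Suc 0) = 1 \<and>
      (\<forall>t\<in>vsupp (Suc n) g. t \<noteq> ((hd x, Suc 0), tl x) \<longrightarrow> vlt (val t) (mu x, tl x))"
      using syz_exists[OF gb x(2,3)] by (simp add: x(1))
  qed
  from bchoice[OF this] obtain s' where s': "\<And>x. x \<in> W (Suc (Suc n)) \<Longrightarrow> syz n s (s' x) \<and>
    (\<forall>(a, y)\<in>vsupp (Suc n) (s' x). snd a = 1) \<and>
    lookup (s' x (tl x)) (hd x, Suc 0) = 1 \<and>
    (\<forall>t\<in>vsupp (Suc n) (s' x). t \<noteq> ((hd x, Suc 0), tl x) \<longrightarrow> vlt (val t) (mu x, tl x))"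
    by blast
  have gens': "gens (Suc n) s'"
    unfolding gens_def
  proof (intro ballI)
    fix u b assume "u \<in> W (Suc n)" "b \<in> L u"
    then show "isvec (Suc n) (s' (b # u)) \<and> (\<forall>(g, w')\<in>vsupp (Suc n) (s' (b # u)). snd g = 1) \<and>
        lookup (s' (b # u) u) (b, Suc 0) = 1 \<and>
        (\<forall>t\<in>vsupp (Suc n) (s' (b # u)). t \<noteq> ((b, Suc 0), u) \<longrightarrow> vlt (val t) (var b + mu u, u))"
      using s'[of "b # u"] by (simp add: syz_def)
  qed
  have comb_syz: "syz n s (comb (Suc n) s' c)" if "isvec (Suc (Suc n)) c" for c
    unfolding syz_def comb_comb using isvec_comb[OF gens' that] s'
    by (auto simp: syz_def intro!: sum.neutral)
  have gb': "groebner (Suc n) s'"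
    unfolding groebner_def using gens' syz_lead[OF gens comb_syz] by blast
  have "\<exists>c. isvec (Suc (Suc n)) c \<and> (\<forall>u\<in>W (Suc n). v u = comb (Suc n) s' c u)" if v: "syz n s v" for v
  proof -
    let ?D = "(\<lambda>(g, w). snd g) ` vsupp (Suc n) v"
    have closed: "syz n s (\<lambda>w. v w - single (tdeg m) k * s' u w)"
      if "syz n s v" "u \<in> W (Suc (Suc n))" "m \<in> monomials A" for v u m k
    proof -
      have su: "syz n s (s' u)" using s' that by blast
      have "comb n s (\<lambda>w. v w - single (tdeg m) k * s' u w) w =
          comb n s v w - single (tdeg m) k * comb n s (s' u) w" for w
        unfolding comb_diff by (simp add: comb_def sum_distrib_left mult.assoc)
      then show ?thesis using that(1) su tor_ring_single[OF that(3)]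
        by (auto simp: syz_def isvec_def intro!: tor_ring_diff tor_ring_mult)
    qed
    have "\<exists>c. quotient (Suc n) s' ?D v c"
    proof (rule division[OF gens', where Z = "syz n s"])
      show "isvec (Suc n) v" if "syz n s v" for v using that by (simp add: syz_def)
      show "\<exists>h\<in>L (snd t). h \<in> keys (nf (fst t))" if "syz n s v" "is_lead (Suc n) v t" for v t
        using syz_lead[OF gens that] .
      show "finite ?D" using finite_vsupp by blast
      show "snd g \<in> ?D" if "(g, w) \<in> vsupp (Suc n) v" for g w using that by force
    qed (use v closed in auto)
    then show ?thesis unfolding quotient_def by blast
  qed
  moreover have "comb n s v w = 0" if "w \<in> W n" "isvec (Suc (Suc n)) c" "\<forall>u\<in>W (Suc n). v u = comb (Suc n) s' c u" for v c w
  proof -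
    have "comb n s v w = comb n s (comb (Suc n) s' c) w"
      using that(3) unfolding comb_def by (intro sum.cong refl) auto
    then show ?thesis using comb_syz[OF that(2)] that(1) by (simp add: syz_def)
  qed
  ultimately have "\<forall>v. isvec (Suc n) v \<longrightarrow> ((\<forall>w\<in>W n. comb n s v w = 0) \<longleftrightarrow>
      (\<exists>c. isvec (Suc (Suc n)) c \<and> (\<forall>u\<in>W (Suc n). v u = comb (Suc n) s' c u)))"
    unfolding syz_def by blast
  then show ?thesis using gb' by blast
qed

section \<open>The first differential and the resolution of the residue field\<close>

definition s0 :: "(int ^ 'd) list \<Rightarrow> ('d, 'k::field) vect" where
  "s0 u w = single (hd u, Suc 0) 1"

lemma gens_s0: "gens 0 s0"
proof -
  have "single (h, Suc 0) 1 \<in> tor_ring A" if "h \<in> A" for h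
    using that tor_ring_single[of "var h" A 1] by simp
  then show ?thesis by (auto simp: gens_def s0_def isvec_def vsupp_def)
qed

text \<open>A normal form of positive degree contains some variable, and \<open>L []\<close>
  consists of all variables.\<close>

lemma irrelevant_lead:
  assumes "\<forall>g\<in>keys (v []). 0 < snd g" "isvec 0 v" "is_lead 0 v t"
  shows "\<exists>h\<in>L (snd t). h \<in> keys (nf (fst t))"
proof -
  obtain g where t: "t = (g, [])" "g \<in> keys (v [])"
    using assms(3) by (auto simp: is_lead_def vsupp_def)
  then have "g \<in> G" using assms(2) by (auto simp: isvec_def tor_ring_def)
  then have nf: "nf g \<in> monomials A" "mdeg (nf g) = snd g" using nf_props[of g] by (auto simp flip: snd_tdeg)
  then have "nf g \<noteq> 0" using assms(1) t by fastforce
  then obtain h where "h \<in> keys (nf g)" by (metis all_not_in_conv keys_eq_empty)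
  then show ?thesis using nf(1) t by (auto simp: monomials_def)
qed

lemma comb_s0_degree:
  assumes "g \<in> keys (comb 0 s0 c w)"
  shows "0 < snd g"
proof -
  obtain u where "g \<in> keys (c u * s0 u w)"
    using assms keys_sum[of "\<lambda>u. c u * s0 u w" "W (Suc 0)"] by (auto simp: comb_def)
  then show ?thesis using keys_mult[of "c u" "s0 u w"] by (auto simp: s0_def)
qed

lemma groebner_s0: "groebner 0 (s0 :: (int ^ 'd) list \<Rightarrow> ('d, 'k::field) vect)"
  unfolding groebner_def
proof (intro conjI allI impI)
  fix c :: "('d, 'k) vect" and t assume "isvec (Suc 0) c" "is_lead 0 (comb 0 s0 c) t"
  then show "\<exists>h\<in>L (snd t). h \<in> keys (nf (fst t))"
    using comb_s0_degree isvec_comb[OF gens_s0] by (intro irrelevant_lead) auto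
qed (rule gens_s0)

lemma irrelevant_ideal_eq:
  "irrelevant_ideal (tor_ring A :: ('d, 'k::field) laurent set) = {comb 0 s0 c [] | c. isvec (Suc 0) c}"
proof (intro equalityI subsetI)
  fix f :: "('d, 'k) laurent" assume f: "f \<in> irrelevant_ideal (tor_ring A)"
  let ?v = "\<lambda>_ :: (int ^ 'd) list. f"
  let ?D = "(\<lambda>(g, w). snd g) ` vsupp 0 ?v"
  have "\<exists>c. quotient 0 s0 ?D ?v c"
  proof (rule division[OF gens_s0, where Z = "\<lambda>v. v [] \<in> irrelevant_ideal (tor_ring A)"])
    show "v [] - single (tdeg m) k * s0 u [] \<in> irrelevant_ideal (tor_ring A)"
      if v: "v [] \<in> irrelevant_ideal (tor_ring A)" and u: "u \<in> W (Suc 0)" and m: "m \<in> monomials A"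
      for v :: "('d, 'k) vect" and u m k
    proof -
      have "s0 u [] \<in> (tor_ring A :: ('d, 'k) laurent set)" using gens_props(1)[OF gens_s0 u] by (simp add: isvec_def)
      then have "v [] - single (tdeg m) k * s0 u [] \<in> tor_ring A"
        using v tor_ring_single[OF m] by (auto simp: irrelevant_ideal_def intro!: tor_ring_diff tor_ring_mult)
      moreover have "0 < snd g" if g: "g \<in> keys (v [] - single (tdeg m) k * s0 u [])" for g
      proof -
        have "g \<in> keys (v []) \<or> g \<in> keys (single (tdeg m) k * s0 u [])"
          using g keys_minus_subset[of "v []" "single (tdeg m) k * s0 u []"] by blast
        then show ?thesis
        proof
          assume "g \<in> keys (v [])"
          then show ?thesis using v by (auto simp: irrelevant_ideal_def)
        next
          assume "g \<in> keys (single (tdeg m) k * s0 u [])"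
          then show ?thesis using keys_single_times[of "tdeg m" k "s0 u []"] by (auto simp: s0_def)
        qed
      qed
      ultimately show ?thesis by (simp add: irrelevant_ideal_def)
    qed
    show "\<exists>h\<in>L (snd t). h \<in> keys (nf (fst t))"
      if "v [] \<in> irrelevant_ideal (tor_ring A)" "is_lead 0 v t" for v :: "('d, 'k) vect" and t
      using that by (intro irrelevant_lead[of v]) (auto simp: irrelevant_ideal_def isvec_def)
    show "finite ?D" using finite_vsupp by blast
    show "snd g \<in> ?D" if "(g, w) \<in> vsupp 0 ?v" for g w using that by force
  qed (use f in \<open>auto simp: irrelevant_ideal_def isvec_def\<close>)
  then show "f \<in> {comb 0 s0 c [] | c. isvec (Suc 0) c}" by (auto simp: quotient_def)
next
  fix f :: "('d, 'k) laurent" assume "f \<in> {comb 0 s0 c [] | c. isvec (Suc 0) c}"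
  then show "f \<in> irrelevant_ideal (tor_ring A)"
    using isvec_comb[OF gens_s0] comb_s0_degree by (auto simp: irrelevant_ideal_def isvec_def)
qed

text \<open>The differentials are obtained by dependent choice from \<open>groebner_step\<close>.
  The rest translates words into the natural-number indices of
  \<open>linear_resolution\<close>.\<close>

lemma koszul_tor_ring: "koszul (tor_ring A :: ('d, 'k::field) laurent set)"
proof -
  let ?R = "tor_ring A :: ('d, 'k) laurent set"
  have "\<exists>f. \<forall>n. (groebner n (f n :: (int ^ 'd) list \<Rightarrow> ('d, 'k) vect) \<and> (n = 0 \<longrightarrow> f n = s0)) \<and>
    (\<forall>v. isvec (Suc n) v \<longrightarrow> ((\<forall>w\<in>W n. comb n (f n) v w = 0) \<longleftrightarrow>
      (\<exists>c. isvec (Suc (Suc n)) c \<and> (\<forall>u\<in>W (Suc n). v u = comb (Suc n) (f (Suc n)) c u))))"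
    by (rule dependent_nat_choice) (use groebner_s0 groebner_step in blast)+
  then obtain f :: "nat \<Rightarrow> (int ^ 'd) list \<Rightarrow> ('d, 'k) vect" where
    f: "\<forall>n. (groebner n (f n) \<and> (n = 0 \<longrightarrow> f n = s0)) \<and>
    (\<forall>v. isvec (Suc n) v \<longrightarrow> ((\<forall>w\<in>W n. comb n (f n) v w = 0) \<longleftrightarrow>
      (\<exists>c. isvec (Suc (Suc n)) c \<and> (\<forall>u\<in>W (Suc n). v u = comb (Suc n) (f (Suc n)) c u))))" ..
  then have gb: "\<And>n. groebner n (f n)" and f0: "f 0 = s0" by simp_all
  have exact: "(\<forall>w\<in>W n. comb n (f n) v w = 0) \<longleftrightarrow>
      (\<exists>c. isvec (Suc (Suc n)) c \<and> (\<forall>u\<in>W (Suc n). v u = comb (Suc n) (f (Suc n)) c u))"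
    if "isvec (Suc n) v" for n v
    using spec[OF conjunct2[OF spec[OF f, of n]], of v] that by (rule mp)
  define b where "b n = card (W n)" for n
  have "\<exists>e. \<forall>n. bij_betw (e n) {..<b n} (W n)"
    using ex_bij_betw_nat_finite[OF finite_W] by (intro choice) (simp add: b_def atLeast0LessThan)
  then obtain e where e: "\<And>n. bij_betw (e n) {..<b n} (W n)" by blast
  define D where "D i j l = f i (e (Suc i) j) (e i l)" for i j l
  \<comment> \<open>Turns a vector indexed by numbers into one indexed by words, through the inverse
    of the numbering \<open>e n\<close>.\<close>
  define dec where "dec n v u = v (the_inv_into {..<b n} (e n) u)" for n and v :: "nat \<Rightarrow> ('d, 'k) laurent" and u
  have dec: "dec n v (e n j) = v j" if "j < b n" for n v j
    using that e[of n] by (simp add: dec_def the_inv_into_f_f bij_betw_def)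
  have eW: "e n j \<in> W n" if "j < b n" for n j
    using that e[of n] by (auto simp: bij_betw_def)
  have allW: "(\<forall>w\<in>W n. Q w) \<longleftrightarrow> (\<forall>l<b n. Q (e n l))" for n Q
    using bij_betw_imp_surj_on[OF e[of n]] by (metis imageE imageI lessThan_iff)
  have isvec_iff: "isvec n v \<longleftrightarrow> (\<forall>j<b n. v (e n j) \<in> ?R)" for n and v :: "('d, 'k) vect"
    unfolding isvec_def by (rule allW)
  have isvec_dec: "isvec n (dec n v) \<longleftrightarrow> (\<forall>j<b n. v j \<in> ?R)" for n v
    unfolding isvec_iff using dec by auto
  have sum_eq: "(\<Sum>j<b (Suc i). c (e (Suc i) j) * D i j l) = comb i (f i) c (e i l)" for i l c
    unfolding comb_def D_def by (rule sum.reindex_bij_betw[OF e])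
  have sum_dec: "(\<Sum>j<b (Suc i). v j * D i j l) = comb i (f i) (dec (Suc i) v) (e i l)" for i l v
    unfolding sum_eq[symmetric] using dec by (intro sum.cong) auto
  have "linear_resolution ?R b D"
    unfolding linear_resolution_def
  proof (intro conjI allI impI)
    show "b 0 = 1" by (simp add: b_def)
  next
    fix i j l assume j: "j < b (Suc i)" and l: "l < b i"
    have "gens i (f i)" using gb[of i] by (simp add: groebner_def)
    note p = gens_props[OF this eW[OF j]]
    show "D i j l \<in> graded_part ?R 1"
      using p(1) p(2)[of _ "e i l"] eW[OF l] by (auto simp: graded_part_def D_def isvec_def vsupp_def)
  next
    have e0: "e 0 0 = []" using eW[of 0 0] by (simp add: b_def)
    have "{\<Sum>j<b 1. v j * D 0 j 0 | v. \<forall>j<b 1. v j \<in> ?R} = {comb 0 s0 c [] | c. isvec (Suc 0) c}"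
    proof (intro equalityI subsetI)
      fix x assume "x \<in> {\<Sum>j<b 1. v j * D 0 j 0 | v. \<forall>j<b 1. v j \<in> ?R}"
      then obtain v where v: "x = (\<Sum>j<b (Suc 0). v j * D 0 j 0)" "\<forall>j<b (Suc 0). v j \<in> ?R" by auto
      then show "x \<in> {comb 0 s0 c [] | c. isvec (Suc 0) c}"
        using sum_dec[of v 0 0] isvec_dec[of "Suc 0" v] e0 f0 by auto
    next
      fix x :: "('d, 'k) laurent" assume "x \<in> {comb 0 s0 c [] | c. isvec (Suc 0) c}"
      then obtain c where c: "x = comb 0 s0 c []" "isvec (Suc 0) c" by auto
      then show "x \<in> {\<Sum>j<b 1. v j * D 0 j 0 | v. \<forall>j<b 1. v j \<in> ?R}"
        using sum_eq[of c 0 0] isvec_iff[of "Suc 0" c] e0 f0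
        by (intro CollectI exI[of _ "\<lambda>j. c (e (Suc 0) j)"]) auto
    qed
    then show "{\<Sum>j<b 1. v j * D 0 j 0 | v. \<forall>j<b 1. v j \<in> ?R} = irrelevant_ideal ?R"
      by (simp add: irrelevant_ideal_eq)
  next
    fix i v assume "\<forall>j<b (Suc i). v j \<in> ?R"
    then have v: "isvec (Suc i) (dec (Suc i) v)" by (simp add: isvec_dec)
    have "(\<forall>l<b i. (\<Sum>j<b (Suc i). v j * D i j l) = 0) \<longleftrightarrow> (\<forall>w\<in>W i. comb i (f i) (dec (Suc i) v) w = 0)"
      unfolding sum_dec allW ..
    also have "\<dots> \<longleftrightarrow> (\<exists>c. isvec (Suc (Suc i)) c \<and> (\<forall>u\<in>W (Suc i). dec (Suc i) v u = comb (Suc i) (f (Suc i)) c u))"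
      by (rule exact[OF v])
    also have "\<dots> \<longleftrightarrow> (\<exists>c. isvec (Suc (Suc i)) c \<and> (\<forall>j<b (Suc i). v j = comb (Suc i) (f (Suc i)) c (e (Suc i) j)))"
      unfolding allW using dec by auto
    also have "\<dots> \<longleftrightarrow> (\<exists>w. (\<forall>k<b (Suc (Suc i)). w k \<in> ?R) \<and>
        (\<forall>j<b (Suc i). v j = (\<Sum>k<b (Suc (Suc i)). w k * D (Suc i) k j)))"
    proof
      assume "\<exists>c. isvec (Suc (Suc i)) c \<and> (\<forall>j<b (Suc i). v j = comb (Suc i) (f (Suc i)) c (e (Suc i) j))"
      then obtain c where "isvec (Suc (Suc i)) c" "\<forall>j<b (Suc i). v j = comb (Suc i) (f (Suc i)) c (e (Suc i) j)"
        by blast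
      then show "\<exists>w. (\<forall>k<b (Suc (Suc i)). w k \<in> ?R) \<and>
          (\<forall>j<b (Suc i). v j = (\<Sum>k<b (Suc (Suc i)). w k * D (Suc i) k j))"
        using isvec_iff by (intro exI[of _ "\<lambda>k. c (e (Suc (Suc i)) k)"]) (auto simp: sum_eq)
    next
      assume "\<exists>w. (\<forall>k<b (Suc (Suc i)). w k \<in> ?R) \<and>
          (\<forall>j<b (Suc i). v j = (\<Sum>k<b (Suc (Suc i)). w k * D (Suc i) k j))"
      then show "\<exists>c. isvec (Suc (Suc i)) c \<and> (\<forall>j<b (Suc i). v j = comb (Suc i) (f (Suc i)) c (e (Suc i) j))"
        using isvec_dec by (auto simp: sum_dec)
    qed
    finally show "(\<forall>l<b i. (\<Sum>j<b (Suc i). v j * D i j l) = 0) \<longleftrightarrow>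
        (\<exists>w. (\<forall>k<b (Suc (Suc i)). w k \<in> ?R) \<and>
        (\<forall>j<b (Suc i). v j = (\<Sum>k<b (Suc (Suc i)). w k * D (Suc i) k j)))" .
  qed
  then show ?thesis unfolding koszul_def by blast
qed

end

lemma koszul_if_quadratic_order:
  assumes "finite A" "quadratic_order A r"
  shows "koszul (tor_ring A :: ('d::finite, 'k::field) laurent set)"
proof -
  obtain idx :: "int ^ 'd \<Rightarrow> nat" where idx: "inj_on idx A"
    using finite_imp_inj_to_nat_seg[OF assms(1)] by blast
  interpret schreyer A r idx
    using assms idx unfolding quadratic_order_def by unfold_locales blast+
  show ?thesis by (rule koszul_tor_ring)
qed

section \<open>From linear resolutions to quadratic generators\<close>

definition grade :: "nat \<Rightarrow> ('d::finite, 'k::field) laurent \<Rightarrow> ('d, 'k) laurent" where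
  "grade k f = (\<Sum>m | m \<in> keys f \<and> snd m = k. single m (lookup f m))"

lemma lookup_grade: "lookup (grade k f) m = (if snd m = k then lookup f m else 0)"
  by (auto simp: grade_def lookup_sum lookup_single when_def in_keys_iff)

lemma grade_add: "grade k (f + g) = grade k f + grade k g"
  by (rule poly_mapping_eqI) (simp add: lookup_grade lookup_add)

lemma grade_zero [simp]: "grade k 0 = 0"
  by (simp add: grade_def)

lemma grade_sum: "grade k (\<Sum>i\<in>X. f i) = (\<Sum>i\<in>X. grade k (f i))"
  by (induction X rule: infinite_finite_induct) (auto simp: grade_add)

lemma grade_homogeneous: "(\<And>m. m \<in> keys f \<Longrightarrow> snd m = k) \<Longrightarrow> grade k f = f"
  by (rule poly_mapping_eqI) (auto simp: lookup_grade in_keys_iff)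

lemma grade_other: "(\<And>m. m \<in> keys f \<Longrightarrow> snd m \<noteq> k) \<Longrightarrow> grade k f = 0"
  by (rule poly_mapping_eqI) (auto simp: lookup_grade in_keys_iff)

lemma keys_grade: "keys (grade k f) = {m \<in> keys f. snd m = k}"
  by (auto simp: in_keys_iff lookup_grade split: if_splits)

lemma grade_in_graded_part: "f \<in> tor_ring A \<Longrightarrow> grade k f \<in> graded_part (tor_ring A) k"
  by (auto simp: tor_ring_def graded_part_def keys_grade)

text \<open>Multiplication by a linear element shifts components by exactly one, so coefficients in
  homogeneous relations may be replaced by their components.\<close>

lemma grade_mult_linear:
  assumes "\<And>m. m \<in> keys g \<Longrightarrow> snd m = 1"
  shows "grade (Suc k) (f * g) = grade k f * g"
proof -
  have "f * g = grade k f * g + (f - grade k f) * g" by (simp add: algebra_simps)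
  then have "grade (Suc k) (f * g) = grade (Suc k) (grade k f * g) + grade (Suc k) ((f - grade k f) * g)"
    by (simp add: grade_add)
  also have "grade (Suc k) (grade k f * g) = grade k f * g"
  proof (rule grade_homogeneous)
    fix m assume "m \<in> keys (grade k f * g)"
    then obtain a b where "m = a + b" "a \<in> keys (grade k f)" "b \<in> keys g"
      using keys_mult[of "grade k f" g] by blast
    then show "snd m = Suc k" using assms[of b] by (auto simp: keys_grade)
  qed
  also have "grade (Suc k) ((f - grade k f) * g) = 0"
  proof (rule grade_other)
    fix m assume "m \<in> keys ((f - grade k f) * g)"
    then obtain a b where ab: "m = a + b" "a \<in> keys (f - grade k f)" "b \<in> keys g"
      using keys_mult[of "f - grade k f" g] by blast
    then have "snd a \<noteq> k" by (auto simp: in_keys_iff lookup_minus lookup_grade)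
    then show "snd m \<noteq> Suc k" using assms[of b] ab by auto
  qed
  finally show ?thesis by simp
qed

definition hpoly :: "'v set \<Rightarrow> nat \<Rightarrow> ('v, 'k::field) mpoly set" where
  "hpoly A k = {p \<in> poly_ring A. \<forall>u\<in>keys p. mdeg u = k}"

lemma hpoly_zero [simp]: "0 \<in> hpoly A k"
  by (simp add: hpoly_def)

lemma hpoly_add: "p \<in> hpoly A k \<Longrightarrow> q \<in> hpoly A k \<Longrightarrow> p + q \<in> hpoly A k"
  using keys_add[of p q] by (auto simp: hpoly_def poly_ring_add)

lemma hpoly_diff: "p \<in> hpoly A k \<Longrightarrow> q \<in> hpoly A k \<Longrightarrow> p - q \<in> hpoly A k"
  using keys_minus_subset[of p q] by (auto simp: hpoly_def poly_ring_diff)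

lemma hpoly_sum: "(\<And>i. i \<in> X \<Longrightarrow> f i \<in> hpoly A k) \<Longrightarrow> (\<Sum>i\<in>X. f i) \<in> hpoly A k"
  by (induction X rule: infinite_finite_induct) (auto intro: hpoly_add)

lemma hpoly_mult: "p \<in> hpoly A k \<Longrightarrow> q \<in> hpoly A l \<Longrightarrow> p * q \<in> hpoly A (k + l)"
  using keys_mult[of p q] by (fastforce simp: hpoly_def poly_ring_mult)

lemma hpoly_single: "m \<in> monomials A \<Longrightarrow> mdeg m = k \<Longrightarrow> single m c \<in> hpoly A k"
  by (simp add: hpoly_def poly_ring_single)

text \<open>An arbitrary section of \<open>tdeg\<close>, in general not multiplicative;
  \<open>push (rep A)\<close> lifts ring elements to polynomials and preserves degrees.\<close>

definition rep :: "(int ^ 'd::finite) set \<Rightarrow> (int ^ 'd) \<times> nat \<Rightarrow> (int ^ 'd) monom" where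
  "rep A g = (SOME m. m \<in> monomials A \<and> tdeg m = g)"

lemma rep:
  assumes "g \<in> tdeg ` monomials A"
  shows "rep A g \<in> monomials A" "tdeg (rep A g) = g"
proof -
  have "\<exists>m. m \<in> monomials A \<and> tdeg m = g" using assms by auto
  from someI_ex[OF this] show "rep A g \<in> monomials A" "tdeg (rep A g) = g" by (simp_all add: rep_def)
qed

lemma push_rep:
  assumes "f \<in> tor_ring A"
  shows "push tdeg (push (rep A) f) = f"
proof -
  have "push (tdeg \<circ> rep A) f = push id f"
    using assms by (intro push_cong) (auto simp: tor_ring_def rep)
  then show ?thesis by (simp add: push_push)
qed

lemma push_rep_hpoly:
  assumes "f \<in> graded_part (tor_ring A) k"
  shows "push (rep A) f \<in> hpoly A k"
proof -
  have "u \<in> monomials A \<and> mdeg u = k" if u: "u \<in> keys (push (rep A) f)" for u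
  proof -
    obtain g where g: "g \<in> keys f" "u = rep A g" using u keys_push[of "rep A" f] by blast
    then have gG: "g \<in> tdeg ` monomials A" and "snd g = k" using assms by (auto simp: graded_part_def tor_ring_def)
    moreover have "mdeg u = snd g" using rep(2)[OF gG] g by (metis snd_tdeg)
    ultimately show ?thesis using rep(1)[OF gG] g by simp
  qed
  then show ?thesis by (auto simp: hpoly_def poly_ring_def)
qed

text \<open>The subtracted representatives add up to the lift of the image of \<open>f\<close>,
  which is zero.\<close>

lemma tor_ideal_binomial_sum:
  assumes "f \<in> tor_ideal A"
  shows "f = (\<Sum>u\<in>keys f. single 0 (lookup f u) *
    (monom_poly u - monom_poly (rep A (tdeg u))))"
proof -
  have "(\<Sum>u\<in>keys f. single (rep A (tdeg u)) (lookup f u)) =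
      push (rep A \<circ> tdeg) f"
    by (simp add: push_def)
  also have "\<dots> = 0" using assms by (simp add: tor_ideal_def flip: push_push)
  finally show ?thesis
    using poly_mapping_expand[of f] by (simp add: right_diff_distrib mult_single sum_subtractf)
qed

lemma tor_ideal_hpoly_1:
  assumes "f \<in> tor_ideal A" "f \<in> hpoly A k" "k \<le> 1"
  shows "f = 0"
proof (rule ccontr)
  assume "f \<noteq> 0"
  then obtain u where u: "u \<in> keys f" by (metis all_not_in_conv keys_eq_empty)
  then obtain v where v: "v \<in> keys f" "v \<noteq> u" "tdeg v = tdeg u"
    using tor_ideal_other_key[OF assms(1)] by blast
  moreover have "mdeg v \<le> 1" using assms v by (auto simp: hpoly_def)
  ultimately show False using tdeg_inj_mdeg_le_1 by blast
qed

locale linear_presentation =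
  fixes A :: "(int ^ 'd::finite) set" and b D
    and R :: "('d, 'k::field) laurent set"
  assumes R_def: "R = tor_ring A" and res: "linear_resolution R b D"
begin

abbreviation J :: "(int ^ 'd, 'k) mpoly set" where
  "J \<equiv> ideal_gen A (quadratic_binomials A \<inter> tor_ideal A)"

definition yh :: "nat \<Rightarrow> (int ^ 'd, 'k) mpoly" where
  "yh j = push (rep A) (D 0 j 0)"

lemma D_linear: "j < b (Suc i) \<Longrightarrow> l < b i \<Longrightarrow> D i j l \<in> graded_part (tor_ring A) 1"
  using res by (simp add: linear_resolution_def R_def)

lemma D_ring: "j < b (Suc i) \<Longrightarrow> l < b i \<Longrightarrow> D i j l \<in> tor_ring A"
  using D_linear by (auto simp: graded_part_def)

lemma D_deg: "j < b (Suc i) \<Longrightarrow> l < b i \<Longrightarrow> m \<in> keys (D i j l) \<Longrightarrow> snd m = 1"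
  using D_linear by (fastforce simp: graded_part_def)

lemma b_0: "b 0 = 1"
  using res by (simp add: linear_resolution_def)

lemma yh: "j < b 1 \<Longrightarrow> yh j \<in> hpoly A 1" "j < b 1 \<Longrightarrow> push tdeg (yh j) = D 0 j 0"
  unfolding yh_def using push_rep_hpoly[OF D_linear[of j 0 0]] push_rep[OF D_ring[of j 0 0]] b_0 by auto

lemma exact_0:
  assumes "\<And>j. j < b 1 \<Longrightarrow> v j \<in> tor_ring A"
  shows "(\<Sum>j<b 1. v j * D 0 j 0) = 0 \<longleftrightarrow>
    (\<exists>w. (\<forall>k<b 2. w k \<in> tor_ring A) \<and> (\<forall>j<b 1. v j = (\<Sum>k<b 2. w k * D 1 k j)))"
proof -
  have "\<forall>i v. (\<forall>j<b (Suc i). v j \<in> R) \<longrightarrow>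
        ((\<forall>l<b i. (\<Sum>j<b (Suc i). v j * D i j l) = 0) \<longleftrightarrow>
        (\<exists>w. (\<forall>k<b (Suc (Suc i)). w k \<in> R) \<and>
             (\<forall>j<b (Suc i). v j = (\<Sum>k<b (Suc (Suc i)). w k * D (Suc i) k j))))"
    using res unfolding linear_resolution_def by blast
  from spec[OF spec[OF this, of 0], of v] assms show ?thesis
    by (simp add: R_def b_0 numeral_2_eq_2)
qed

lemma binomial_in_J:
  assumes "u \<in> monomials A" "v \<in> monomials A" "tdeg u = tdeg v" "mdeg u \<le> 2"
  shows "monom_poly u - monom_poly v \<in> J"
proof (cases "u = v")
  case False
  then have "mdeg u = 2" "mdeg v = 2" using tdeg_inj_mdeg_le_1[OF assms(3)] tdeg_eq_mdeg[OF assms(3)] assms(4)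
    by linarith+
  then have "(monom_poly u - monom_poly v :: (int ^ 'd, 'k) mpoly) \<in> quadratic_binomials A \<inter> tor_ideal A"
    using assms False tor_ideal_binomial[OF assms(1-3)] by (auto simp: quadratic_binomials_def)
  then show ?thesis by (rule ideal_gen_gen)
qed simp

lemma tor_ideal_subset_if_binomials:
  assumes "f \<in> tor_ideal A"
    and "\<And>u v. u \<in> keys f \<Longrightarrow> u \<in> monomials A \<Longrightarrow> v \<in> monomials A \<Longrightarrow> tdeg u = tdeg v \<Longrightarrow>
      monom_poly u - monom_poly v \<in> J"
  shows "f \<in> J"
proof -
  have uA: "u \<in> monomials A" if "u \<in> keys f" for u
    using assms(1) that by (auto simp: tor_ideal_def poly_ring_def)
  have rA: "rep A (tdeg u) \<in> monomials A" "tdeg (rep A (tdeg u)) = tdeg u" if "u \<in> keys f" for u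
    using rep[OF imageI[OF uA[OF that]]] by auto
  have "(\<Sum>u\<in>keys f. single 0 (lookup f u) *
    (monom_poly u - monom_poly (rep A (tdeg u)))) \<in> J"
    using uA rA by (intro ideal_gen_sum ideal_gen_mult assms(2)) (auto intro: poly_ring_single)
  then show ?thesis using tor_ideal_binomial_sum[OF assms(1)] by simp
qed

lemma low_degree: "f \<in> tor_ideal A \<Longrightarrow> f \<in> hpoly A k \<Longrightarrow> k \<le> 2 \<Longrightarrow> f \<in> J"
  by (erule tor_ideal_subset_if_binomials, rule binomial_in_J) (auto simp: hpoly_def)

text \<open>The first differential has linear entries generating the irrelevant ideal, so in degree
  one their span with constant coefficients contains every variable. The equation lifts to
  polynomials because the toric ideal has no nonzero linear forms.\<close>

lemma var_combination:
  assumes "a \<in> A"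
  shows "\<exists>c. (monom_poly (var a) :: (int ^ 'd, 'k) mpoly) = (\<Sum>j<b 1. single 0 (c j) * yh j)"
proof -
  let ?X = "single (a, Suc 0) 1 :: ('d, 'k) laurent"
  have "?X \<in> tor_ring A" using tor_ring_single[of "var a" A 1] assms by simp
  then have "?X \<in> irrelevant_ideal R" by (simp add: irrelevant_ideal_def R_def)
  moreover have "{\<Sum>j<b 1. v j * D 0 j 0 | v. \<forall>j<b 1. v j \<in> R} = irrelevant_ideal R"
    using res unfolding linear_resolution_def by blast
  ultimately obtain v where v: "?X = (\<Sum>j<b 1. v j * D 0 j 0)" "\<forall>j<b 1. v j \<in> R" by blast
  define c where "c j = lookup (v j) 0" for j
  \<comment> \<open>Zero is the only exponent of the semigroup with \<open>s\<close>-degree zero, so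
    the degree-zero component is a constant.\<close>
  have gr0: "grade 0 (v j) = single 0 (c j)" if "j < b 1" for j
  proof (rule poly_mapping_eqI)
    fix m
    have "m = 0" if m: "m \<in> keys (v j)" "snd m = 0"
    proof -
      obtain u where "m = tdeg u" using v(2) \<open>j < b 1\<close> m(1) unfolding R_def tor_ring_def by blast
      then show ?thesis using m(2) by simp
    qed
    then show "lookup (grade 0 (v j)) m = lookup (single 0 (c j)) m"
      by (auto simp: lookup_grade lookup_single c_def when_def in_keys_iff)
  qed
  have "?X = grade (Suc 0) ?X" by (rule grade_homogeneous[symmetric]) simp
  also have "\<dots> = (\<Sum>j<b 1. grade (Suc 0) (v j * D 0 j 0))" unfolding v(1) by (rule grade_sum)
  also have "\<dots> = (\<Sum>j<b 1. grade 0 (v j) * D 0 j 0)"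
    using D_deg[of _ 0 0] b_0 by (intro sum.cong grade_mult_linear) auto
  also have "\<dots> = (\<Sum>j<b 1. single 0 (c j) * D 0 j 0)"
    using gr0 by (intro sum.cong) auto
  finally have X: "?X = (\<Sum>j<b 1. single 0 (c j) * D 0 j 0)" .
  let ?f = "monom_poly (var a) - (\<Sum>j<b 1. single 0 (c j) * yh j)"
  have "push tdeg ?f = ?X - (\<Sum>j<b 1. single 0 (c j) * D 0 j 0)"
    by (simp add: push_diff push_sum push_mult[OF tdeg_add] yh(2))
  then have p0: "push tdeg ?f = 0" using X by simp
  have "single 0 (c j) * yh j \<in> hpoly A (0 + 1)" if "j < b 1" for j
    using that by (intro hpoly_mult hpoly_single yh) auto
  then have h: "?f \<in> hpoly A 1"
    using assms by (intro hpoly_diff hpoly_sum hpoly_single) auto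
  then have "?f \<in> tor_ideal A" using p0 by (simp add: tor_ideal_def hpoly_def)
  then have "?f = 0" using tor_ideal_hpoly_1 h by blast
  then show ?thesis by auto
qed

lemma hpoly_decompose:
  assumes "f \<in> hpoly A (Suc k)"
  shows "\<exists>F. (\<forall>j<b 1. F j \<in> hpoly A k) \<and> f = (\<Sum>j<b 1. F j * yh j)"
proof -
  have "\<forall>u\<in>keys f. \<exists>F. (\<forall>j<b 1. F j \<in> hpoly A k) \<and>
      single u (lookup f u) = (\<Sum>j<b 1. F j * yh j)"
  proof
    fix u assume u: "u \<in> keys f"
    then have "mdeg u = Suc k" "u \<in> monomials A" using assms by (auto simp: hpoly_def poly_ring_def)
    then obtain a u' where a: "u = u' + var a" "mdeg u' = k" "u' \<in> monomials A" "a \<in> A"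
      by (metis One_nat_def monom_Suc_degE monomials_add_iff monomials_var)
    obtain c where c: "(monom_poly (var a) :: (int ^ 'd, 'k) mpoly) = (\<Sum>j<b 1. single 0 (c j) * yh j)"
      using var_combination[OF a(4)] by blast
    let ?x = "lookup f u"
    have "single u ?x = single u' ?x * monom_poly (var a)"
      by (simp add: mult_single a(1))
    also have "\<dots> = (\<Sum>j<b 1. single u' (?x * c j) * yh j)"
      unfolding c sum_distrib_left mult.assoc[symmetric] by (simp add: mult_single)
    finally show "\<exists>F. (\<forall>j<b 1. F j \<in> hpoly A k) \<and> single u ?x = (\<Sum>j<b 1. F j * yh j)"
      using a by (intro exI[of _ "\<lambda>j. single u' (?x * c j)"]) (auto intro: hpoly_single)
  qed
  from bchoice[OF this] obtain F where F: "\<And>u j. u \<in> keys f \<Longrightarrow> j < b 1 \<Longrightarrow> F u j \<in> hpoly A k"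
    "\<And>u. u \<in> keys f \<Longrightarrow> single u (lookup f u) = (\<Sum>j<b 1. F u j * yh j)"
    by blast
  have "f = (\<Sum>u\<in>keys f. \<Sum>j<b 1. F u j * yh j)"
    using F(2) poly_mapping_expand[of f] by simp
  also have "\<dots> = (\<Sum>j<b 1. (\<Sum>u\<in>keys f. F u j) * yh j)"
    unfolding sum_distrib_right by (rule sum.swap)
  finally show ?thesis
    using F(1) by (intro exI[of _ "\<lambda>j. \<Sum>u\<in>keys f. F u j"]) (auto intro!: hpoly_sum)
qed

text \<open>Write \<open>f\<close> with coefficients \<open>F j\<close> in terms of the linear forms
  \<open>yh j\<close>. The images of the \<open>F j\<close> form a syzygy, hence come from the
  second differential with coefficients of degree \<open>k\<close>. Lifting these splits
  \<open>f\<close> into multiples of the errors \<open>g j\<close>, which lie in the ideal in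
  smaller degree, and of the quadratic relations \<open>q t\<close>.\<close>

lemma homogeneous_in_J: "f \<in> tor_ideal A \<Longrightarrow> f \<in> hpoly A m \<Longrightarrow> f \<in> J"
proof (induction m arbitrary: f rule: less_induct)
  case (less m)
  show ?case
  proof (cases "m \<le> 2")
    case True
    then show ?thesis using less.prems low_degree by blast
  next
    case False
    then obtain k where k: "m = Suc (Suc k)" "k \<ge> 1" by (cases m; cases "m - 1") auto
    obtain F where F: "\<And>j. j < b 1 \<Longrightarrow> F j \<in> hpoly A (Suc k)" "f = (\<Sum>j<b 1. F j * yh j)"
      using hpoly_decompose less.prems(2) k by blast
    define v where "v j = push tdeg (F j)" for j
    have FR: "v j \<in> tor_ring A" if "j < b 1" for j
      unfolding v_def using F(1)[OF that] by (intro push_tdeg_in_tor_ring) (simp add: hpoly_def)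
    have "push tdeg f = (\<Sum>j<b 1. v j * D 0 j 0)"
      unfolding F(2) by (simp add: push_sum push_mult[OF tdeg_add] yh(2) v_def)
    then have "(\<Sum>j<b 1. v j * D 0 j 0) = 0" using less.prems(1) by (simp add: tor_ideal_def)
    then obtain w where w: "\<forall>t<b 2. w t \<in> tor_ring A" "\<forall>j<b 1. v j = (\<Sum>t<b 2. w t * D 1 t j)"
      using exact_0[of v] FR by blast
    define wh where "wh t = push (rep A) (grade k (w t))" for t
    define Dh where "Dh t j = push (rep A) (D 1 t j)" for t j
    have gr: "grade k (w t) \<in> graded_part (tor_ring A) k" if "t < b 2" for t
      using w that grade_in_graded_part by blast
    have wh: "wh t \<in> hpoly A k" "push tdeg (wh t) = grade k (w t)" if "t < b 2" for t
      unfolding wh_def using push_rep_hpoly[OF gr[OF that]] push_rep[of "grade k (w t)" A] gr[OF that]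
      by (auto simp: graded_part_def)
    have D1: "D 1 t j \<in> graded_part (tor_ring A) 1" if "t < b 2" "j < b 1" for t j
      using D_linear[of t 1 j] that by (simp add: numeral_2_eq_2)
    have Dh: "Dh t j \<in> hpoly A 1" "push tdeg (Dh t j) = D 1 t j" if "t < b 2" "j < b 1" for t j
      unfolding Dh_def using push_rep_hpoly[OF D1[OF that]] push_rep[of "D 1 t j" A] D1[OF that]
      by (auto simp: graded_part_def)
    have v_eq: "v j = (\<Sum>t<b 2. grade k (w t) * D 1 t j)" if "j < b 1" for j
    proof -
      have "snd m = Suc k" if m: "m \<in> keys (v j)" for m
      proof -
        obtain u where "u \<in> keys (F j)" "m = tdeg u"
          using m keys_push[of tdeg "F j"] by (auto simp: v_def)
        then show ?thesis using F(1)[OF \<open>j < b 1\<close>] by (auto simp: hpoly_def)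
      qed
      then have "v j = grade (Suc k) (v j)" by (intro grade_homogeneous[symmetric])
      also have "\<dots> = (\<Sum>t<b 2. grade (Suc k) (w t * D 1 t j))"
        using w(2) that by (simp add: grade_sum)
      also have "\<dots> = (\<Sum>t<b 2. grade k (w t) * D 1 t j)"
        using D1 that by (intro sum.cong grade_mult_linear) (auto simp: graded_part_def)
      finally show ?thesis .
    qed
    define g where "g j = F j - (\<Sum>t<b 2. wh t * Dh t j)" for j
    have gJ: "g j \<in> J" if "j < b 1" for j
    proof (rule less.IH)
      show "Suc k < m" using k by simp
      have "wh t * Dh t j \<in> hpoly A (k + 1)" if "t < b 2" for t
        using wh Dh that \<open>j < b 1\<close> by (intro hpoly_mult) auto
      then show h: "g j \<in> hpoly A (Suc k)" unfolding g_def using F(1)[OF that] by (intro hpoly_diff hpoly_sum) auto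
      have "push tdeg (g j) = v j - (\<Sum>t<b 2. grade k (w t) * D 1 t j)"
        using that by (simp add: g_def push_diff push_sum push_mult[OF tdeg_add] wh Dh v_def)
      then show "g j \<in> tor_ideal A" using v_eq[OF that] h by (simp add: tor_ideal_def hpoly_def)
    qed
    define q where "q t = (\<Sum>j<b 1. Dh t j * yh j)" for t
    have qJ: "q t \<in> J" if t: "t < b 2" for t
    proof (rule low_degree)
      have "Dh t j * yh j \<in> hpoly A (1 + 1)" if "j < b 1" for j
        using Dh yh t that by (intro hpoly_mult) auto
      then show h: "q t \<in> hpoly A 2" unfolding q_def by (intro hpoly_sum) (auto simp: numeral_2_eq_2)
      \<comment> \<open>Row \<open>t\<close> of the second differential is the image of a unit
        vector, so exactness makes it a syzygy of the first one.\<close>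
      have "D 1 t j = (\<Sum>k<b 2. (if k = t then 1 else 0) * D 1 k j)" for j
      proof -
        have "(\<Sum>k<b 2. (if k = t then 1 else 0) * D 1 k j) = (\<Sum>k<b 2. if k = t then D 1 t j else 0)"
          by (intro sum.cong) auto
        then show ?thesis using t by simp
      qed
      then have "\<exists>w. (\<forall>k<b 2. w k \<in> tor_ring A) \<and> (\<forall>j<b 1. D 1 t j = (\<Sum>k<b 2. w k * D 1 k j))"
        using tor_ring_const[of 1 A] by (intro exI[of _ "\<lambda>k. if k = t then 1 else 0"]) auto
      then have "(\<Sum>j<b 1. D 1 t j * D 0 j 0) = 0"
        using exact_0[of "D 1 t"] D1[OF t] by (auto simp: graded_part_def)
      moreover have "push tdeg (q t) = (\<Sum>j<b 1. D 1 t j * D 0 j 0)"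
        using t by (simp add: q_def push_sum push_mult[OF tdeg_add] Dh yh)
      ultimately show "q t \<in> tor_ideal A" using h by (simp add: tor_ideal_def hpoly_def)
    qed simp
    have "f = (\<Sum>j<b 1. g j * yh j) + (\<Sum>j<b 1. (\<Sum>t<b 2. wh t * Dh t j) * yh j)"
      unfolding F(2) g_def by (simp add: left_diff_distrib sum_subtractf)
    also have "(\<Sum>j<b 1. (\<Sum>t<b 2. wh t * Dh t j) * yh j) = (\<Sum>t<b 2. wh t * q t)"
      unfolding q_def sum_distrib_right sum_distrib_left mult.assoc by (rule sum.swap)
    also have "(\<Sum>j<b 1. g j * yh j) = (\<Sum>j<b 1. yh j * g j)" by (simp add: mult.commute)
    also have "(\<Sum>j<b 1. yh j * g j) + (\<Sum>t<b 2. wh t * q t) \<in> J"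
      using gJ qJ yh wh by (intro ideal_gen_add ideal_gen_sum ideal_gen_mult) (auto simp: hpoly_def)
    finally show ?thesis .
  qed
qed

lemma generated: "generated_by_quadratic_binomials A (tor_ideal A :: (int ^ 'd, 'k) mpoly set)"
proof -
  have "tor_ideal A \<subseteq> J"
  proof
    fix f :: "(int ^ 'd, 'k) mpoly" assume f: "f \<in> tor_ideal A"
    show "f \<in> J"
    proof (rule tor_ideal_subset_if_binomials[OF f])
      fix u v assume uv: "u \<in> monomials A" "v \<in> monomials A" "tdeg u = tdeg v"
      have "mdeg u = mdeg v" using tdeg_eq_mdeg[OF uv(3)] .
      then have "(monom_poly u - monom_poly v :: (int ^ 'd, 'k) mpoly) \<in> hpoly A (mdeg u)"
        using uv by (intro hpoly_diff hpoly_single) auto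
      then show "monom_poly u - monom_poly v \<in> J" using homogeneous_in_J tor_ideal_binomial[OF uv] by blast
    qed
  qed
  moreover have "J \<subseteq> tor_ideal A" by (rule ideal_gen_subset_tor_ideal) simp
  ultimately show ?thesis unfolding generated_by_quadratic_binomials_def by blast
qed

end

lemma koszul_imp_generated_by_quadratic_binomials:
  assumes "koszul (tor_ring A :: ('d::finite, 'k::field) laurent set)"
  shows "generated_by_quadratic_binomials A (tor_ideal A :: (int ^ 'd, 'k) mpoly set)"
proof -
  obtain b and D :: "nat \<Rightarrow> nat \<Rightarrow> nat \<Rightarrow> ('d, 'k) laurent" where "linear_resolution (tor_ring A) b D"
    using assms unfolding koszul_def by blast
  then interpret linear_presentation A b D "tor_ring A :: ('d, 'k) laurent set" by unfold_locales auto
  show ?thesis by (rule generated)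
qed

section \<open>The polytope of a bipartite graph and chordless cycles\<close>

definition clique_vectors :: "'d set set \<Rightarrow> (int ^ 'd::finite) set" where
  "clique_vectors E = {a. (\<forall>i. \<bar>a $ i\<bar> \<le> 1) \<and> (\<forall>i j. i \<noteq> j \<and> a $ i \<noteq> 0 \<and> a $ j \<noteq> 0 \<longrightarrow> {i, j} \<in> E)}"

lemma finite_clique_vectors: "finite (clique_vectors E :: (int ^ 'd::finite) set)"
proof -
  have "finite (UNIV \<rightarrow>\<^sub>E {-1..1::int} :: ('d \<Rightarrow> int) set)" by (intro finite_PiE) auto
  moreover have "(clique_vectors E :: (int ^ 'd) set) \<subseteq> vec_lambda ` (UNIV \<rightarrow>\<^sub>E {-1..1})"
  proof
    fix a :: "int ^ 'd" assume "a \<in> clique_vectors E"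
    then have "vec_nth a \<in> UNIV \<rightarrow>\<^sub>E {-1..1}" by (auto simp: clique_vectors_def abs_le_iff minus_le_iff)
    then show "a \<in> vec_lambda ` (UNIV \<rightarrow>\<^sub>E {-1..1})" by (metis image_eqI vec_nth_inverse)
  qed
  ultimately show ?thesis by (meson finite_imageI finite_subset)
qed

lemma axis_nth_if: "axis i x $ j = (if i = j then x else 0)"
  by (simp add: axis_def)

lemma abs_int_le_1_cases: "\<bar>x::int\<bar> \<le> 1 \<Longrightarrow> x \<noteq> 0 \<Longrightarrow> x = 1 \<or> x = -1"
  by arith

locale bipartite_graph =
  fixes E :: "'d::finite set set" and V W :: "'d set"
  assumes VW: "V \<union> W = UNIV" "V \<inter> W = {}" and E: "\<And>e. e \<in> E \<Longrightarrow> \<exists>v\<in>V. \<exists>w\<in>W. e = {v, w}"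
begin

lemma edge_sides: "{i, j} \<in> E \<Longrightarrow> (i \<in> V) \<noteq> (j \<in> V)"
  using E[of "{i, j}"] VW by (auto simp: doubleton_eq_iff)

lemma singleton_not_edge: "{i} \<notin> E"
  using edge_sides[of i i] by auto

lemma W_iff: "i \<in> W \<longleftrightarrow> i \<notin> V"
  using VW by auto

text \<open>Three nonzero entries would require three pairwise adjacent vertices, but there are only
  two sides.\<close>

lemma clique_vectors_cases:
  assumes "a \<in> clique_vectors E"
  obtains "a = 0"
  | i s where "a = axis i s" "s = 1 \<or> s = -1"
  | i j s t where "a = axis i s + axis j t" "s = 1 \<or> s = -1" "t = 1 \<or> t = -1" "{i, j} \<in> E" "i \<noteq> j"
proof (cases "a = 0")
  case False
  then obtain i where i: "a $ i \<noteq> 0" by (auto simp: vec_eq_iff)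
  then have si: "a $ i = 1 \<or> a $ i = -1" using assms abs_int_le_1_cases by (auto simp: clique_vectors_def)
  show ?thesis
  proof (cases "\<exists>j. j \<noteq> i \<and> a $ j \<noteq> 0")
    case False
    then have "a = axis i (a $ i)" by (auto simp: vec_eq_iff axis_nth_if)
    then show ?thesis using that(2) si by blast
  next
    case True
    then obtain j where j: "j \<noteq> i" "a $ j \<noteq> 0" by blast
    have sj: "a $ j = 1 \<or> a $ j = -1" using j assms abs_int_le_1_cases by (auto simp: clique_vectors_def)
    have edge: "{x, y} \<in> E" if "x \<noteq> y" "a $ x \<noteq> 0" "a $ y \<noteq> 0" for x y
      using that assms by (auto simp: clique_vectors_def)
    have "a $ k = 0" if "k \<noteq> i" "k \<noteq> j" for k
    proof (rule ccontr)
      assume "a $ k \<noteq> 0"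
      then show False
        using edge_sides[OF edge[of i j]] edge_sides[OF edge[of i k]] edge_sides[OF edge[of j k]] i j that by auto
    qed
    then have "a = axis i (a $ i) + axis j (a $ j)" using j by (auto simp: vec_eq_iff axis_nth_if)
    then show ?thesis using that(3) si sj edge[of i j] i j by blast
  qed
qed (use that in auto)

text \<open>The sets \<open>\<bar>x $ i\<bar> \<le> 1\<close> and, for distinct nonadjacent
  \<open>i\<close>, \<open>j\<close>, \<open>\<bar>x $ i\<bar> + \<bar>x $ j\<bar> \<le> 1\<close>
  are convex and contain the generators; integer points satisfying these bounds are clique vectors,
  which are generators themselves.\<close>

lemma lattice_points_graph_polytope: "lattice_points (graph_polytope E) = clique_vectors E"
proof (intro equalityI subsetI)
  let ?gens = "{0} \<union> {\<sigma> *\<^sub>R axis i 1 | \<sigma> i. \<sigma> \<in> {-1, 1}} \<union>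
      {\<sigma> *\<^sub>R axis i 1 + \<tau> *\<^sub>R axis j 1 | \<sigma> \<tau> i j. \<sigma> \<in> {-1, 1} \<and> \<tau> \<in> {-1, 1} \<and> {i, j} \<in> E} :: (real ^ 'd) set"
  fix a assume "a \<in> lattice_points (graph_polytope E)"
  then have x: "(\<chi> i. real_of_int (a $ i)) \<in> convex hull ?gens"
    by (simp add: lattice_points_def graph_polytope_def)
  have ne: "i \<noteq> j" if "{i, j} \<in> E" for i j using edge_sides[OF that] by auto
  have "\<bar>real_of_int (a $ i)\<bar> \<le> 1" for i
  proof -
    have "?gens \<subseteq> {x. \<bar>x $ i\<bar> \<le> 1}" using ne singleton_not_edge by (auto simp: axis_nth_if)
    moreover have "convex {x :: real ^ 'd. \<bar>x $ i\<bar> \<le> 1}"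
    proof (rule convexI)
      fix x y :: "real ^ 'd" and u v :: real
      assume *: "x \<in> {x. \<bar>x $ i\<bar> \<le> 1}" "y \<in> {x. \<bar>x $ i\<bar> \<le> 1}" "0 \<le> u" "0 \<le> v" "u + v = 1"
      have "\<bar>u * x $ i + v * y $ i\<bar> \<le> u * \<bar>x $ i\<bar> + v * \<bar>y $ i\<bar>"
        using * by (metis abs_mult abs_of_nonneg abs_triangle_ineq)
      also have "\<dots> \<le> u * 1 + v * 1" using * by (intro add_mono mult_left_mono) auto
      finally show "u *\<^sub>R x + v *\<^sub>R y \<in> {x. \<bar>x $ i\<bar> \<le> 1}" using * by simp
    qed
    ultimately have "convex hull ?gens \<subseteq> {x. \<bar>x $ i\<bar> \<le> 1}" by (rule hull_minimal)
    from subsetD[OF this x] show ?thesis by simp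
  qed
  then have "\<bar>a $ i\<bar> \<le> 1" for i by (metis of_int_1_le_iff of_int_abs of_int_le_1_iff)
  moreover have "{i, j} \<in> E" if ij: "i \<noteq> j" "a $ i \<noteq> 0" "a $ j \<noteq> 0" for i j
  proof (rule ccontr)
    assume nE: "{i, j} \<notin> E"
    let ?S = "{x :: real ^ 'd. \<bar>x $ i\<bar> + \<bar>x $ j\<bar> \<le> 1}"
    have nE': "\<not> ({k, l} \<in> E \<and> (k = i \<and> l = j \<or> k = j \<and> l = i))" for k l
      using nE by (auto simp: insert_commute)
    have "?gens \<subseteq> ?S"
    proof (intro Un_least)
      show "{\<sigma> *\<^sub>R axis i 1 + \<tau> *\<^sub>R axis j 1 | \<sigma> \<tau> i j. \<sigma> \<in> {-1, 1} \<and> \<tau> \<in> {-1, 1} \<and> {i, j} \<in> E} \<subseteq> ?S"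
      proof clarify
        fix \<sigma> \<tau> :: real and k l assume "\<sigma> \<in> {-1, 1}" "\<tau> \<in> {-1, 1}" "{k, l} \<in> E"
        then show "\<bar>(\<sigma> *\<^sub>R axis k 1 + \<tau> *\<^sub>R axis l 1 :: real ^ 'd) $ i\<bar> +
            \<bar>(\<sigma> *\<^sub>R axis k 1 + \<tau> *\<^sub>R axis l 1 :: real ^ 'd) $ j\<bar> \<le> 1"
          using ne[of k l] nE'[of k l] ij(1) by (auto simp: axis_nth_if)
      qed
    qed (use ij(1) in \<open>auto simp: axis_nth_if\<close>)
    moreover have "convex ?S"
    proof (rule convexI)
      fix x y :: "real ^ 'd" and u v :: real
      assume *: "x \<in> ?S" "y \<in> ?S" "0 \<le> u" "0 \<le> v" "u + v = 1"
      have "\<bar>u * x $ i + v * y $ i\<bar> \<le> u * \<bar>x $ i\<bar> + v * \<bar>y $ i\<bar>"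
        using * by (metis abs_mult abs_of_nonneg abs_triangle_ineq)
      moreover have "\<bar>u * x $ j + v * y $ j\<bar> \<le> u * \<bar>x $ j\<bar> + v * \<bar>y $ j\<bar>"
        using * by (metis abs_mult abs_of_nonneg abs_triangle_ineq)
      moreover have "u * (\<bar>x $ i\<bar> + \<bar>x $ j\<bar>) + v * (\<bar>y $ i\<bar> + \<bar>y $ j\<bar>) \<le> u * 1 + v * 1"
        using * by (intro add_mono mult_left_mono) auto
      ultimately show "u *\<^sub>R x + v *\<^sub>R y \<in> ?S" using * by (simp add: algebra_simps)
    qed
    ultimately have "convex hull ?gens \<subseteq> ?S" by (rule hull_minimal)
    from subsetD[OF this x] have "\<bar>real_of_int (a $ i)\<bar> + \<bar>real_of_int (a $ j)\<bar> \<le> 1" by simp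
    then have "real_of_int (\<bar>a $ i\<bar> + \<bar>a $ j\<bar>) \<le> 1" by simp
    then have "\<bar>a $ i\<bar> + \<bar>a $ j\<bar> \<le> 1" by (simp only: of_int_le_1_iff)
    then show False using ij by arith
  qed
  ultimately show "a \<in> clique_vectors E" by (auto simp: clique_vectors_def)
next
  fix a assume "a \<in> clique_vectors E"
  then show "a \<in> lattice_points (graph_polytope E)"
  proof (cases rule: clique_vectors_cases)
    case 1
    then have "(\<chi> i. real_of_int (a $ i)) = 0" by (simp add: vec_eq_iff)
    then show ?thesis unfolding lattice_points_def graph_polytope_def by (simp add: hull_inc)
  next
    case (2 i s)
    then have "(\<chi> i. real_of_int (a $ i)) = real_of_int s *\<^sub>R axis i 1"
      by (auto simp: vec_eq_iff axis_nth_if)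
    then show ?thesis unfolding lattice_points_def graph_polytope_def using 2(2)
      by (auto intro!: hull_inc)
  next
    case (3 i j s t)
    then have "(\<chi> i. real_of_int (a $ i)) = real_of_int s *\<^sub>R axis i 1 + real_of_int t *\<^sub>R axis j 1"
      by (auto simp: vec_eq_iff axis_nth_if)
    moreover have "real_of_int s \<in> {-1, 1}" "real_of_int t \<in> {-1, 1}" using 3 by auto
    ultimately have "(\<chi> i. real_of_int (a $ i)) \<in> {\<sigma> *\<^sub>R axis i 1 + \<tau> *\<^sub>R axis j 1 | \<sigma> \<tau> i j. \<sigma> \<in> {-1, 1} \<and> \<tau> \<in> {-1, 1} \<and> {i, j} \<in> E}"
      using 3(4) by blast
    then show ?thesis unfolding lattice_points_def graph_polytope_def by (intro CollectI hull_inc) blast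
  qed
qed

end

section \<open>The perfect matchings of a chordless cycle as a toric fibre\<close>

lemma wt_nonneg_eq_0:
  assumes "\<And>b. b \<in> keys m \<Longrightarrow> 0 \<le> g b" "wt g m = 0" "b \<in> keys m"
  shows "g b = 0"
proof -
  have "\<forall>b\<in>keys m. int (lookup m b) * g b = 0"
    using assms(1,2) unfolding wt_def by (subst (asm) sum_nonneg_eq_0_iff) auto
  then show ?thesis using assms(3) by (auto simp: in_keys_iff)
qed

lemma monomials_sum: "(\<And>i. i \<in> X \<Longrightarrow> f i \<in> monomials A) \<Longrightarrow> (\<Sum>i\<in>X. f i) \<in> monomials A"
  by (induction X rule: infinite_finite_induct) auto

lemma sum_double: "(\<Sum>i<2 * k. f i) = (\<Sum>j<k. f (2 * j) + f (Suc (2 * j)) :: 'a::comm_monoid_add)"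
  by (induction k) (auto simp: algebra_simps)

locale chordless_cycle = bipartite_graph E V W for E :: "'a::finite set set" and V W +
  fixes vs :: "'a list"
  assumes cyc: "is_cycle E vs" and len: "6 \<le> length vs" and chordless: "\<not> has_chord E vs"
begin

abbreviation n where "n \<equiv> length vs"

lemma dist: "distinct vs"
  using cyc by (simp add: is_cycle_def)

lemma cycle_edge: "i < n \<Longrightarrow> {vs ! i, vs ! (Suc i mod n)} \<in> E"
  using cyc by (auto simp: is_cycle_def cycle_edges_def)

lemma mod_n [simp]: "i mod n < n"
  using len by (intro mod_less_divisor) linarith

text \<open>Sides alternate along the cycle, and the closing edge has to change sides as
  well.\<close>

lemma even_n: "even n"
proof -
  have side: "vs ! i \<in> V \<longleftrightarrow> (even i \<longleftrightarrow> vs ! 0 \<in> V)" if "i < n" for i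
    using that
  proof (induction i)
    case (Suc i)
    then have "{vs ! i, vs ! Suc i} \<in> E" using cycle_edge[of i] by simp
    then show ?case using Suc edge_sides by auto
  qed simp
  have n1: "n - 1 < n" "Suc (n - 1) = n" using len by auto
  have "{vs ! (n - 1), vs ! 0} \<in> E" using cycle_edge[OF n1(1)] unfolding n1(2) by simp
  then have "odd (n - 1)" using edge_sides side[OF n1(1)] by blast
  then show ?thesis using n1(2) by (metis even_Suc)
qed

definition eps :: "nat \<Rightarrow> int ^ 'a" where
  "eps i = axis (vs ! i) 1 + axis (vs ! (Suc i mod n)) 1"

lemma eps_nth: "eps i $ x = (if vs ! i = x then 1 else 0) + (if vs ! (Suc i mod n) = x then 1 else 0)"
  by (simp add: eps_def axis_nth_if)

lemma nth_eq: "i < n \<Longrightarrow> j < n \<Longrightarrow> vs ! i = vs ! j \<longleftrightarrow> i = j"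
  using dist by (simp add: nth_eq_iff_index_eq)

lemma eps_in: "i < n \<Longrightarrow> eps i \<in> clique_vectors E"
proof -
  assume i: "i < n"
  have e: "{vs ! i, vs ! (Suc i mod n)} \<in> E" using cycle_edge[OF i] .
  then have "vs ! i \<noteq> vs ! (Suc i mod n)" using edge_sides by fastforce
  then show ?thesis using e by (auto simp: clique_vectors_def eps_nth insert_commute)
qed

text \<open>The fibre of both perfect matchings: the multidegree is the indicator vector of the
  cycle, the degree half its length.\<close>

definition F :: "(int ^ 'a) monom set" where
  "F = {m \<in> monomials (clique_vectors E). (\<forall>x. wt (\<lambda>b. b $ x) m = (if x \<in> set vs then 1 else 0)) \<and> 2 * mdeg m = n}"

lemma sum_axis: "(\<Sum>x\<in>UNIV. axis i (s::int) $ x) = s"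
  by (simp add: axis_nth_if)

lemma F_keys:
  assumes m: "m \<in> F" and b: "b \<in> keys m"
  shows "\<exists>s<n. b = eps s"
proof -
  have edge: "\<exists>i j. c = axis i 1 + axis j 1 \<and> {i, j} \<in> E \<and> i \<noteq> j" if c: "c \<in> keys m" for c
  proof -
    have le: "(\<Sum>x\<in>UNIV. d $ x) \<le> 2 \<and> ((\<Sum>x\<in>UNIV. d $ x) = 2 \<longrightarrow> (\<exists>i j. d = axis i 1 + axis j 1 \<and> {i, j} \<in> E \<and> i \<noteq> j))"
      if "d \<in> clique_vectors E" for d
      using that
    proof (cases rule: clique_vectors_cases)
      case (3 i j s t)
      then show ?thesis by (auto simp: sum.distrib sum_axis)
    qed (auto simp: sum_axis)
    have cv: "d \<in> clique_vectors E" if "d \<in> keys m" for d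
      using m that by (auto simp: F_def monomials_def)
    have "wt (\<lambda>b. \<Sum>x\<in>UNIV. b $ x) m = (\<Sum>x\<in>UNIV. if x \<in> set vs then 1 else 0)"
      using m by (simp add: wt_fun_sum F_def)
    also have "\<dots> = int (card (set vs))" by (simp add: sum.If_cases)
    also have "\<dots> = int n" using dist by (simp add: distinct_card)
    also have "\<dots> = 2 * int (mdeg m)" using m by (simp add: F_def)
    also have "\<dots> = wt (\<lambda>_. 2) m" by (simp add: int_mdeg wt_def sum_distrib_left mult.commute)
    finally have "wt (\<lambda>b. 2 - (\<Sum>x\<in>UNIV. b $ x)) m = 0" by (simp add: wt_fun_diff)
    from wt_nonneg_eq_0[OF _ this c] have "2 - (\<Sum>x\<in>UNIV. c $ x) = 0" using le cv by force
    then show ?thesis using le[OF cv[OF c]] by simp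
  qed
  obtain i j where ij: "b = axis i 1 + axis j 1" "{i, j} \<in> E" "i \<noteq> j" using edge[OF b] by blast
  have "x \<in> set vs" if x: "b $ x \<noteq> 0" for x
  proof (rule ccontr)
    assume "x \<notin> set vs"
    then have "wt (\<lambda>b. b $ x) m = 0" using m by (simp add: F_def)
    moreover have "0 \<le> c $ x" if "c \<in> keys m" for c
      using edge[OF that] by (auto simp: axis_nth_if)
    ultimately have "b $ x = 0" using wt_nonneg_eq_0[of m "\<lambda>b. b $ x" b] b by blast
    then show False using x by simp
  qed
  then have "i \<in> set vs" "j \<in> set vs" using ij by (auto simp: axis_nth_if)
  then have "{i, j} \<in> cycle_edges vs" using chordless ij by (auto simp: has_chord_def)
  then obtain s where "s < n" "{i, j} = {vs ! s, vs ! (Suc s mod n)}" by (auto simp: cycle_edges_def)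
  then show ?thesis using ij(1) by (auto simp: doubleton_eq_iff eps_def add.commute)
qed

lemma Suc_mod_inj: "i < n \<Longrightarrow> j < n \<Longrightarrow> Suc i mod n = Suc j mod n \<longleftrightarrow> i = j"
  by (auto simp: mod_Suc split: if_splits)

text \<open>The coordinate at the common vertex of two consecutive edges is one, and no other cycle
  edge contains that vertex.\<close>

lemma F_alternates:
  assumes m: "m \<in> F" and t: "t < n"
  shows "lookup m (eps t) + lookup m (eps (Suc t mod n)) = 1"
proof -
  let ?t' = "Suc t mod n"
  let ?x = "vs ! ?t'"
  have t': "?t' < n" using len by (intro mod_less_divisor) linarith
  have comp: "eps s $ ?x = (if s = ?t' then 1 else 0) + (if s = t then 1 else 0)" if "s < n" for s
    using that t t' len nth_eq[OF that t'] nth_eq[of "Suc s mod n" ?t'] Suc_mod_inj[OF that t]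
    by (simp add: eps_nth)
  have tt: "t \<noteq> ?t'" using t len by (auto simp: mod_Suc split: if_splits)
  have ne: "eps t \<noteq> eps ?t'"
  proof
    assume "eps t = eps ?t'"
    then have "eps t $ (vs ! t) = eps ?t' $ (vs ! t)" by simp
    moreover have "Suc ?t' mod n \<noteq> t" using t len by (auto simp: mod_Suc split: if_splits)
    ultimately show False
      using t t' tt nth_eq[of ?t' t] nth_eq[of "Suc ?t' mod n" t] len by (simp add: eps_nth split: if_splits)
  qed
  let ?B = "eps ` {..<n}"
  have "1 = wt (\<lambda>b. b $ ?x) m" using m t' by (simp add: F_def)
  also have "\<dots> = (\<Sum>b\<in>?B. int (lookup m b) * b $ ?x)"
    using F_keys[OF m] by (intro wt_superset) auto
  also have "\<dots> = (\<Sum>b\<in>{eps t, eps ?t'}. int (lookup m b) * b $ ?x)"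
    using t t' comp by (intro sum.mono_neutral_right) (auto split: if_splits)
  also have "\<dots> = int (lookup m (eps t)) + int (lookup m (eps ?t'))"
    using ne tt comp[OF t] comp[OF t'] by simp
  finally show ?thesis by linarith
qed

text \<open>Each exponent determines the next one around the cycle, so a single common variable
  fixes all exponents.\<close>

lemma F_unique:
  assumes m: "m \<in> F" and u: "u \<in> F" and "a \<in> keys m" "a \<in> keys u"
  shows "m = u"
proof -
  obtain t where t: "t < n" "a = eps t" using F_keys[OF m assms(3)] by blast
  have npos: "0 < n" using len by linarith
  have start: "lookup m (eps t) = lookup u (eps t)"
    using F_alternates[OF m t(1)] F_alternates[OF u t(1)] assms(3,4) unfolding in_keys_iff t(2) by linarith
  have step: "lookup m (eps ((t + s) mod n)) = lookup u (eps ((t + s) mod n))" for s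
  proof (induction s)
    case 0
    then show ?case using start t by simp
  next
    case (Suc s)
    have "(t + s) mod n < n" using npos by (rule mod_less_divisor)
    from F_alternates[OF m this] F_alternates[OF u this] Suc show ?case by (simp add: mod_Suc_eq)
  qed
  \<comment> \<open>The offset \<open>i + n - t\<close> leads from \<open>t\<close> to
    \<open>i\<close> modulo \<open>n\<close> and avoids truncated subtraction.\<close>
  have all: "lookup m (eps i) = lookup u (eps i)" if "i < n" for i
    using step[of "i + n - t"] t that by simp
  show ?thesis
  proof (rule poly_mapping_eqI)
    fix b
    show "lookup m b = lookup u b"
      using F_keys[OF m, of b] F_keys[OF u, of b] all by (metis in_keys_iff)
  qed
qed

text \<open>The parameter selects the even edges for \<open>c = 0\<close> and the odd ones for
  \<open>c = 1\<close>.\<close>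

definition matching :: "nat \<Rightarrow> (int ^ 'a) monom" where
  "matching c = (\<Sum>j<n div 2. var (eps (2 * j + c)))"

lemma indicator_sum: "(\<Sum>i<n. if vs ! i = x then 1 else 0 :: int) = (if x \<in> set vs then 1 else 0)"
proof -
  have "(\<Sum>i<n. if vs ! i = x then 1 else 0 :: int) = (\<Sum>y\<in>set vs. if y = x then 1 else 0)"
    using sum.reindex_bij_betw[OF bij_betw_nth[OF dist refl refl], of "\<lambda>y. if y = x then 1 else 0 :: int"] .
  then show ?thesis by simp
qed

lemma matching_in_F:
  assumes "c \<le> 1"
  shows "matching c \<in> F"
proof -
  define h where "h = n div 2"
  have n2: "n = 2 * h" using even_n by (simp add: h_def)
  obtain h' where h': "h = Suc h'" using len n2 by (cases h) auto
  have lt: "2 * j + c < n" if "j < h" for j using that assms n2 by simp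
  have "matching c \<in> monomials (clique_vectors E)"
    using eps_in lt unfolding matching_def h_def[symmetric] by (intro monomials_sum) auto
  moreover have "2 * mdeg (matching c) = n"
  proof -
    have "int (mdeg (matching c)) = int h" by (simp add: matching_def int_mdeg wt_sum h_def)
    then show ?thesis using n2 by simp
  qed
  moreover have "wt (\<lambda>b. b $ x) (matching c) = (if x \<in> set vs then 1 else 0)" for x
  proof -
    let ?I = "\<lambda>i. if vs ! i = x then 1 else 0 :: int"
    have "wt (\<lambda>b. b $ x) (matching c) = (\<Sum>j<h. ?I (2 * j + c) + ?I (Suc (2 * j + c) mod n))"
      by (simp add: matching_def wt_sum eps_nth h_def)
    also have "\<dots> = (\<Sum>j<h. ?I (2 * j) + ?I (Suc (2 * j)))"
    proof (cases "c = 0")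
      case True
      then show ?thesis using n2 by (intro sum.cong) auto
    next
      case False
      then have o: "c = 1" using assms by simp
      \<comment> \<open>The last odd edge wraps around to vertex 0. Splitting it off leaves the even
        vertices from 2 on as second endpoints.\<close>
      have "(\<Sum>j<h. ?I (Suc (Suc (2 * j)) mod n)) = (\<Sum>j<h'. ?I (Suc (Suc (2 * j)) mod n)) + ?I 0"
        using n2 by (simp add: h')
      also have "(\<Sum>j<h'. ?I (Suc (Suc (2 * j)) mod n)) = (\<Sum>j<h'. ?I (2 * Suc j))"
        using n2 h' by (intro sum.cong) auto
      also have "\<dots> + ?I 0 = (\<Sum>j<h. ?I (2 * j))"
        unfolding h' sum.lessThan_Suc_shift by simp
      finally show ?thesis using o by (simp add: sum.distrib)
    qed
    also have "\<dots> = (\<Sum>i<n. ?I i)" unfolding n2 by (rule sum_double[symmetric])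
    finally show ?thesis by (simp add: indicator_sum)
  qed
  ultimately show ?thesis by (simp add: F_def)
qed

lemma eps_in_matching: "c \<le> 1 \<Longrightarrow> eps c \<in> keys (matching c)"
  using len by (auto simp: matching_def in_keys_iff lookup_sum lookup_single when_def intro!: bexI[of _ 0])

lemma matchings_distinct: "matching 0 \<noteq> matching 1"
proof
  assume eq: "matching 0 = matching 1"
  have "lookup (matching 0) (eps 0) \<ge> 1" "lookup (matching 0) (eps 1) \<ge> 1"
    using eps_in_matching[of 0] eps_in_matching[of 1] unfolding eq[symmetric] in_keys_iff by auto
  moreover have "lookup (matching 0) (eps 0) + lookup (matching 0) (eps (Suc 0 mod n)) = 1"
    using len by (intro F_alternates matching_in_F) linarith+
  moreover have "Suc 0 mod n = 1" using len by simp
  ultimately show False by simp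
qed

text \<open>The two perfect matchings of the cycle are the only elements of their fibre, and a quadratic
  move would produce a third one because it keeps at least one variable.\<close>

lemma not_generated_by_quadratic_binomials:
  "\<not> generated_by_quadratic_binomials (clique_vectors E) (tor_ideal (clique_vectors E) :: (int ^ 'a, 'k::field) mpoly set)"
proof
  let ?A = "clique_vectors E"
  let ?I = "tor_ideal ?A :: (int ^ 'a, 'k) mpoly set"
  let ?u = "matching 0" and ?v = "matching 1"
  assume "generated_by_quadratic_binomials ?A ?I"
  then obtain S where S: "S \<subseteq> quadratic_binomials ?A" "?I = ideal_gen ?A S"
    unfolding generated_by_quadratic_binomials_def by blast
  have uF: "?u \<in> F" "?v \<in> F" using matching_in_F by auto
  then have td: "tdeg ?u = tdeg ?v" and uA: "?u \<in> monomials ?A" "?v \<in> monomials ?A"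
    by (auto simp: F_def tdeg_eq_iff)
  have "monom_poly ?u - monom_poly ?v \<in> ?I" by (rule tor_ideal_binomial[OF uA td])
  then obtain T q where T: "monom_poly ?u - monom_poly ?v = (\<Sum>f\<in>T. q f * f)" "finite T" "T \<subseteq> S"
    "\<forall>f\<in>T. q f \<in> poly_ring ?A"
    unfolding S(2) ideal_gen_def by blast
  have nodiv: "?u \<notin> keys (p * monom_poly a :: (int ^ 'a, 'k) mpoly)"
    if p: "p \<in> poly_ring ?A" and ac: "tdeg a = tdeg c" "a \<noteq> c" "mdeg a = 2" "c \<in> monomials ?A"
    for p :: "(int ^ 'a, 'k) mpoly" and a c
  proof
    assume "?u \<in> keys (p * monom_poly a :: (int ^ 'a, 'k) mpoly)"
    then obtain l where l: "l \<in> keys p" "?u = l + a"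
      using keys_mult[of p "monom_poly a"] by auto
    then have lA: "l \<in> monomials ?A" using p by (auto simp: poly_ring_def)
    have "tdeg (l + c) = tdeg ?u" using l ac by (simp add: tdeg_add)
    then have lc: "l + c \<in> F" using uF(1) lA ac by (auto simp: F_def tdeg_eq_iff)
    have "2 * mdeg ?u = n" using uF by (simp add: F_def)
    moreover have "mdeg ?u = mdeg l + 2" by (simp add: l(2) ac(3))
    \<comment> \<open>Length at least six forces degree at least three, so a quadratic divisor
      leaves a nontrivial cofactor. The matchings of a 4-cycle have degree two and differ by a
      quadratic move.\<close>
    ultimately have "mdeg l \<noteq> 0" using len by linarith
    then have "l \<noteq> 0" by auto
    then obtain x where "x \<in> keys l" by (metis all_not_in_conv keys_eq_empty)
    then have "l + c = ?u"
      using l(2) by (intro F_unique[OF lc uF(1), of x]) (auto simp: keys_add_monom)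
    then show False using l(2) ac by simp
  qed
  have "lookup (q f * f) ?u = 0" if f: "f \<in> T" for f
  proof -
    obtain a c where ac: "f = monom_poly a - monom_poly c" "a \<in> monomials ?A" "c \<in> monomials ?A" "a \<noteq> c" "mdeg a = 2" "mdeg c = 2"
      using f T S unfolding quadratic_binomials_def by blast
    have "f \<in> ?I" using f T S ideal_gen_gen by blast
    then have "push tdeg f = 0" by (simp add: tor_ideal_def)
    then have "single (tdeg a) (1::'k) = single (tdeg c) 1"
      by (simp add: ac(1) push_diff)
    then have td: "tdeg a = tdeg c" by (metis keys_single singleton_inject zero_neq_one)
    have qf: "q f \<in> poly_ring ?A" using T f by blast
    have "lookup (q f * monom_poly a) ?u = 0" "lookup (q f * monom_poly c) ?u = 0"
      using nodiv[OF qf td] nodiv[OF qf td[symmetric]] ac by (auto simp: in_keys_iff)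
    then show ?thesis by (subst ac(1)) (simp add: right_diff_distrib lookup_minus)
  qed
  then have "lookup (\<Sum>f\<in>T. q f * f) ?u = 0" by (simp add: lookup_sum)
  moreover have "lookup (monom_poly ?u - monom_poly ?v :: (int ^ 'a, 'k) mpoly) ?u = 1"
    using matchings_distinct by (simp add: lookup_minus lookup_single)
  ultimately show False using T(1) by simp
qed

end

section \<open>Gamma-free orderings of chordal bipartite graphs\<close>

text \<open>Makes a comparison of sums of distinct powers of two a lexicographic comparison from the
  highest exponent down.\<close>

lemma sum_pow2_less:
  assumes "finite S" "inj_on f S" "\<And>z. z \<in> S \<Longrightarrow> f z < (k::nat)"
  shows "(\<Sum>z\<in>S. 2 ^ f z) < (2 ^ k :: nat)"
proof -
  have "(\<Sum>z\<in>S. 2 ^ f z) = (\<Sum>i\<in>f ` S. 2 ^ i :: nat)" using assms(2) by (simp add: sum.reindex)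
  also have "\<dots> \<le> (\<Sum>i<k. 2 ^ i)" using assms(3) by (intro sum_mono2) auto
  also have "\<dots> < 2 ^ k" by (induction k) auto
  finally show ?thesis .
qed

section \<open>Doubly lexical orderings as maximisers of a potential\<close>

context bipartite_graph begin

abbreviation adj where "adj x y \<equiv> {x, y} \<in> E"

lemma adj_commute: "adj x y \<longleftrightarrow> adj y x"
  by (simp add: insert_commute)

text \<open>The neighbourhood of \<open>x\<close> read as a binary number whose bit positions are
  the ranks.\<close>

definition weight :: "('d \<Rightarrow> nat) \<Rightarrow> 'd \<Rightarrow> nat" where
  "weight \<alpha> x = (\<Sum>z | adj x z. 2 ^ \<alpha> z)"

text \<open>The sum of \<open>2 ^ (\<alpha> v + \<alpha> w)\<close> over all edges. It is symmetric
  in the two sides, so one maximiser orders both of them at once.\<close>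

definition potential :: "('d \<Rightarrow> nat) \<Rightarrow> nat" where
  "potential \<alpha> = (\<Sum>v\<in>V. 2 ^ \<alpha> v * weight \<alpha> v)"

lemma potential_swap: "potential \<alpha> = (\<Sum>w\<in>W. 2 ^ \<alpha> w * weight \<alpha> w)"
proof -
  have V: "weight \<alpha> v = (\<Sum>w\<in>W. if adj v w then 2 ^ \<alpha> w else 0)" if "v \<in> V" for v
  proof -
    have "{z. adj v z} = W \<inter> {z. adj v z}" using edge_sides that W_iff by auto
    then show ?thesis unfolding weight_def by (simp add: sum.If_cases)
  qed
  have W: "weight \<alpha> w = (\<Sum>v\<in>V. if adj v w then 2 ^ \<alpha> v else 0)" if "w \<in> W" for w
  proof -
    have "{z. adj w z} = V \<inter> {z. adj z w}" using edge_sides that W_iff by (auto simp: adj_commute)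
    then show ?thesis unfolding weight_def by (simp add: sum.If_cases)
  qed
  have "potential \<alpha> = (\<Sum>v\<in>V. \<Sum>w\<in>W. if adj v w then 2 ^ \<alpha> v * 2 ^ \<alpha> w else 0)"
    unfolding potential_def by (intro sum.cong) (auto simp: V sum_distrib_left intro!: sum.cong)
  also have "\<dots> = (\<Sum>w\<in>W. \<Sum>v\<in>V. if adj v w then 2 ^ \<alpha> v * 2 ^ \<alpha> w else 0)"
    by (rule sum.swap)
  also have "\<dots> = (\<Sum>w\<in>W. 2 ^ \<alpha> w * weight \<alpha> w)"
    by (intro sum.cong) (auto simp: W sum_distrib_left mult.commute intro!: sum.cong)
  finally show ?thesis .
qed

text \<open>Exchanging the ranks of two vertices on the same side changes the potential by the product
  of the differences of the powers of two and of the weights.\<close>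

lemma weight_mono:
  assumes max: "\<And>\<beta>. bij_betw \<beta> UNIV {..<CARD('d)} \<Longrightarrow> potential \<beta> \<le> potential \<alpha>"
    and bij: "bij_betw \<alpha> UNIV {..<CARD('d)}"
    and xy: "x \<in> V \<longleftrightarrow> y \<in> V" "\<alpha> x < \<alpha> y"
  shows "weight \<alpha> x \<le> weight \<alpha> y"
proof (rule ccontr)
  assume "\<not> ?thesis"
  then have less: "weight \<alpha> y < weight \<alpha> x" by simp
  define \<beta> where "\<beta> = \<alpha> \<circ> Transposition.transpose x y"
  have "bij_betw \<beta> UNIV {..<CARD('d)}" unfolding \<beta>_def using bij by (intro bij_betw_trans[OF _ bij]) simp
  then have le: "potential \<beta> \<le> potential \<alpha>" by (rule max)
  have \<beta>: "\<beta> x = \<alpha> y" "\<beta> y = \<alpha> x" "\<And>z. z \<noteq> x \<Longrightarrow> z \<noteq> y \<Longrightarrow> \<beta> z = \<alpha> z"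
    by (auto simp: \<beta>_def Transposition.transpose_def)
  \<comment> \<open>The side of the exchanged vertices. Neighbours of \<open>U\<close> lie on the
    other side, so weights along \<open>U\<close> are unaffected by the exchange.\<close>
  define U where "U = (if x \<in> V then V else W)"
  have pot: "potential \<gamma> = (\<Sum>v\<in>U. 2 ^ \<gamma> v * weight \<gamma> v)" for \<gamma>
    using potential_swap by (simp add: U_def potential_def)
  have U: "x \<in> U" "y \<in> U" "x \<noteq> y" using xy by (auto simp: U_def W_iff)
  have side: "v \<in> U \<longleftrightarrow> (v \<in> V \<longleftrightarrow> x \<in> V)" for v by (auto simp: U_def W_iff)
  have "weight \<beta> v = weight \<alpha> v" if "v \<in> U" for v
    unfolding weight_def
  proof (intro sum.cong refl)
    fix z assume "z \<in> {z. adj v z}"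
    then have "z \<noteq> x \<and> z \<noteq> y" using edge_sides[of v z] that U side by auto
    then show "2 ^ \<beta> z = (2 ^ \<alpha> z :: nat)" using \<beta> by simp
  qed
  then have p\<beta>: "potential \<beta> = (\<Sum>v\<in>U. 2 ^ \<beta> v * weight \<alpha> v)" unfolding pot by (intro sum.cong) auto
  have split: "(\<Sum>v\<in>U. f v) = f x + (f y + (\<Sum>v\<in>U - {x} - {y}. f v))" for f :: "'d \<Rightarrow> nat"
    using U by (simp add: sum.remove[of U x] sum.remove[of "U - {x}" y])
  have rest: "(\<Sum>v\<in>U - {x} - {y}. 2 ^ \<beta> v * weight \<alpha> v) = (\<Sum>v\<in>U - {x} - {y}. 2 ^ \<alpha> v * weight \<alpha> v)"
    using \<beta>(3) by (intro sum.cong) auto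
  have "2 ^ \<alpha> y * weight \<alpha> x + 2 ^ \<alpha> x * weight \<alpha> y \<le> 2 ^ \<alpha> x * weight \<alpha> x + 2 ^ \<alpha> y * weight \<alpha> y"
    using le unfolding p\<beta> unfolding pot split rest \<beta>(1,2) by linarith
  moreover obtain d where "weight \<alpha> x = weight \<alpha> y + Suc d" using less by (metis less_iff_Suc_add add_Suc_right)
  ultimately have "2 ^ \<alpha> y * Suc d \<le> 2 ^ \<alpha> x * Suc d" by (simp add: algebra_simps)
  then have "(2::nat) ^ \<alpha> y \<le> 2 ^ \<alpha> x" by (simp only: mult_le_cancel2) 
  then show False using xy by simp
qed

text \<open>At the highest-ranked vertex where the neighbourhoods of \<open>x\<close> and
  \<open>y\<close> differ, the later vertex \<open>y\<close> has the edge. It is phrased from a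
  neighbour \<open>z\<close> missing at \<open>y\<close>, as ladders are extended.\<close>

definition doubly_lexical :: "('d \<Rightarrow> nat) \<Rightarrow> bool" where
  "doubly_lexical \<alpha> \<longleftrightarrow> (\<forall>x y z. (x \<in> V \<longleftrightarrow> y \<in> V) \<and> \<alpha> x < \<alpha> y \<and> adj x z \<and> \<not> adj y z \<longrightarrow>
     (\<exists>z'. adj y z' \<and> \<not> adj x z' \<and> \<alpha> z < \<alpha> z' \<and> (\<forall>z''. \<alpha> z' < \<alpha> z'' \<longrightarrow> (adj x z'' \<longleftrightarrow> adj y z''))))"

text \<open>Take a bijection maximising the potential. If the highest difference belonged to the
  earlier vertex, that vertex would have the larger weight, against
  \<open>weight_mono\<close>.\<close>

lemma doubly_lexical_exists:
  "\<exists>\<alpha>. bij_betw \<alpha> UNIV {..<CARD('d)} \<and> doubly_lexical \<alpha>"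
proof -
  let ?S = "{\<alpha>. bij_betw \<alpha> (UNIV :: 'd set) {..<CARD('d)}}"
  have "?S \<subseteq> UNIV \<rightarrow>\<^sub>E {..<CARD('d)}" by (auto simp: bij_betw_def)
  then have fin: "finite ?S" by (rule finite_subset) (intro finite_PiE, auto)
  have ne: "?S \<noteq> {}" using ex_bij_betw_finite_nat[of "UNIV :: 'd set"] by (auto simp: atLeast0LessThan)
  have "Max (potential ` ?S) \<in> potential ` ?S" using fin ne by (intro Max_in) auto
  then obtain \<alpha> where \<alpha>: "\<alpha> \<in> ?S" "Max (potential ` ?S) = potential \<alpha>" by blast
  have max: "potential \<beta> \<le> potential \<alpha>" if "bij_betw \<beta> UNIV {..<CARD('d)}" for \<beta>
    unfolding \<alpha>(2)[symmetric] using fin that by (intro Max_ge) auto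
  have bij: "bij_betw \<alpha> UNIV {..<CARD('d)}" using \<alpha> by simp
  then have inj: "inj \<alpha>" by (simp add: bij_betw_def)
  have "\<exists>z'. adj y z' \<and> \<not> adj x z' \<and> \<alpha> z < \<alpha> z' \<and> (\<forall>z''. \<alpha> z' < \<alpha> z'' \<longrightarrow> (adj x z'' \<longleftrightarrow> adj y z''))"
    if xy: "x \<in> V \<longleftrightarrow> y \<in> V" "\<alpha> x < \<alpha> y" and z: "adj x z" "\<not> adj y z" for x y z
  proof -
    let ?D = "{z. adj x z \<noteq> adj y z}"
    have "z \<in> ?D" using z by simp
    then have "Max (\<alpha> ` ?D) \<in> \<alpha> ` ?D" by (intro Max_in) auto
    then obtain z' where z': "z' \<in> ?D" "Max (\<alpha> ` ?D) = \<alpha> z'" by blast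
    have top: "\<alpha> v \<le> \<alpha> z'" if "v \<in> ?D" for v
      unfolding z'(2)[symmetric] using that by (intro Max_ge) auto
    then have agree: "adj x v \<longleftrightarrow> adj y v" if "\<alpha> z' < \<alpha> v" for v
      using that by fastforce
    have "adj y z'"
    proof (rule ccontr)
      assume ny: "\<not> adj y z'"
      then have "adj x z'" using z' by simp
      \<comment> \<open>Above \<open>z'\<close> the neighbourhoods agree; what \<open>y\<close> has
        below is worth less than the bit of \<open>z'\<close>, which only \<open>x\<close>
        has.\<close>
      let ?C = "{v. adj x v \<and> \<alpha> z' < \<alpha> v}" and ?L = "{v. adj y v \<and> \<alpha> v < \<alpha> z'}"
      have "{v. adj y v} = ?C \<union> ?L"
      proof (intro equalityI subsetI)
        fix v assume v: "v \<in> {v. adj y v}"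
        then have "\<alpha> v \<noteq> \<alpha> z'" using ny inj by (auto dest: injD)
        then show "v \<in> ?C \<union> ?L" using v agree[of v] by auto
      qed (use agree in auto)
      moreover have "?C \<inter> ?L = {}" by auto
      ultimately have "weight \<alpha> y = (\<Sum>v\<in>?C. 2 ^ \<alpha> v) + (\<Sum>v\<in>?L. 2 ^ \<alpha> v)"
        unfolding weight_def by (simp add: sum.union_disjoint)
      moreover have "(\<Sum>v\<in>?L. 2 ^ \<alpha> v) < (2 ^ \<alpha> z' :: nat)"
        using inj by (intro sum_pow2_less) (auto intro: inj_on_subset)
      moreover have "(\<Sum>v\<in>insert z' ?C. 2 ^ \<alpha> v) \<le> weight \<alpha> x"
        unfolding weight_def using \<open>adj x z'\<close> by (intro sum_mono2) auto
      moreover have "(\<Sum>v\<in>insert z' ?C. 2 ^ \<alpha> v) = 2 ^ \<alpha> z' + (\<Sum>v\<in>?C. 2 ^ \<alpha> v :: nat)" by simp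
      ultimately have "weight \<alpha> y < weight \<alpha> x" by linarith
      then show False using weight_mono[OF max bij xy] by simp
    qed
    moreover have "z \<noteq> z'" using calculation z by auto
    then have "\<alpha> z < \<alpha> z'" using top[OF \<open>z \<in> ?D\<close>] inj by (auto simp: order_less_le dest: injD)
    ultimately show ?thesis using z' agree by blast
  qed
  then show ?thesis using bij unfolding doubly_lexical_def by blast
qed

text \<open>A doubly lexical ordering that is not Gamma-free yields, step by step, ever longer
  induced paths \<open>\<dots> r\<^sub>2 c\<^sub>1 r\<^sub>0 c\<^sub>0 r\<^sub>1 c\<^sub>2 \<dots>\<close>; when the two ends meet, this is a chordless cycle.\<close>

definition ladder :: "('d \<Rightarrow> nat) \<Rightarrow> nat \<Rightarrow> (nat \<Rightarrow> 'd) \<Rightarrow> (nat \<Rightarrow> 'd) \<Rightarrow> bool" where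
  "ladder \<alpha> m r c \<longleftrightarrow>
     (\<forall>a\<le>m. r a \<in> V \<and> c a \<in> W) \<and>
     (\<forall>a<m. \<alpha> (r a) < \<alpha> (r (Suc a)) \<and> \<alpha> (c a) < \<alpha> (c (Suc a))) \<and>
     (\<forall>a\<le>m. \<forall>b\<le>m. (a, b) \<noteq> (m, m) \<longrightarrow> (adj (r a) (c b) \<longleftrightarrow> a = 0 \<and> b = 0 \<or> a = Suc b \<or> b = Suc a)) \<and>
     (\<forall>a z. a + 2 \<le> m \<longrightarrow> (\<alpha> (c (a + 2)) < \<alpha> z \<longrightarrow> (adj (r a) z \<longleftrightarrow> adj (r (Suc a)) z)) \<and>
       (\<alpha> (r (a + 2)) < \<alpha> z \<longrightarrow> (adj (c a) z \<longleftrightarrow> adj (c (Suc a)) z)))"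

text \<open>The rows \<open>r p\<close> and \<open>r m\<close> differ at \<open>c m\<close>, so the
  lexical condition supplies a later column \<open>C\<close> seen by \<open>r m\<close> but not by
  \<open>r p\<close>; exchanging rows and columns supplies \<open>R\<close>. Whether
  \<open>R\<close> and \<open>C\<close> are adjacent stays open, which is the corner excluded in
  \<open>ladder\<close>.\<close>

lemma ladder_extend:
  assumes lex: "doubly_lexical \<alpha>" and lad: "ladder \<alpha> m r c" and m: "1 \<le> m" and nadj: "\<not> adj (r m) (c m)"
  shows "\<exists>r' c'. ladder \<alpha> (Suc m) r' c'"
proof -
  obtain p where p: "m = Suc p" using m by (cases m) auto
  have side: "\<And>a. a \<le> m \<Longrightarrow> r a \<in> V" "\<And>a. a \<le> m \<Longrightarrow> c a \<in> W"
    and inc: "\<And>a. a < m \<Longrightarrow> \<alpha> (r a) < \<alpha> (r (Suc a))" "\<And>a. a < m \<Longrightarrow> \<alpha> (c a) < \<alpha> (c (Suc a))"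
    and adj: "\<And>a b. a \<le> m \<Longrightarrow> b \<le> m \<Longrightarrow> (a, b) \<noteq> (m, m) \<Longrightarrow> adj (r a) (c b) \<longleftrightarrow> a = 0 \<and> b = 0 \<or> a = Suc b \<or> b = Suc a"
    and agr: "\<And>a z. a + 2 \<le> m \<Longrightarrow> \<alpha> (c (a + 2)) < \<alpha> z \<Longrightarrow> adj (r a) z \<longleftrightarrow> adj (r (Suc a)) z"
    and agc: "\<And>a z. a + 2 \<le> m \<Longrightarrow> \<alpha> (r (a + 2)) < \<alpha> z \<Longrightarrow> adj (c a) z \<longleftrightarrow> adj (c (Suc a)) z"
    using lad unfolding ladder_def by blast+
  have sides: "r p \<in> V" "r m \<in> V" "c p \<in> W" "c m \<in> W" using side p by auto
  have "adj (r p) (c m)" using adj[of p m] p by simp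
  then obtain C where C: "adj (r m) C" "\<not> adj (r p) C" "\<alpha> (c m) < \<alpha> C"
    and C': "\<And>z. \<alpha> C < \<alpha> z \<Longrightarrow> adj (r p) z \<longleftrightarrow> adj (r m) z"
    using lex[unfolded doubly_lexical_def, rule_format, of "r p" "r m" "c m"] inc(1)[of p] nadj sides p by blast
  have "adj (c p) (r m)" using adj[of m p] p by (simp add: adj_commute)
  moreover have "\<not> adj (c m) (r m)" using nadj by (simp add: adj_commute)
  ultimately obtain R where R: "adj (c m) R" "\<not> adj (c p) R" "\<alpha> (r m) < \<alpha> R"
    and R': "\<And>z. \<alpha> R < \<alpha> z \<Longrightarrow> adj (c p) z \<longleftrightarrow> adj (c m) z"
    using lex[unfolded doubly_lexical_def, rule_format, of "c p" "c m" "r m"] inc(2)[of p] sides p W_iff by blast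
  have mono: "\<alpha> (r a) \<le> \<alpha> (r m)" "\<alpha> (c a) \<le> \<alpha> (c m)" if "a \<le> m" for a
    using that by (induction rule: inc_induct) (auto intro: order_trans[OF less_imp_le[OF inc(1)]] order_trans[OF less_imp_le[OF inc(2)]])
  \<comment> \<open>Downward from \<open>a = p\<close>: \<open>C\<close> lies beyond
    \<open>c (a + 2)\<close>, where the rows \<open>r a\<close> and \<open>r (Suc a)\<close>
    agree.\<close>
  have rC: "\<not> adj (r a) C" if "a \<le> p" for a
    using that
  proof (induction rule: inc_induct)
    case (step a)
    have "\<alpha> (c (a + 2)) \<le> \<alpha> (c m)" using mono(2)[of "a + 2"] step p by simp
    then show ?case using agr[of a C] C(3) step p by auto
  qed (use C in simp)
  have cR: "\<not> adj (c a) R" if "a \<le> p" for a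
    using that
  proof (induction rule: inc_induct)
    case (step a)
    have "\<alpha> (r (a + 2)) \<le> \<alpha> (r m)" using mono(1)[of "a + 2"] step p by simp
    then show ?case using agc[of a R] R(3) step p by auto
  qed (use R in simp)
  define r' where "r' = r(Suc m := R)"
  define c' where "c' = c(Suc m := C)"
  have CR: "C \<in> W" "R \<in> V" using edge_sides C(1) R(1) sides W_iff by blast+
  have "ladder \<alpha> (Suc m) r' c'"
    unfolding ladder_def
  proof (intro conjI allI impI)
    fix a assume "a \<le> Suc m"
    then show "r' a \<in> V" "c' a \<in> W" using side CR by (auto simp: r'_def c'_def le_Suc_eq)
  next
    fix a assume "a < Suc m"
    then show "\<alpha> (r' a) < \<alpha> (r' (Suc a))" "\<alpha> (c' a) < \<alpha> (c' (Suc a))"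
      using inc C R by (auto simp: r'_def c'_def less_Suc_eq)
  next
    fix a b assume ab: "a \<le> Suc m" "b \<le> Suc m" "(a, b) \<noteq> (Suc m, Suc m)"
    consider "a \<le> m" "b \<le> m" | "a = Suc m" "b \<le> m" | "a \<le> m" "b = Suc m" using ab by force
    then show "adj (r' a) (c' b) \<longleftrightarrow> a = 0 \<and> b = 0 \<or> a = Suc b \<or> b = Suc a"
    proof cases
      case 1
      then show ?thesis using adj[of a b] nadj m by (cases "(a, b) = (m, m)") (auto simp: r'_def c'_def)
    next
      case 2
      then show ?thesis using R(1) cR[of b] p by (cases "b = m") (auto simp: r'_def c'_def adj_commute)
    next
      case 3
      then show ?thesis using C(1) rC[of a] p by (cases "a = m") (auto simp: r'_def c'_def)
    qed
  next
    fix a z assume a: "a + 2 \<le> Suc m" 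
    show "adj (r' a) z \<longleftrightarrow> adj (r' (Suc a)) z" if "\<alpha> (c' (a + 2)) < \<alpha> z"
      using a that C' agr[of a z] p by (cases "a = p") (auto simp: r'_def c'_def)
    show "adj (c' a) z \<longleftrightarrow> adj (c' (Suc a)) z" if "\<alpha> (r' (a + 2)) < \<alpha> z"
      using a that R' agc[of a z] p by (cases "a = p") (auto simp: r'_def c'_def)
  qed
  then show ?thesis by blast
qed

text \<open>Together with the closing edge, the adjacencies of a ladder are exactly those of
  consecutive vertices on the path, so no chord is left.\<close>

lemma ladder_chordless_cycle:
  assumes lad: "ladder \<alpha> m r c" and m: "2 \<le> m" and closed: "adj (r m) (c m)"
  shows "\<exists>vs. is_cycle E vs \<and> 6 \<le> length vs \<and> \<not> has_chord E vs"
proof -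
  have side: "\<And>a. a \<le> m \<Longrightarrow> r a \<in> V" "\<And>a. a \<le> m \<Longrightarrow> c a \<in> W"
    and inc: "\<And>a. a < m \<Longrightarrow> \<alpha> (r a) < \<alpha> (r (Suc a))" "\<And>a. a < m \<Longrightarrow> \<alpha> (c a) < \<alpha> (c (Suc a))"
    and adj0: "\<And>a b. a \<le> m \<Longrightarrow> b \<le> m \<Longrightarrow> (a, b) \<noteq> (m, m) \<Longrightarrow> adj (r a) (c b) \<longleftrightarrow> a = 0 \<and> b = 0 \<or> a = Suc b \<or> b = Suc a"
    using lad unfolding ladder_def by blast+
  have adj: "adj (r a) (c b) \<longleftrightarrow> a = 0 \<and> b = 0 \<or> a = Suc b \<or> b = Suc a \<or> a = m \<and> b = m" if "a \<le> m" "b \<le> m" for a b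
    using adj0[OF that] closed by (cases "(a, b) = (m, m)") auto
  have strict: "\<alpha> (r a) < \<alpha> (r b) \<and> \<alpha> (c a) < \<alpha> (c b)" if "a < b" "b \<le> m" for a b
    using that
  proof (induction b)
    case (Suc b)
    then show ?case using inc[of b] by (cases "a = b") (auto dest: order.strict_trans)
  qed simp
  have r_inj: "a = b" if "r a = r b" "a \<le> m" "b \<le> m" for a b
    using strict[of a b] strict[of b a] that by (cases a b rule: linorder_cases) auto
  have c_inj: "a = b" if "c a = c b" "a \<le> m" "b \<le> m" for a b
    using strict[of a b] strict[of b a] that by (cases a b rule: linorder_cases) auto
  \<comment> \<open>The two arms of the path: \<open>x\<close> runs through r0, c1, r2 and so on,
    \<open>y\<close> through c0, r1, c2. The map \<open>node\<close> walks down \<open>x\<close> and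
    then up \<open>y\<close>.\<close>
  define x where "x a = (if even a then r a else c a)" for a
  define y where "y a = (if even a then c a else r a)" for a
  define node where "node t = (if t \<le> m then x (m - t) else y (t - m - 1))" for t
  define n where "n = 2 * m + 2"
  define vs where "vs = map node [0..<n]"
  have len: "length vs = n" by (simp add: vs_def)
  have nth: "vs ! t = node t" if "t < n" for t using that by (simp add: vs_def)
  have xx: "adj (x (Suc a)) (x a)" "adj (y a) (y (Suc a))" if "a < m" for a
    using that adj[of a "Suc a"] adj[of "Suc a" a] by (auto simp: x_def y_def adj_commute)
  have xy: "adj (x 0) (y 0)" "adj (y m) (x m)"
    using adj[of 0 0] closed by (auto simp: x_def y_def adj_commute)
  have cedge: "{node t, node (Suc t mod n)} \<in> cycle_edges vs" if "t < n" for t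
  proof -
    have "Suc t mod n < n" by (simp add: n_def)
    then show ?thesis unfolding cycle_edges_def len using that nth by (intro CollectI exI[of _ t]) auto
  qed
  have cx: "{x (Suc a), x a} \<in> cycle_edges vs" if "a < m" for a
    using cedge[of "m - Suc a"] that by (simp add: node_def n_def Suc_diff_Suc)
  have cy: "{y a, y (Suc a)} \<in> cycle_edges vs" if "a < m" for a
    using cedge[of "m + 1 + a"] that by (simp add: node_def n_def)
  have c0: "{x 0, y 0} \<in> cycle_edges vs" using cedge[of m] by (simp add: node_def n_def)
  have cm: "{y m, x m} \<in> cycle_edges vs" using cedge[of "2 * m + 1"] by (simp add: node_def n_def)
  have sub: "cycle_edges vs \<subseteq> E"
  proof
    fix e assume "e \<in> cycle_edges vs"
    then obtain t where t: "t < n" "e = {vs ! t, vs ! (Suc t mod n)}" by (auto simp: cycle_edges_def len)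
    have "Suc t mod n < n" by (simp add: n_def)
    then have e: "e = {node t, node (Suc t mod n)}" using t nth by simp
    consider "t < m" | "t = m" | "m < t" "t < 2 * m + 1" | "t = 2 * m + 1" using t by (force simp: n_def)
    then show "e \<in> E"
    proof cases
      case 1
      then have "e = {x (Suc (m - Suc t)), x (m - Suc t)}" using e by (simp add: node_def n_def Suc_diff_Suc)
      then show ?thesis using xx(1)[of "m - Suc t"] 1 by simp
    next
      case 2
      then show ?thesis using e xy by (simp add: node_def n_def)
    next
      case 3
      then have "e = {y (t - m - 1), y (Suc (t - m - 1))}" using e by (simp add: node_def n_def Suc_diff_Suc)
      then show ?thesis using xx(2)[of "t - m - 1"] 3 by simp
    next
      case 4
      then show ?thesis using e xy by (simp add: node_def n_def)
    qed
  qed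
  \<comment> \<open>The positions of \<open>r a\<close> and \<open>c a\<close> in \<open>vs\<close>;
    the parity of \<open>a\<close> tells on which arm the vertex lies.\<close>
  define pr where "pr a = (if even a then m - a else m + 1 + a)" for a
  define pc where "pc a = (if even a then m + 1 + a else m - a)" for a
  have rc: "(\<exists>a\<le>m. node t = r a \<and> t = pr a) \<or> (\<exists>a\<le>m. node t = c a \<and> t = pc a)" if "t < n" for t
  proof (cases "t \<le> m")
    case True
    then show ?thesis
      by (cases "even (m - t)") (auto simp: node_def x_def pr_def pc_def intro!: exI[of _ "m - t"])
  next
    case False
    then show ?thesis using that
      by (cases "even (t - m - 1)") (auto simp: node_def y_def n_def pr_def pc_def intro!: exI[of _ "t - m - 1"])
  qed
  have "inj_on node {..<n}"
  proof (rule inj_onI)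
    fix t t' assume t: "t \<in> {..<n}" "t' \<in> {..<n}" "node t = node t'"
    have disj: "r a \<noteq> c b" if "a \<le> m" "b \<le> m" for a b using side that W_iff by metis
    have "t < n" "t' < n" using t by auto
    from rc[OF this(1)] rc[OF this(2)] t(3) show "t = t'"
      using r_inj c_inj disj by metis
  qed
  then have "distinct vs" by (simp add: vs_def distinct_map atLeast0LessThan)
  then have cyc: "is_cycle E vs" using sub m by (simp add: is_cycle_def len n_def)
  have "\<not> has_chord E vs"
  proof
    assume "has_chord E vs"
    then obtain e where e: "e \<in> E" "e \<subseteq> set vs" "e \<notin> cycle_edges vs" by (auto simp: has_chord_def)
    obtain v w where vw: "v \<in> V" "w \<in> W" "e = {v, w}" using E[OF e(1)] by blast
    have set_vs: "set vs = node ` {..<n}" by (auto simp: vs_def)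
    obtain t t' where t: "t < n" "v = node t" and t': "t' < n" "w = node t'"
      using e(2) unfolding vw(3) set_vs by auto
    obtain a where a: "a \<le> m" "v = r a" using rc[OF t(1)] t(2) side(2) vw(1) W_iff by metis
    obtain b where b: "b \<le> m" "w = c b" using rc[OF t'(1)] t'(2) side(1) vw(2) W_iff by metis
    have "e = {r a, c b}" using vw a b by simp
    have "e \<in> cycle_edges vs"
    proof -
      consider "a = 0" "b = 0" | "a = Suc b" | "b = Suc a" | "a = m" "b = m"
        using adj[OF a(1) b(1)] e(1) \<open>e = {r a, c b}\<close> by auto
      then show ?thesis
      proof cases
        case 1
        then show ?thesis using c0 \<open>e = {r a, c b}\<close> by (simp add: x_def y_def)
      next
        case 2
        then show ?thesis using cx[of b] cy[of b] a \<open>e = {r a, c b}\<close>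
          by (cases "even b") (auto simp: x_def y_def insert_commute)
      next
        case 3
        then show ?thesis using cx[of a] cy[of a] b \<open>e = {r a, c b}\<close>
          by (cases "even a") (auto simp: x_def y_def insert_commute)
      next
        case 4
        then show ?thesis using cm \<open>e = {r a, c b}\<close>
          by (cases "even m") (auto simp: x_def y_def insert_commute)
      qed
    qed
    then show False using e by simp
  qed
  then show ?thesis using cyc m by (intro exI[of _ vs]) (simp add: len n_def)
qed

text \<open>A violation is a ladder with \<open>m = 1\<close> that does not close. A longer ladder
  cannot close either, since that would give a chordless cycle, so it can be extended forever
  although its ranks increase strictly.\<close>

lemma gamma_free_ordering:
  assumes chordal: "\<And>vs. is_cycle E vs \<Longrightarrow> 6 \<le> length vs \<Longrightarrow> has_chord E vs"
  shows "\<exists>\<alpha>. bij_betw \<alpha> UNIV {..<CARD('d)} \<and>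
    (\<forall>v\<in>V. \<forall>v'\<in>V. \<forall>w\<in>W. \<forall>w'\<in>W. \<alpha> v < \<alpha> v' \<longrightarrow> \<alpha> w < \<alpha> w' \<longrightarrow> adj v w \<longrightarrow> adj v w' \<longrightarrow> adj v' w \<longrightarrow> adj v' w')"
proof -
  obtain \<alpha> where bij: "bij_betw \<alpha> UNIV {..<CARD('d)}" and lex: "doubly_lexical \<alpha>"
    using doubly_lexical_exists by blast
  have "adj v' w'" if *: "v \<in> V" "v' \<in> V" "w \<in> W" "w' \<in> W" "\<alpha> v < \<alpha> v'" "\<alpha> w < \<alpha> w'" "adj v w" "adj v w'" "adj v' w"
    for v v' w w'
  proof (rule ccontr)
    assume nadj: "\<not> adj v' w'"
    have "\<exists>r c. ladder \<alpha> (Suc m) r c \<and> \<not> adj (r (Suc m)) (c (Suc m))" for m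
    proof (induction m)
      case 0
      define r where "r a = (if a = 0 then v else v')" for a :: nat
      define c where "c a = (if a = 0 then w else w')" for a :: nat
      have "ladder \<alpha> (Suc 0) r c"
        using * by (auto simp: ladder_def r_def c_def le_Suc_eq)
      moreover have "\<not> adj (r (Suc 0)) (c (Suc 0))" using nadj by (simp add: r_def c_def)
      ultimately show ?case by blast
    next
      case (Suc m)
      then obtain r c where rc: "ladder \<alpha> (Suc m) r c" "\<not> adj (r (Suc m)) (c (Suc m))" by blast
      obtain r' c' where rc': "ladder \<alpha> (Suc (Suc m)) r' c'"
        using ladder_extend[OF lex rc(1) _ rc(2)] by auto
      have "\<not> adj (r' (Suc (Suc m))) (c' (Suc (Suc m)))"
        using ladder_chordless_cycle[OF rc'] chordal by auto
      then show ?case using rc' by blast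
    qed
    \<comment> \<open>Long enough that index \<open>CARD('d)\<close> still lies in the increasing
      range, forcing a rank outside the image of \<open>\<alpha>\<close>.\<close>
    then obtain r c where lad: "ladder \<alpha> (Suc CARD('d)) r c" by blast
    have "a \<le> \<alpha> (r a)" if "a \<le> Suc CARD('d)" for a
      using that
    proof (induction a)
      case (Suc a)
      then have "\<alpha> (r a) < \<alpha> (r (Suc a))" using lad by (simp add: ladder_def)
      then show ?case using Suc by simp
    qed simp
    from this[of "CARD('d)"] have "CARD('d) \<le> \<alpha> (r CARD('d))" by simp
    moreover have "\<alpha> (r CARD('d)) < CARD('d)" using bij by (auto simp: bij_betw_def)
    ultimately show False by simp
  qed
  then show ?thesis using bij by blast
qed

end

section \<open>A quadratic reverse lexicographic order\<close>

text \<open>Linearity gives compatibility with products and joint injectivity gives totality;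
  comparing the degree first makes 1 the least monomial.\<close>

lemma monomial_order_lex_functionals:
  fixes g :: "nat \<Rightarrow> 'v \<Rightarrow> int"
  assumes g0: "g 0 = (\<lambda>_. 1)"
    and inj: "\<And>m n. m \<in> monomials A \<Longrightarrow> n \<in> monomials A \<Longrightarrow> (\<And>k. wt (g k) m = wt (g k) n) \<Longrightarrow> m = n"
  shows "monomial_order A {(m, n). m \<in> monomials A \<and> n \<in> monomials A \<and>
    (m = n \<or> (\<exists>k. wt (g k) m < wt (g k) n \<and> (\<forall>j<k. wt (g j) m = wt (g j) n)))}"
    (is "monomial_order A ?r")
proof -
  define less where "less m n \<longleftrightarrow> (\<exists>k. wt (g k) m < wt (g k) n \<and> (\<forall>j<k. wt (g j) m = wt (g j) n))" for m n
  define r where "r = ?r"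
  have r: "r = {(m, n). m \<in> monomials A \<and> n \<in> monomials A \<and> (m = n \<or> less m n)}"
    by (simp add: less_def r_def)
  have less_trans: "less m k" if mnk: "less m n" "less n k" for m n k
  proof -
    obtain a b where a: "wt (g a) m < wt (g a) n" "\<forall>j<a. wt (g j) m = wt (g j) n"
      and b: "wt (g b) n < wt (g b) k" "\<forall>j<b. wt (g j) n = wt (g j) k"
      using mnk unfolding less_def by blast
    show ?thesis
      unfolding less_def using a b
      by (intro exI[of _ "min a b"]) (cases a b rule: linorder_cases, auto simp: min_def)
  qed
  have less_irrefl: "\<not> less m m" for m by (simp add: less_def)
  have less_total: "less m n \<or> less n m" if "m \<in> monomials A" "n \<in> monomials A" "m \<noteq> n" for m n
  proof -
    have ex: "\<exists>k. wt (g k) m \<noteq> wt (g k) n" using inj that by blast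
    define k where "k = (LEAST k. wt (g k) m \<noteq> wt (g k) n)"
    have "wt (g k) m \<noteq> wt (g k) n" unfolding k_def by (rule LeastI_ex[OF ex])
    moreover have "\<forall>j<k. wt (g j) m = wt (g j) n" unfolding k_def using not_less_Least by blast
    ultimately show ?thesis unfolding less_def by (metis linorder_neqE)
  qed
  have "trans r" unfolding r trans_def using less_trans by blast
  moreover have "antisym r" unfolding r antisym_def using less_trans less_irrefl by blast
  moreover have "total_on (monomials A) r" unfolding r total_on_def using less_total by auto
  moreover have "refl_on (monomials A) r" unfolding r refl_on_def by auto
  moreover have "r \<subseteq> monomials A \<times> monomials A" by (auto simp: r)
  moreover have "(0, m) \<in> r" if "m \<in> monomials A" for m
  proof (cases "m = 0")
    case False
    then have "0 < mdeg m" using mdeg_eq_0_iff[of m] by blast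
    then have "less 0 m" unfolding less_def by (intro exI[of _ 0]) (simp add: g0 flip: int_mdeg)
    then show ?thesis using that by (simp add: r)
  qed (simp add: r)
  moreover have "(m + k, n + k) \<in> r" if "(m, n) \<in> r" "k \<in> monomials A" for m n k
    using that by (auto simp: r less_def wt_add)
  ultimately have "monomial_order A r"
    unfolding monomial_order_def linear_order_on_def partial_order_on_def preorder_on_def by blast
  then show ?thesis by (simp add: r_def)
qed

lemma keys_two:
  fixes m :: "'v monom"
  assumes "a \<in> keys m" "b \<in> keys m" "a \<noteq> b"
  shows "\<exists>k. m = k + (var a + var b)"
proof -
  let ?k = "m - var a - var b"
  have "m = ?k + (var a + var b)"
    using assms by (intro poly_mapping_eqI)
      (auto simp: lookup_add lookup_minus lookup_single in_keys_iff when_def)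
  then show ?thesis by blast
qed

lemma wt_abs_le: "\<bar>wt g m\<bar> \<le> wt (\<lambda>a. \<bar>g a\<bar>) m"
proof -
  have "\<bar>wt g m\<bar> \<le> (\<Sum>a\<in>keys m. \<bar>int (lookup m a) * g a\<bar>)"
    unfolding wt_def by (rule sum_abs)
  then show ?thesis by (simp add: wt_def abs_mult)
qed

lemma wt_scale: "wt (\<lambda>a. c * g a) m = c * wt g m"
  by (simp add: wt_def sum_distrib_left algebra_simps)

lemma wt_abs_same_sign:
  assumes "\<And>a b. a \<in> keys m \<Longrightarrow> b \<in> keys m \<Longrightarrow> 0 \<le> g a * g b"
  shows "wt (\<lambda>a. \<bar>g a\<bar>) m = \<bar>wt g m\<bar>"
proof (cases "\<exists>a\<in>keys m. g a < 0")
  case True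
  then obtain a where a: "a \<in> keys m" "g a < 0" by blast
  have neg: "g b \<le> 0" if "b \<in> keys m" for b
    using assms[OF a(1) that] a(2) by (auto simp: zero_le_mult_iff)
  have "wt (\<lambda>a. \<bar>g a\<bar>) m = wt (\<lambda>a. (-1) * g a) m" using neg by (intro wt_cong) auto
  also have "\<dots> = - wt g m" by (subst wt_scale) simp
  finally have eq: "wt (\<lambda>a. \<bar>g a\<bar>) m = - wt g m" .
  have "wt (\<lambda>a. \<bar>g a\<bar>) m \<ge> 0" unfolding wt_def by (intro sum_nonneg) auto
  then show ?thesis using eq by simp
next
  case False
  then have "wt (\<lambda>a. \<bar>g a\<bar>) m = wt g m" by (intro wt_cong) auto
  moreover have "wt (\<lambda>a. \<bar>g a\<bar>) m \<ge> 0" unfolding wt_def by (intro sum_nonneg) auto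
  ultimately show ?thesis by simp
qed

text \<open>Equality in the triangle inequality: each summand has the sign of the total.\<close>

lemma wt_sign:
  assumes "wt (\<lambda>a. \<bar>g a\<bar>) m = \<bar>wt g m\<bar>" "b \<in> keys m"
  shows "\<bar>g b\<bar> = sgn (wt g m) * g b"
proof -
  let ?s = "sgn (wt g m)"
  have "wt (\<lambda>a. \<bar>g a\<bar> - ?s * g a) m = \<bar>wt g m\<bar> - ?s * wt g m"
    by (simp add: wt_fun_diff wt_scale assms(1))
  also have "\<dots> = 0" by (simp add: abs_sgn mult.commute)
  finally have z: "wt (\<lambda>a. \<bar>g a\<bar> - ?s * g a) m = 0" .
  have "0 \<le> \<bar>g a\<bar> - ?s * g a" for a by (auto simp: sgn_if)
  from wt_nonneg_eq_0[of m "\<lambda>a. \<bar>g a\<bar> - ?s * g a", OF this z assms(2)] show ?thesis by simp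
qed

locale gamma_free = bipartite_graph E V W for E :: "'d::finite set set" and V W +
  fixes \<alpha> :: "'d \<Rightarrow> nat"
  assumes bij: "bij_betw \<alpha> UNIV {..<CARD('d)}"
    and gamma: "\<And>v v' w w'. v \<in> V \<Longrightarrow> v' \<in> V \<Longrightarrow> w \<in> W \<Longrightarrow> w' \<in> W \<Longrightarrow> \<alpha> v < \<alpha> v' \<Longrightarrow> \<alpha> w < \<alpha> w' \<Longrightarrow>
      {v, w} \<in> E \<Longrightarrow> {v, w'} \<in> E \<Longrightarrow> {v', w} \<in> E \<Longrightarrow> {v', w'} \<in> E"
begin

abbreviation A where "A \<equiv> clique_vectors E"

text \<open>A vector without support on one side gets the last rank there, as if it used an extra vertex
  adjacent to the whole other side.\<close>

definition rk :: "'d set \<Rightarrow> int ^ 'd \<Rightarrow> nat" where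
  "rk U a = Min (insert CARD('d) (\<alpha> ` {i \<in> U. a $ i \<noteq> 0}))"

definition l1 :: "int ^ 'd \<Rightarrow> int" where
  "l1 a = (\<Sum>i\<in>UNIV. \<bar>a $ i\<bar>)"

lemma alpha_less: "\<alpha> i < CARD('d)"
  using bij by (auto simp: bij_betw_def)

lemma alpha_inj: "\<alpha> i = \<alpha> j \<longleftrightarrow> i = j"
  using bij by (auto simp: bij_betw_def inj_eq)

lemma A_edge: "a \<in> A \<Longrightarrow> i \<noteq> j \<Longrightarrow> a $ i \<noteq> 0 \<Longrightarrow> a $ j \<noteq> 0 \<Longrightarrow> {i, j} \<in> E"
  by (simp add: clique_vectors_def)

lemma A_side: "a \<in> A \<Longrightarrow> U = V \<or> U = W \<Longrightarrow> i \<in> U \<Longrightarrow> j \<in> U \<Longrightarrow> a $ i \<noteq> 0 \<Longrightarrow> a $ j \<noteq> 0 \<Longrightarrow> i = j"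
  using A_edge edge_sides W_iff by blast

lemma A_abs: "a \<in> A \<Longrightarrow> \<bar>a $ i\<bar> = (if a $ i = 0 then 0 else 1)"
  unfolding clique_vectors_def by (auto dest!: spec[of _ i])

lemma rk_cases:
  assumes "a \<in> A" "U = V \<or> U = W"
  obtains "rk U a = CARD('d)" "\<And>i. i \<in> U \<Longrightarrow> a $ i = 0"
  | i where "i \<in> U" "a $ i \<noteq> 0" "rk U a = \<alpha> i" "\<And>j. j \<in> U \<Longrightarrow> j \<noteq> i \<Longrightarrow> a $ j = 0"
proof (cases "\<exists>i\<in>U. a $ i \<noteq> 0")
  case True
  then obtain i where i: "i \<in> U" "a $ i \<noteq> 0" by blast
  have oth: "a $ j = 0" if "j \<in> U" "j \<noteq> i" for j using A_side[OF assms] i that by metis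
  then have e: "{i \<in> U. a $ i \<noteq> 0} = {i}" using i by auto
  have "rk U a = \<alpha> i" unfolding rk_def e using alpha_less[of i] by (simp add: min_def)
  then show ?thesis using that(2) i oth by blast
next
  case False
  then have e: "{i \<in> U. a $ i \<noteq> 0} = {}" by auto
  have "rk U a = CARD('d)" unfolding rk_def e by simp
  then show ?thesis using that(1) False by blast
qed

lemma rk_le: "rk U a \<le> CARD('d)"
  by (simp add: rk_def)

lemma rk_eq_alpha_iff:
  assumes "a \<in> A" "U = V \<or> U = W" "i \<in> U"
  shows "rk U a = \<alpha> i \<longleftrightarrow> a $ i \<noteq> 0"
  using assms(1,2)
proof (cases rule: rk_cases)
  case 1
  then show ?thesis using alpha_less[of i] assms(3) by auto
next
  case (2 j)
  then show ?thesis using assms(3) by (auto simp: alpha_inj)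
qed

text \<open>A vector has at most one nonzero entry on a side. Thus counting variables without
  support on \<open>U\<close> is an affine expression in absolute values, as needed in
  \<open>exists_larger\<close>.\<close>

lemma rk_eq_d_iff:
  assumes "a \<in> A" "U = V \<or> U = W"
  shows "(if rk U a = CARD('d) then 1 else 0) = 1 - (\<Sum>i\<in>U. \<bar>a $ i\<bar>)"
  using assms
proof (cases rule: rk_cases)
  case 1
  then show ?thesis by simp
next
  case (2 i)
  have "(\<Sum>i\<in>U. \<bar>a $ i\<bar>) = \<bar>a $ i\<bar>" using 2 by (subst sum.remove[of U i]) auto
  then show ?thesis using 2 alpha_less[of i] A_abs[OF assms(1), of i] by simp
qed

definition idx :: "int ^ 'd \<Rightarrow> nat" where
  "idx = (SOME f. inj_on f A \<and> f ` A \<subseteq> {..<Suc (card A)})"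

lemma idx: "inj_on idx A" "\<And>a. a \<in> A \<Longrightarrow> idx a < Suc (card A)"
proof -
  obtain f where "bij_betw f A {0..<card A}"
    using ex_bij_betw_finite_nat[OF finite_clique_vectors] by blast
  then have "inj_on f A \<and> f ` A \<subseteq> {..<Suc (card A)}" by (auto simp: bij_betw_def)
  from someI[of "\<lambda>f. inj_on f A \<and> f ` A \<subseteq> {..<Suc (card A)}", OF this]
  show "inj_on idx A" "\<And>a. a \<in> A \<Longrightarrow> idx a < Suc (card A)"
    unfolding idx_def by auto
qed

text \<open>A two-digit number in base \<open>Suc CARD('d)\<close>, since ranks go up to
  \<open>CARD('d)\<close>: the \<open>V\<close>-rank is compared first, then the
  \<open>W\<close>-rank.\<close>

definition prio :: "int ^ 'd \<Rightarrow> nat" where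
  "prio a = rk V a * Suc CARD('d) + rk W a"

text \<open>The extra digit separates vectors with equal support and different signs, which makes
  the ordering strict.\<close>

definition \<rho> :: "int ^ 'd \<Rightarrow> nat" where
  "\<rho> a = prio a * Suc (card A) + idx a"

lemma rho_div: "a \<in> A \<Longrightarrow> \<rho> a div Suc (card A) = prio a"
  using idx(2)[of a] by (simp only: \<rho>_def div_mult_self3 div_less)

lemma rho_mod: "a \<in> A \<Longrightarrow> \<rho> a mod Suc (card A) = idx a"
  using idx(2)[of a] by (simp only: \<rho>_def mod_mult_self3 mod_less)

lemma prio_div: "prio a div Suc CARD('d) = rk V a"
  using le_imp_less_Suc[OF rk_le[of W a]] by (simp only: prio_def div_mult_self3 div_less)

lemma rho_inj: "a \<in> A \<Longrightarrow> b \<in> A \<Longrightarrow> \<rho> a = \<rho> b \<longleftrightarrow> a = b"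
  using rho_mod idx(1) by (metis inj_onD)

lemma rho_less_prio: "a \<in> A \<Longrightarrow> b \<in> A \<Longrightarrow> \<rho> a < \<rho> b \<Longrightarrow> prio a \<le> prio b"
  using rho_div div_le_mono less_imp_le by metis

lemma rho_less_rkV: "a \<in> A \<Longrightarrow> b \<in> A \<Longrightarrow> \<rho> a < \<rho> b \<Longrightarrow> rk V a \<le> rk V b"
  using rho_less_prio prio_div div_le_mono by metis

lemma rho_less_rkW: "a \<in> A \<Longrightarrow> b \<in> A \<Longrightarrow> \<rho> a < \<rho> b \<Longrightarrow> rk V a = rk V b \<Longrightarrow> rk W a \<le> rk W b"
  using rho_less_prio[of a b] by (simp add: prio_def)

lemma rkV_less_rho: "a \<in> A \<Longrightarrow> b \<in> A \<Longrightarrow> rk V a < rk V b \<Longrightarrow> \<rho> a < \<rho> b"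
  using rho_less_rkV[of b a] rho_inj[of a b] by (cases "\<rho> a" "\<rho> b" rule: linorder_cases) auto

text \<open>Exponents enter with a negative sign and in increasing order of \<open>\<rho>\<close>, so among monomials of
  equal degree and norm the one with more of the first variable is smaller.\<close>

definition fnl :: "nat \<Rightarrow> int ^ 'd \<Rightarrow> int" where
  "fnl k = (if k = 0 then (\<lambda>_. 1) else if k = 1 then l1 else (\<lambda>a. if Suc (Suc (\<rho> a)) = k then -1 else 0))"

lemma wt_fnl_rho:
  assumes "m \<in> monomials A" "a \<in> A"
  shows "wt (fnl (Suc (Suc (\<rho> a)))) m = - int (lookup m a)"
proof -
  have "wt (fnl (Suc (Suc (\<rho> a)))) m = (\<Sum>b\<in>A. int (lookup m b) * fnl (Suc (Suc (\<rho> a))) b)"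
    using assms finite_clique_vectors by (intro wt_superset) (auto simp: monomials_def)
  also have "\<dots> = (\<Sum>b\<in>A. if b = a then - int (lookup m a) else 0)"
    using assms(2) by (intro sum.cong) (auto simp: fnl_def rho_inj)
  finally show ?thesis using assms(2) by (simp add: finite_clique_vectors)
qed

lemma wt_fnl_other:
  assumes "m \<in> monomials A" "\<And>a. a \<in> A \<Longrightarrow> k \<noteq> \<rho> a"
  shows "wt (fnl (Suc (Suc k))) m = 0"
  using assms unfolding wt_def by (intro sum.neutral) (auto simp: fnl_def monomials_def)

definition revlex :: "(int ^ 'd) monom rel" where
  "revlex = {(m, n). m \<in> monomials A \<and> n \<in> monomials A \<and>
    (m = n \<or> (\<exists>k. wt (fnl k) m < wt (fnl k) n \<and> (\<forall>j<k. wt (fnl j) m = wt (fnl j) n)))}"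

lemma monomial_order_revlex: "monomial_order A revlex"
  unfolding revlex_def
proof (rule monomial_order_lex_functionals)
  show "fnl 0 = (\<lambda>_. 1)" by (simp add: fnl_def)
next
  fix m n assume mn: "m \<in> monomials A" "n \<in> monomials A" and eq: "\<And>k. wt (fnl k) m = wt (fnl k) n"
  show "m = n"
  proof (rule poly_mapping_eqI)
    fix a
    show "lookup m a = lookup n a"
    proof (cases "a \<in> A")
      case True
      then show ?thesis using eq[of "Suc (Suc (\<rho> a))"] mn by (simp add: wt_fnl_rho)
    next
      case False
      then show ?thesis using mn by (metis in_keys_iff monomials_def mem_Collect_eq subsetD)
    qed
  qed
qed

sublocale monom_order A revlex
  using monomial_order_revlex finite_clique_vectors by unfold_locales

lemma l1_wt: "wt l1 m = (\<Sum>i\<in>UNIV. wt (\<lambda>a. \<bar>a $ i\<bar>) m)"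
  unfolding l1_def by (rule wt_fun_sum)

text \<open>Deleting the two opposite entries keeps both vectors in \<open>A\<close>, preserves sum
  and degree, and lowers the norm.\<close>

lemma cancelling_pair_not_std:
  assumes "a \<in> A" "b \<in> A" "a $ i * b $ i < 0"
  shows "\<not> std (var a + var b)"
proof -
  define a' where "a' = a - axis i (a $ i)"
  define b' where "b' = b - axis i (b $ i)"
  have ab: "a $ i + b $ i = 0" using A_abs[OF assms(1), of i] A_abs[OF assms(2), of i] assms(3)
    by (auto simp: mult_less_0_iff split: if_splits)
  have mem: "a' \<in> A" "b' \<in> A"
    using assms(1,2) by (auto simp: a'_def b'_def clique_vectors_def axis_nth_if)
  have l1: "l1 (c - axis i (c $ i)) = l1 c - \<bar>c $ i\<bar>" for c
  proof -
    have "l1 c = \<bar>c $ i\<bar> + (\<Sum>j\<in>UNIV - {i}. \<bar>c $ j\<bar>)" unfolding l1_def by (simp add: sum.remove)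
    moreover have "l1 (c - axis i (c $ i)) = (\<Sum>j\<in>UNIV - {i}. \<bar>c $ j\<bar>)"
      unfolding l1_def by (subst sum.remove[of _ i]) (auto simp: axis_nth_if intro!: sum.cong)
    ultimately show ?thesis by simp
  qed
  have "tdeg (var a' + var b') = tdeg (var a + var b)"
    using ab by (auto simp: tdeg_add a'_def b'_def vec_eq_iff axis_nth_if)
  moreover have "lt (var a' + var b') (var a + var b)"
  proof -
    have "a $ i \<noteq> 0" "b $ i \<noteq> 0" using assms(3) by auto
    then have less: "wt (fnl 1) (var a' + var b') < wt (fnl 1) (var a + var b)"
      using l1[of a] l1[of b] by (simp add: fnl_def wt_add a'_def b'_def)
    moreover have "\<forall>j<1. wt (fnl j) (var a' + var b') = wt (fnl j) (var a + var b)"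
      by (simp add: fnl_def wt_add)
    ultimately have "(var a' + var b', var a + var b) \<in> revlex"
      using mem assms(1,2) unfolding revlex_def by auto
    then show ?thesis using less by auto
  qed
  ultimately show ?thesis using not_std_if_smaller by blast
qed

text \<open>How many variables have a given rank on \<open>U\<close> is determined by degree and
  coordinate norms, hence equal for \<open>u\<close> and \<open>v\<close>. A surplus of
  \<open>a\<close> in \<open>v\<close> must be balanced in \<open>u\<close> by another variable of
  the same rank.\<close>

lemma exists_larger:
  assumes um: "u \<in> monomials A" and vm: "v \<in> monomials A" and mdeg: "mdeg u = mdeg v"
    and N: "\<And>i. wt (\<lambda>a. \<bar>a $ i\<bar>) u = wt (\<lambda>a. \<bar>a $ i\<bar>) v"
    and a: "a \<in> A" "lookup u a < lookup v a" and U: "U = V \<or> U = W"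
  shows "\<exists>l\<in>A. rk U l = rk U a \<and> lookup v l < lookup u l"
proof (rule ccontr)
  assume no: "\<not> ?thesis"
  define \<phi> where "\<phi> b = (if rk U b = rk U a then 1 else 0 :: int)" for b
  have keysA: "b \<in> A" if "b \<in> keys m" "m \<in> monomials A" for b m
    using that by (auto simp: monomials_def)
  have "wt \<phi> u = wt \<phi> v"
    using a(1) U
  proof (cases rule: rk_cases)
    case 1
    have "wt \<phi> m = int (mdeg m) - (\<Sum>i\<in>U. wt (\<lambda>a. \<bar>a $ i\<bar>) m)" if "m \<in> monomials A" for m
    proof -
      have "wt \<phi> m = wt (\<lambda>b. 1 - (\<Sum>i\<in>U. \<bar>b $ i\<bar>)) m"
        using rk_eq_d_iff[OF keysA U] that 1(1) by (intro wt_cong) (simp add: \<phi>_def)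
      then show ?thesis by (simp add: wt_fun_diff wt_fun_sum int_mdeg)
    qed
    then show ?thesis using um vm mdeg N by simp
  next
    case (2 i)
    have "wt \<phi> m = wt (\<lambda>a. \<bar>a $ i\<bar>) m" if "m \<in> monomials A" for m
      using rk_eq_alpha_iff[OF keysA U 2(1)] A_abs[OF keysA] that 2(3) by (intro wt_cong) (simp add: \<phi>_def)
    then show ?thesis using um vm N by simp
  qed
  moreover have "wt \<phi> u < wt \<phi> v"
  proof -
    have "wt \<phi> u = (\<Sum>b\<in>A. int (lookup u b) * \<phi> b)" "wt \<phi> v = (\<Sum>b\<in>A. int (lookup v b) * \<phi> b)"
      using um vm finite_clique_vectors by (auto simp: monomials_def intro!: wt_superset)
    moreover have "(\<Sum>b\<in>A. int (lookup u b) * \<phi> b) < (\<Sum>b\<in>A. int (lookup v b) * \<phi> b)"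
      using no a finite_clique_vectors
      by (intro sum_strict_mono_ex1) (auto simp: \<phi>_def not_less intro!: bexI[of _ a])
    ultimately show ?thesis by simp
  qed
  ultimately show False by simp
qed

text \<open>\<open>a\<close> joins the \<open>V\<close>-part of \<open>l\<close> with the
  \<open>W\<close>-part of \<open>k\<close>; \<open>f\<close> takes the two remaining parts.
  Gamma-freeness makes \<open>f\<close> a lattice point, so \<open>x_l x_k\<close> can be replaced
  by the smaller \<open>x_a x_f\<close>.\<close>

lemma exchange_not_std:
  assumes A: "a \<in> A" "l \<in> A" "k \<in> A"
    and eqV: "\<And>i. i \<in> V \<Longrightarrow> l $ i = a $ i" and eqW: "\<And>i. i \<in> W \<Longrightarrow> k $ i = a $ i"
    and less: "rk W a < rk W l" "rk V a < rk V k"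
    and rho: "\<rho> a < \<rho> l" "\<rho> a < \<rho> k"
  shows "\<not> std (var l + var k)"
proof -
  define f where "f = (\<chi> i. if i \<in> V then k $ i else l $ i)"
  have fV: "f $ i = k $ i" if "i \<in> V" for i using that by (simp add: f_def)
  have fW: "f $ i = l $ i" if "i \<in> W" for i using that by (simp add: f_def W_iff)
  have edge: "{i, j} \<in> E" if ij: "i \<in> V" "j \<in> W" "k $ i \<noteq> 0" "l $ j \<noteq> 0" for i j
  proof -
    have rk: "rk V k = \<alpha> i" "rk W l = \<alpha> j" using rk_eq_alpha_iff[OF A(3), of V i] rk_eq_alpha_iff[OF A(2), of W j] ij by auto
    have "V = V \<or> V = W" "W = V \<or> W = W" by auto
    note cV = rk_cases[OF A(1) this(1)] and cW = rk_cases[OF A(1) this(2)]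
    \<comment> \<open>The ranks of \<open>a\<close> are strictly below those of actual vertices, so
      they are not the default \<open>CARD('d)\<close>, and \<open>a\<close> has a vertex on each
      side.\<close>
    obtain i0 where i0: "i0 \<in> V" "a $ i0 \<noteq> 0" "rk V a = \<alpha> i0" using cV less(2) rk alpha_less[of i] by (metis less_asym)
    obtain j0 where j0: "j0 \<in> W" "a $ j0 \<noteq> 0" "rk W a = \<alpha> j0" using cW less(1) rk alpha_less[of j] by (metis less_asym)
    have "i0 \<noteq> j0" "i0 \<noteq> j" "i \<noteq> j0" using i0 j0 ij W_iff by auto
    then have "{i0, j0} \<in> E" "{i0, j} \<in> E" "{i, j0} \<in> E"
      using A_edge[OF A(1)] A_edge[OF A(2)] A_edge[OF A(3)] eqV[OF i0(1)] eqW[OF j0(1)] i0 j0 ij by auto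
    then show ?thesis using gamma[of i0 i j0 j] i0 j0 ij less rk by simp
  qed
  have fA: "f \<in> A"
    unfolding clique_vectors_def
  proof (intro CollectI conjI allI impI)
    show "\<bar>f $ i\<bar> \<le> 1" for i using A by (auto simp: f_def clique_vectors_def)
    fix i j assume ij: "i \<noteq> j \<and> f $ i \<noteq> 0 \<and> f $ j \<noteq> 0"
    consider "i \<in> V" "j \<in> V" | "i \<in> W" "j \<in> W" | "i \<in> V" "j \<in> W" | "i \<in> W" "j \<in> V" using W_iff by blast
    then show "{i, j} \<in> E"
    proof cases
      case 1
      then show ?thesis using ij A_edge[OF A(3)] fV by auto
    next
      case 2
      then show ?thesis using ij A_edge[OF A(2)] fW by auto
    next
      case 3
      then show ?thesis using ij edge fV fW by auto
    next
      case 4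
      then show ?thesis using ij edge[of j i] fV fW by (auto simp: insert_commute)
    qed
  qed
  have comp: "a $ i + f $ i = l $ i + k $ i" "\<bar>a $ i\<bar> + \<bar>f $ i\<bar> = \<bar>l $ i\<bar> + \<bar>k $ i\<bar>" for i
    using eqV[of i] eqW[of i] fV[of i] fW[of i] W_iff[of i] by (cases "i \<in> V"; simp)+
  have td: "tdeg (var a + var f) = tdeg (var l + var k)"
    using comp by (simp add: tdeg_add vec_eq_iff)
  have "rk V f = rk V k" unfolding rk_def using fV by (metis (mono_tags, lifting))
  then have rf: "\<rho> a < \<rho> f" using less(2) rkV_less_rho[OF A(1) fA] by simp
  have l1: "l1 a + l1 f = l1 l + l1 k"
    unfolding l1_def by (simp add: comp flip: sum.distrib)
  \<comment> \<open>\<open>l\<close>, \<open>k\<close> and \<open>f\<close> all come after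
    \<open>a\<close>, so \<open>x_a\<close> is the first variable in which the products differ, and
    the negative sign favours the product containing it.\<close>
  let ?K = "Suc (Suc (\<rho> a))"
  have K: "wt (fnl ?K) (var a + var f) < wt (fnl ?K) (var l + var k)"
    using rho rf by (simp add: wt_add fnl_def)
  have "\<forall>j<?K. wt (fnl j) (var a + var f) = wt (fnl j) (var l + var k)"
    using rho rf l1 by (auto simp: wt_add fnl_def)
  then have "(var a + var f, var l + var k) \<in> revlex"
    using K A fA unfolding revlex_def by auto
  then have "lt (var a + var f) (var l + var k)" using K by auto
  then show ?thesis using not_std_if_smaller td by blast
qed

text \<open>Compare a nonstandard \<open>u\<close> with a smaller \<open>v\<close> in its fibre.
  Once cancelling pairs are excluded, the first variable \<open>a\<close> in which they differ
  supplies two variables of \<open>u\<close> that share one part each with \<open>a\<close>, and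
  \<open>exchange_not_std\<close> applies to them.\<close>

lemma quadratic_order_revlex: "quadratic_order A revlex"
  unfolding quadratic_order_def
proof (intro conjI ballI impI monomial_order_revlex)
  fix u assume u: "u \<in> monomials A" "\<not> std u"
  then obtain v where v: "lt v u" "tdeg v = tdeg u" by (rule not_std_smaller)
  then have vm: "v \<in> monomials A" using r_dom by blast
  have keysA: "b \<in> A" if "b \<in> keys u \<or> b \<in> keys v" for b
    using that u vm by (auto simp: monomials_def)
  have mdeg: "mdeg u = mdeg v" and tw: "\<And>i. wt (\<lambda>a. a $ i) v = wt (\<lambda>a. a $ i) u"
    using v(2) by (auto simp: tdeg_eq_iff)
  show "\<exists>a b k. a \<noteq> b \<and> u = k + (var a + var b) \<and> \<not> std (var a + var b)"
  proof (cases "\<exists>a b i. a \<in> keys u \<and> b \<in> keys u \<and> a $ i * b $ i < 0")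
    case True
    then obtain a b i where ab: "a \<in> keys u" "b \<in> keys u" "a $ i * b $ i < 0" by blast
    then have "a \<noteq> b" by (auto simp: mult_less_0_iff)
    then show ?thesis using keys_two[OF ab(1,2)] cancelling_pair_not_std keysA ab by metis
  next
    case False
    have Nu: "wt (\<lambda>a. \<bar>a $ i\<bar>) u = \<bar>wt (\<lambda>a. a $ i) u\<bar>" for i
      using False by (intro wt_abs_same_sign) (auto simp: not_less)
    \<comment> \<open>Without cancellation \<open>u\<close> attains the least norm possible in its
      fibre, in every coordinate.\<close>
    have Nle: "wt (\<lambda>a. \<bar>a $ i\<bar>) u \<le> wt (\<lambda>a. \<bar>a $ i\<bar>) v" for i
      unfolding Nu using wt_abs_le[of "\<lambda>a. a $ i" v] tw by simp
    then have l1le: "wt l1 u \<le> wt l1 v" unfolding l1_wt by (intro sum_mono) auto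
    obtain K where K: "wt (fnl K) v < wt (fnl K) u" "\<And>j. j < K \<Longrightarrow> wt (fnl j) v = wt (fnl j) u"
      using v(1) unfolding revlex_def by auto
    have "K \<noteq> 0"
    proof
      assume "K = 0"
      then show False using K(1) mdeg by (simp add: fnl_def flip: int_mdeg)
    qed
    moreover have "K \<noteq> 1"
    proof
      assume "K = 1"
      then show False using K(1) l1le by (simp add: fnl_def)
    qed
    ultimately obtain t where t: "K = Suc (Suc t)" by (metis One_nat_def old.nat.exhaust)
    \<comment> \<open>The first difference comes after degree and norm, so the total norms agree; by
      the coordinatewise inequality every coordinate norm agrees.\<close>
    have l1eq: "wt l1 u = wt l1 v" using K(2)[of 1] t by (simp add: fnl_def)
    have N: "wt (\<lambda>a. \<bar>a $ i\<bar>) u = wt (\<lambda>a. \<bar>a $ i\<bar>) v" for i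
      by (rule sum_mono_inv[OF l1eq[unfolded l1_wt] Nle]) auto
    \<comment> \<open>Both monomials are now free of cancellation, so each nonzero entry carries the
      sign of the fibre, and a variable is determined by its support.\<close>
    have sign: "b $ i = sgn (wt (\<lambda>a. a $ i) u)" if b: "b \<in> keys u \<or> b \<in> keys v" "b $ i \<noteq> 0" for b i
    proof -
      have "\<bar>b $ i\<bar> = sgn (wt (\<lambda>a. a $ i) u) * b $ i"
        using b(1) wt_sign[OF Nu, of b i] wt_sign[of "\<lambda>a. a $ i" v b] N[of i] Nu[of i] tw[of i] by auto
      then show ?thesis using A_abs[OF keysA[OF b(1)], of i] b(2) by (auto simp: sgn_if split: if_splits)
    qed
    obtain a where a: "a \<in> A" "t = \<rho> a"
      using K(1) wt_fnl_other[OF u(1), of t] wt_fnl_other[OF vm, of t] unfolding t by force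
    have av: "lookup u a < lookup v a"
      using K(1) wt_fnl_rho[OF u(1) a(1)] wt_fnl_rho[OF vm a(1)] unfolding t a(2) by simp
    have before: "lookup v c = lookup u c" if "c \<in> A" "\<rho> c < \<rho> a" for c
      using K(2)[of "Suc (Suc (\<rho> c))"] wt_fnl_rho[OF u(1) that(1)] wt_fnl_rho[OF vm that(1)] t a(2) that(2) by simp
    have aK: "a \<in> keys v" using av by (simp add: in_keys_iff)
    have same: "b $ i = a $ i" if "b \<in> keys u" "rk U b = rk U a" "i \<in> U" "U = V \<or> U = W" for b U i
    proof -
      have bA: "b \<in> A" using keysA that by blast
      have "b $ i \<noteq> 0 \<longleftrightarrow> a $ i \<noteq> 0"
        using rk_eq_alpha_iff[OF bA that(4,3)] rk_eq_alpha_iff[OF a(1) that(4,3)] that(2) by simp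
      then show ?thesis using sign[of b i] sign[of a i] that(1) aK by metis
    qed
    \<comment> \<open>The balancing variable cannot precede \<open>a\<close>, because before
      \<open>a\<close> the exponents of \<open>u\<close> and \<open>v\<close> coincide.\<close>
    have larger: "\<exists>l\<in>keys u. rk U l = rk U a \<and> \<rho> a < \<rho> l" if U: "U = V \<or> U = W" for U
    proof -
      obtain l where l: "l \<in> A" "rk U l = rk U a" "lookup v l < lookup u l"
        using exists_larger[OF u(1) vm mdeg N a(1) av U] by blast
      then have "\<not> \<rho> l < \<rho> a" "l \<noteq> a" using before[of l] av by auto
      then have "\<rho> a < \<rho> l" using rho_inj[OF a(1) l(1)] by auto
      moreover have "l \<in> keys u" using l by (simp add: in_keys_iff)
      ultimately show ?thesis using l by blast
    qed
    obtain l where l: "l \<in> keys u" "rk V l = rk V a" "\<rho> a < \<rho> l" using larger by blast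
    obtain k where k: "k \<in> keys u" "rk W k = rk W a" "\<rho> a < \<rho> k" using larger by blast
    have lk: "l \<in> A" "k \<in> A" using keysA l k by auto
    have eqV: "l $ i = a $ i" if "i \<in> V" for i using same[OF l(1,2) that] by simp
    have eqW: "k $ i = a $ i" if "i \<in> W" for i using same[OF k(1,2) that] by simp
    have "rk W l \<noteq> rk W a"
    proof
      assume "rk W l = rk W a"
      then have "l $ i = a $ i" for i using same[OF l(1), of W i] eqV[of i] W_iff by blast
      then have "l = a" by (simp add: vec_eq_iff)
      then show False using l(3) by simp
    qed
    then have lW: "rk W a < rk W l" using rho_less_rkW[OF a(1) lk(1) l(3)] l(2) by simp
    have "rk V k \<noteq> rk V a"
    proof
      assume "rk V k = rk V a"
      then have "k $ i = a $ i" for i using same[OF k(1), of V i] eqW[of i] W_iff by blast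
      then have "k = a" by (simp add: vec_eq_iff)
      then show False using k(3) by simp
    qed
    then have kV: "rk V a < rk V k" using rho_less_rkV[OF a(1) lk(2) k(3)] by simp
    have "\<not> std (var l + var k)" using exchange_not_std[OF a(1) lk eqV eqW lW kV l(3) k(3)] .
    moreover have "l \<noteq> k" using lW k(2) by auto
    ultimately show ?thesis using keys_two[OF l(1) k(1)] by metis
  qed
qed

end

theorem theorem2p4:
  fixes E :: "'d::finite set set"
    and I :: "(int ^ 'd, 'k::field) mpoly set"
    and R :: "('d, 'k) laurent set"
    and A :: "(int ^ 'd) set"
  assumes simple: "\<forall>e\<in>E. card e = 2"
    and bip: "bipartite E"
    and A: "A = lattice_points (graph_polytope E)"
    and I: "I = toric_ideal (graph_polytope E)"
    and R: "R = toric_ring (graph_polytope E)"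
  shows "(has_sqfree_quadratic_initial_ideal A I \<longleftrightarrow> koszul R) \<and>
    (koszul R \<longleftrightarrow> generated_by_quadratic_binomials A I) \<and>
    (generated_by_quadratic_binomials A I \<longleftrightarrow>
      (\<forall>vs. is_cycle E vs \<and> 6 \<le> length vs \<longrightarrow> has_chord E vs))"
proof -
  obtain V W where VW: "V \<union> W = UNIV" "V \<inter> W = {}" "\<forall>e\<in>E. \<exists>v\<in>V. \<exists>w\<in>W. e = {v, w}"
    using bip unfolding bipartite_def by blast
  interpret bipartite_graph E V W using VW by unfold_locales auto
  have A': "A = clique_vectors E" by (simp add: A lattice_points_graph_polytope)
  have I': "I = tor_ideal A" by (simp add: I toric_ideal_eq A)
  have R': "R = tor_ring A" by (simp add: R toric_ring_eq A)
  have fin: "finite A" by (simp add: A' finite_clique_vectors)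
  \<comment> \<open>The four conditions are linked in a cycle: (iii) gives (iv), (iv) gives (i), (i)
    gives (ii), and (ii) gives (iii).\<close>
  have "has_chord E vs" if "generated_by_quadratic_binomials A I" "is_cycle E vs" "6 \<le> length vs" for vs
  proof (rule ccontr)
    assume "\<not> has_chord E vs"
    then interpret chordless_cycle E V W vs using that by unfold_locales
    show False using not_generated_by_quadratic_binomials[where 'k = 'k] that(1) by (simp add: A' I')
  qed
  moreover have "has_sqfree_quadratic_initial_ideal A I"
    if chordal: "\<forall>vs. is_cycle E vs \<and> 6 \<le> length vs \<longrightarrow> has_chord E vs"
  proof -
    obtain \<alpha> where \<alpha>: "bij_betw \<alpha> UNIV {..<CARD('d)}"
      "\<forall>v\<in>V. \<forall>v'\<in>V. \<forall>w\<in>W. \<forall>w'\<in>W. \<alpha> v < \<alpha> v' \<longrightarrow> \<alpha> w < \<alpha> w' \<longrightarrow>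
        {v, w} \<in> E \<longrightarrow> {v, w'} \<in> E \<longrightarrow> {v', w} \<in> E \<longrightarrow> {v', w'} \<in> E"
      using gamma_free_ordering chordal by blast
    then have "gamma_free E V W \<alpha>" by unfold_locales blast+
    then have "\<exists>r. quadratic_order A r" unfolding A' using gamma_free.quadratic_order_revlex by blast
    then show ?thesis unfolding I' has_sqfree_quadratic_initial_ideal_iff[OF fin] .
  qed
  moreover have "koszul R" if "has_sqfree_quadratic_initial_ideal A I"
    using that koszul_if_quadratic_order[OF fin] unfolding I' R' has_sqfree_quadratic_initial_ideal_iff[OF fin] by blast
  moreover have "generated_by_quadratic_binomials A I" if "koszul R"
    using that koszul_imp_generated_by_quadratic_binomials unfolding I' R' by blast
  ultimately show ?thesis by blast
qed

end
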